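(* Let $\{W_t\}_{t\in\mathbb R}$ be a fractional Brownian motion, i.e. a zero-mean Gaussian process with covariance $$\mathbb E W_tW_s=\frac{\sigma^2}{2}\big(|t|^{2H}+|s|^{2H}-|t-s|^{2H}\big),\quad t,s\in\mathbb R,$$ where $0<H\le1$ and $\sigma>0$. Then the stationary Brown--Resnick process $X=\{X_t\}_{t\in\mathbb R}$ associated with $\{W_t\}_{t\in\mathbb R}$ is purely dissipative, and hence it has a mixed moving maxima representation.
   Context: A $1$-Fréchet random sup-measure $M_1$ with control measure $\mu$ on $S$ is a process indexed by measurable sets, independent over disjoint sets, a.s. $\sigma$-sup-additive over disjoint sets, with $P(M_1(A)\le x)=\exp(-\mu(A)x^{-1})$, $x>0$. The extremal integral $\int^e_Sf\,dM_1$ equals $\bigvee_ia_iM_1(A_i)$ for $f=\sum_ia_i\mathbf 1_{A_i}$ ($A_i$ disjoint, $a_i\ge0$), and is extended to all measurable $f\ge0$ with $\int f\,d\mu<\infty$ by continuity in probability; $P(\int^ef_i\,dM_1\le x_i,\,1\le i\le n)=\exp\{-\int_S\bigvee_ix_i^{-1}f_i\,d\mu\}$. Brown--Resnick process associated with a zero-mean Gaussian process $\{W_t\}_{t\in\mathbb R}$ (here taken with continuous paths) defined on a probability space $(E,\mathcal E,\mu)$, with $\sigma_t^2=\mathrm{Var}(W_t)$: the process with $$\{X_t\}_{t\in\mathbb R}\stackrel d=\Big\{\int^e_Ee^{W_t-\sigma_t^2/2}\,dM_1\Big\}_{t\in\mathbb R},$$ where $M_1$ is a $1$-Fréchet random sup-measure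 on $E$ with control measure $\mu$ (defined on a different probability space). It is stationary when $W$ has stationary increments. Given a jointly measurable representation $\{X_t\}_{t\in\mathbb R}\stackrel d=\{\int^e_Sf_t\,dM_1\}$ with control measure $\mu$, $X$ is purely dissipative if its conservative component is trivial, i.e. $\int_{\mathbb R}f_t(s)\,dt<\infty$ for $\mu$-a.e. $s\in S$ (this does not depend on the choice of jointly measurable representation; for stationary $X$ it means that $X$ is generated by a dissipative non-singular measurable flow). Mixed moving maxima representation: there exist a Borel space $W'$, a $\sigma$-finite measure $\nu$ on $W'$ and a measurable $g\ge0$ on $W'\times\mathbb R$ with $\int g\,d(\nu\otimes\lambda)<\infty$ ($\lambda$ Lebesgue measure) such that $\{X_t\}_{t\in\mathbb R}\stackrel d=\{\int^e_{W'\times\mathbb R}g(x,t+u)\,M_1(dx,du)\}_{t\in\mathbb R}$ with $M_1$ having control measure $\nu\otimes\lambda$. *)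

theory Defs
  imports "HOL-Probability.Probability"
begin

section \<open>Random sup-measures and extremal integrals\<close>

text \<open>
  A sup-measure is indexed by all measurable sets; it takes values in \<open>[0, \<infinity>]\<close>, because
  \<open>M A = \<infinity>\<close> almost surely when \<open>A\<close> has infinite control measure
  (the formula \<open>exp (- \<mu> A / x)\<close> is then read as \<open>0\<close>).
  The sup-measure lives on the probability space \<open>Q\<close>, its control measure is \<open>S\<close>.
  Independence over finitely many disjoint sets is the case of a sequence that is
  eventually empty.
\<close>

locale frechet_sup_measure = prob_space Q
  for Q :: "'q measure" +
  fixes S :: "'s measure" and M :: "'s set \<Rightarrow> 'q \<Rightarrow> ennreal"
  assumes measurable: "A \<in> sets S \<Longrightarrow> M A \<in> borel_measurable Q"
    and indep_disjoint:
      "range B \<subseteq> sets S \<Longrightarrow> disjoint_family B \<Longrightarrow>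
        indep_vars (\<lambda>_. borel) (\<lambda>i::nat. M (B i)) UNIV"
    and sup_additive:
      "range B \<subseteq> sets S \<Longrightarrow> disjoint_family B \<Longrightarrow>
        AE \<omega> in Q. M (\<Union>i::nat. B i) \<omega> = (SUP i. M (B i) \<omega>)"
    and frechet:
      "A \<in> sets S \<Longrightarrow> x > 0 \<Longrightarrow>
        prob {\<omega> \<in> space Q. M A \<omega> \<le> ennreal x} =
          (if emeasure S A = \<infinity> then 0 else exp (- measure S A / x))"

text \<open>
  For \<open>h = \<Sum>i. a i * indicator (A i)\<close> the level sets of \<open>h\<close> serve as the disjoint
  \<open>A i\<close>; another disjoint decomposition changes the value only on a null set.
  Note that \<open>0 * \<infinity> = 0\<close> in \<^typ>\<open>ennreal\<close>, so the zero level set does not contribute.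
  If \<open>h\<close> is integrable, the supremum is almost surely finite.
\<close>

definition simple_extremal_integral ::
    "'s measure \<Rightarrow> ('s set \<Rightarrow> 'q \<Rightarrow> ennreal) \<Rightarrow> ('s \<Rightarrow> real) \<Rightarrow> 'q \<Rightarrow> real" where
  "simple_extremal_integral S M h \<omega> =
     enn2real (SUP a \<in> h ` space S. ennreal a * M (h -` {a} \<inter> space S) \<omega>)"

definition tendsto_in_prob ::
    "'q measure \<Rightarrow> (nat \<Rightarrow> 'q \<Rightarrow> real) \<Rightarrow> ('q \<Rightarrow> real) \<Rightarrow> bool" where
  "tendsto_in_prob Q Z Y \<longleftrightarrow>
     (\<forall>\<epsilon>>0. (\<lambda>n. measure Q {\<omega> \<in> space Q. \<bar>Z n \<omega> - Y \<omega>\<bar> > \<epsilon>}) \<longlonglongrightarrow> 0)"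

text \<open>
  \<open>Y\<close> is a version of the extremal integral of \<open>f\<close>: the limit in probability of the integrals
  of simple functions that converge to \<open>f\<close> in \<open>L\<^sup>1\<close>.  The limit is determined up to null sets
  and does not depend on the approximating sequence.
\<close>

definition has_extremal_integral ::
    "'q measure \<Rightarrow> 's measure \<Rightarrow> ('s set \<Rightarrow> 'q \<Rightarrow> ennreal) \<Rightarrow> ('s \<Rightarrow> real) \<Rightarrow> ('q \<Rightarrow> real) \<Rightarrow> bool" where
  "has_extremal_integral Q S M f Y \<longleftrightarrow>
     integrable S f \<and> (\<forall>s\<in>space S. f s \<ge> 0) \<and> Y \<in> borel_measurable Q \<and>
     (\<exists>h :: nat \<Rightarrow> 's \<Rightarrow> real.
        (\<forall>n. simple_function S (h n) \<and> integrable S (h n) \<and> (\<forall>s\<in>space S. h n s \<ge> 0)) \<and>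
        (\<lambda>n. \<integral>s. \<bar>h n s - f s\<bar> \<partial>S) \<longlonglongrightarrow> 0 \<and>
        tendsto_in_prob Q (\<lambda>n. simple_extremal_integral S M (h n)) Y)"


section \<open>Processes indexed by the real line\<close>

definition real_process :: "'w measure \<Rightarrow> (real \<Rightarrow> 'w \<Rightarrow> real) \<Rightarrow> bool" where
  "real_process P X \<longleftrightarrow> prob_space P \<and> (\<forall>t. X t \<in> borel_measurable P)"

definition eq_fdd ::
    "'w measure \<Rightarrow> (real \<Rightarrow> 'w \<Rightarrow> real) \<Rightarrow> 'q measure \<Rightarrow> (real \<Rightarrow> 'q \<Rightarrow> real) \<Rightarrow> bool" where
  "eq_fdd P X Q Y \<longleftrightarrow>
     (\<forall>J. finite J \<longrightarrow>
        distr P (\<Pi>\<^sub>M t\<in>J. borel) (\<lambda>\<omega>. \<lambda>t\<in>J. X t \<omega>) =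
        distr Q (\<Pi>\<^sub>M t\<in>J. borel) (\<lambda>\<omega>. \<lambda>t\<in>J. Y t \<omega>))"

text \<open>
  The process \<open>X\<close> has the same law as the process of extremal integrals of the spectral
  functions \<open>f t\<close>, with respect to a sup-measure \<open>M\<close> on \<open>Q\<close> with control measure \<open>S\<close>.
\<close>

definition extremal_representation ::
    "'w measure \<Rightarrow> (real \<Rightarrow> 'w \<Rightarrow> real) \<Rightarrow> 'q measure \<Rightarrow> 's measure \<Rightarrow> ('s set \<Rightarrow> 'q \<Rightarrow> ennreal) \<Rightarrow>
      (real \<Rightarrow> 's \<Rightarrow> real) \<Rightarrow> bool" where
  "extremal_representation P X Q S M f \<longleftrightarrow>
     real_process P X \<and> frechet_sup_measure Q S M \<and>
     (\<exists>Y. (\<forall>t. has_extremal_integral Q S M (f t) (Y t)) \<and> eq_fdd P X Q Y)"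

definition jointly_measurable_representation ::
    "'w measure \<Rightarrow> (real \<Rightarrow> 'w \<Rightarrow> real) \<Rightarrow> 'q measure \<Rightarrow> 's measure \<Rightarrow> ('s set \<Rightarrow> 'q \<Rightarrow> ennreal) \<Rightarrow>
      (real \<Rightarrow> 's \<Rightarrow> real) \<Rightarrow> bool" where
  "jointly_measurable_representation P X Q S M f \<longleftrightarrow>
     sigma_finite_measure S \<and> extremal_representation P X Q S M f \<and>
     (\<lambda>(t, s). f t s) \<in> borel_measurable (borel \<Otimes>\<^sub>M S)"

text \<open>
  Pure dissipativity of \<open>X\<close>, read off from a given jointly measurable representation; the
  property of \<open>X\<close> is the same for every choice of that representation.
\<close>

definition purely_dissipative ::
    "'w measure \<Rightarrow> (real \<Rightarrow> 'w \<Rightarrow> real) \<Rightarrow> 'q measure \<Rightarrow> 's measure \<Rightarrow> ('s set \<Rightarrow> 'q \<Rightarrow> ennreal) \<Rightarrow>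
      (real \<Rightarrow> 's \<Rightarrow> real) \<Rightarrow> bool" where
  "purely_dissipative P X Q S M f \<longleftrightarrow>
     jointly_measurable_representation P X Q S M f \<and>
     (AE s in S. (\<integral>\<^sup>+t. ennreal (f t s) \<partial>lborel) < \<infinity>)"

definition mixed_moving_maxima_representation ::
    "'w measure \<Rightarrow> (real \<Rightarrow> 'w \<Rightarrow> real) \<Rightarrow> 'q measure \<Rightarrow> 'b::polish_space measure \<Rightarrow>
      (('b \<times> real) set \<Rightarrow> 'q \<Rightarrow> ennreal) \<Rightarrow> ('b \<times> real \<Rightarrow> real) \<Rightarrow> bool" where
  "mixed_moving_maxima_representation P X Q \<nu> M g \<longleftrightarrow>
     sets \<nu> = sets borel \<and> sigma_finite_measure \<nu> \<and>
     g \<in> borel_measurable (\<nu> \<Otimes>\<^sub>M lborel) \<and> (\<forall>z. g z \<ge> 0) \<and>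
     (\<integral>\<^sup>+z. ennreal (g z) \<partial>(\<nu> \<Otimes>\<^sub>M lborel)) < \<infinity> \<and>
     extremal_representation P X Q (\<nu> \<Otimes>\<^sub>M lborel) M (\<lambda>t (x, u). g (x, t + u))"

text \<open>
  HOL cannot quantify existentially over types, so the Borel space and the underlying set of the
  probability space carrying the sup-measure are both taken to be \<open>\<real>\<^sup>\<nat>\<close>.  For the Borel space
  this is no restriction: every Borel space is isomorphic to a Borel subset of \<open>\<real>\<^sup>\<nat>\<close>, and
  \<open>\<nu>\<close> extends by \<open>0\<close> to the complement.  For the probability space neither the sigma-algebra
  nor the measure is prescribed.
\<close>

definition has_mixed_moving_maxima_representation ::
    "'w measure \<Rightarrow> (real \<Rightarrow> 'w \<Rightarrow> real) \<Rightarrow> bool" where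
  "has_mixed_moving_maxima_representation P X \<longleftrightarrow>
     (\<exists>(Q :: (nat \<Rightarrow> real) measure) (\<nu> :: (nat \<Rightarrow> real) measure) M g.
        mixed_moving_maxima_representation P X Q \<nu> M g)"


section \<open>Gaussian processes and Brown--Resnick processes\<close>

text \<open>Normal distributions may be degenerate: a fractional Brownian motion vanishes at time 0.\<close>

definition gaussian_rv :: "'e measure \<Rightarrow> ('e \<Rightarrow> real) \<Rightarrow> bool" where
  "gaussian_rv E Z \<longleftrightarrow> Z \<in> borel_measurable E \<and>
     ((\<exists>m. AE \<omega> in E. Z \<omega> = m) \<or>
      (\<exists>m s. s > 0 \<and> distributed E lborel Z (\<lambda>x. ennreal (normal_density m s x))))"

definition gaussian_process :: "'e measure \<Rightarrow> (real \<Rightarrow> 'e \<Rightarrow> real) \<Rightarrow> bool" where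
  "gaussian_process E W \<longleftrightarrow> real_process E W \<and>
     (\<forall>J c. finite J \<longrightarrow> gaussian_rv E (\<lambda>\<omega>. \<Sum>t\<in>J. c t * W t \<omega>))"

definition zero_mean_gaussian_process :: "'e measure \<Rightarrow> (real \<Rightarrow> 'e \<Rightarrow> real) \<Rightarrow> bool" where
  "zero_mean_gaussian_process E W \<longleftrightarrow>
     gaussian_process E W \<and> (\<forall>t. prob_space.expectation E (W t) = 0)"

definition fractional_brownian_motion ::
    "'e measure \<Rightarrow> (real \<Rightarrow> 'e \<Rightarrow> real) \<Rightarrow> real \<Rightarrow> real \<Rightarrow> bool" where
  "fractional_brownian_motion E W H \<sigma> \<longleftrightarrow>
     zero_mean_gaussian_process E W \<and>
     (\<forall>t s. prob_space.expectation E (\<lambda>\<omega>. W t \<omega> * W s \<omega>) =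
        \<sigma>\<^sup>2 / 2 * (\<bar>t\<bar> powr (2 * H) + \<bar>s\<bar> powr (2 * H) - \<bar>t - s\<bar> powr (2 * H)))"

definition brown_resnick_spectral_function ::
    "'e measure \<Rightarrow> (real \<Rightarrow> 'e \<Rightarrow> real) \<Rightarrow> real \<Rightarrow> 'e \<Rightarrow> real" where
  "brown_resnick_spectral_function E W t \<omega> =
     exp (W t \<omega> - prob_space.variance E (W t) / 2)"

text \<open>
  \<open>X\<close> (on \<open>P\<close>) is the Brown--Resnick process associated with \<open>W\<close> (on \<open>E\<close>), where the
  sup-measure \<open>M\<close> is defined on a further probability space \<open>Q\<close> and has control measure \<open>E\<close>.
\<close>

definition brown_resnick_process ::
    "'w measure \<Rightarrow> (real \<Rightarrow> 'w \<Rightarrow> real) \<Rightarrow> 'e measure \<Rightarrow> (real \<Rightarrow> 'e \<Rightarrow> real) \<Rightarrow>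
      'q measure \<Rightarrow> ('e set \<Rightarrow> 'q \<Rightarrow> ennreal) \<Rightarrow> bool" where
  "brown_resnick_process P X E W Q M \<longleftrightarrow>
     zero_mean_gaussian_process E W \<and>
     (\<forall>\<omega>\<in>space E. continuous_on UNIV (\<lambda>t. W t \<omega>)) \<and>
     extremal_representation P X Q E M (brown_resnick_spectral_function E W)"

end

theory Submission
  imports Defs "HOL-Real_Asymp.Real_Asymp"
begin

text \<open>
  Write \<open>v t = \<sigma>\<^sup>2 \<bar>t\<bar> powr (2 * H)\<close> for the variance of \<open>W t\<close> and \<open>f t = exp (W t - v t / 2)\<close> for the
  spectral functions.

  \<^bold>\<open>Pure dissipativity.\<close> The expectation of \<open>f t\<close> is \<open>1\<close>, so the integral of \<open>f\<close> over the line
  has infinite expectation; but the expectation of \<open>sqrt (f t)\<close> is \<open>exp (- v t / 8)\<close>, which is tiny for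
  large \<open>\<bar>t\<bar>\<close>. This controls \<open>f\<close> at the integers. Between integers one factors
  \<open>f (n + u) = f n * (f (n + u) / f n)\<close>: the second factor has bounded expectation, because the increments
  are stationary and \<open>v\<close> grows away from \<open>0\<close>. With the weight \<open>exp (v n / 16)\<close> on \<open>sqrt (f n)\<close> and
  the weight \<open>exp (- v n / 16)\<close> on the integral of the second factor over \<open>0 \<le> u < 1\<close>, both series over \<open>n\<close> converge almost
  surely, and their sums bound the integral of \<open>f\<close> (\<open>suminf_le_weighted\<close>, \<open>AE_spectral_integral_finite\<close>).

  \<^bold>\<open>Mixed moving maxima.\<close> Let \<open>Z\<close> be the integral of \<open>f\<close> over the line, finite by the first part.
  The law of a process of extremal integrals depends on the spectral functions only through the
  expectations of the maxima of \<open>c t * f t\<close> over finite sets of times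
  (\<open>prob_extremal_integrals\<close>, \<open>eq_fdd_extremal_integrals\<close>). In such an expectation insert
  \<open>1 = \<integral> f s / Z ds\<close> and exchange the integrals. For fixed \<open>s\<close> the factor \<open>f s\<close> is a change of measure under
  which the path \<open>f / f s\<close> has the law of the original path shifted by \<open>s\<close>
  (\<open>tilted_distr\<close>). The rest of the integrand, a maximum of \<open>c t * f t / Z\<close>, is unchanged when
  \<open>f\<close> is multiplied by a constant, so the expectation becomes the one of
  \<open>c t * f (t - s) / Z\<close>, integrated over \<open>s\<close>. This is the expression belonging to the moving maxima
  \<open>g (x, u) = f u / Z\<close>, where \<open>x\<close> is the path, distributed as the path of \<open>f\<close>
  (\<open>spectral_SUP_eq_moving_maxima\<close>). Since the paths are continuous, \<open>x\<close> can be encoded by its values at the dyadic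
  rationals, an element of \<open>\<real>\<^sup>\<nat>\<close>.

  Two tools are built on the way. The change of measure rests on the fact that the joint
  law of real random variables is determined by their exponential moments
  (\<open>distr_eqI_exp_moments\<close>), because these are explicit for Gaussian
  processes. The sup-measure of the new representation is the one of de Haan: the supremum of \<open>1 / \<gamma>\<close> over the
  points \<open>(\<gamma>, s)\<close> of a Poisson process with \<open>s\<close> in the given set; only the
  probabilities that the process avoids a set enter (\<open>frechet_point_sup_measure\<close>).
\<close>

section \<open>Laws determined by exponential moments\<close>

text \<open>Once the lower coefficients vanish, division by \<open>x ^ n\<close> leaves a power series that vanishes off \<open>0\<close>;
  its continuity at \<open>0\<close> gives the next coefficient.\<close>

lemma powser_zero_imp_coeff_zero:
  fixes a :: "nat \<Rightarrow> real"
  assumes "\<And>x. (\<lambda>n. a n * x ^ n) sums 0"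
  shows "a n = 0"
proof (induction n rule: less_induct)
  case (less n)
  have "(\<lambda>i. a (i + n) * x ^ i) sums 0" if "x \<noteq> 0" for x
  proof -
    have "(\<lambda>i. a (i + n) * x ^ (i + n)) sums (0 - (\<Sum>i<n. a i * x ^ i))"
      using sums_iff_shift'[of "\<lambda>i. a i * x ^ i" n 0] assms[of x]
      by simp
    moreover have "(\<Sum>i<n. a i * x ^ i) = 0"
      using less by simp
    ultimately have "(\<lambda>i. a (i + n) * x ^ i * x ^ n) sums 0"
      by (simp add: power_add mult_ac)
    then have "(\<lambda>i. a (i + n) * x ^ i * x ^ n / x ^ n) sums (0 / x ^ n)"
      by (rule sums_divide)
    with that show ?thesis by simp
  qed
  then have "((\<lambda>x::real. 0::real) \<longlongrightarrow> a (0 + n)) (at 0)"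
    by (intro powser_limit_0_strong[where s=1]) auto
  then show ?case
    by (metis LIM_const_eq add_0)
qed

text \<open>Finite exponential moments dominate the exponential series, so it may be integrated term by term.
  The parameter is complex so that the same coefficients, the moments, govern both the real exponential
  moments and the characteristic function.\<close>

lemma exp_moments_power_series:
  fixes M :: "real measure" and z :: complex
  assumes [measurable_cong]: "sets M = sets borel"
    and int: "\<And>c. integrable M (\<lambda>x. exp (c * x))"
  shows "(\<lambda>n. of_real ((\<integral>x. x ^ n \<partial>M) / fact n) * z ^ n) sums (\<integral>x. exp (z * of_real x) \<partial>M)"
proof -
  let ?f = "\<lambda>n x. (z * of_real x) ^ n /\<^sub>R fact n"
  have int_abs: "integrable M (\<lambda>x. exp (c * \<bar>x\<bar>))" for c
  proof (rule Bochner_Integration.integrable_bound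
          [OF Bochner_Integration.integrable_add[OF int[of c] int[of "-c"]]])
    have "exp (c * \<bar>x\<bar>) \<le> exp (c * x) + exp (- c * x)" for x
      by (cases "x < 0") auto
    then show "AE x in M. norm (exp (c * \<bar>x\<bar>)) \<le> norm (exp (c * x) + exp (- c * x))"
      by (metis (no_types, lifting) AE_I2 abs_exp_cancel abs_ge_self order_trans real_norm_def)
  qed simp
  have expn: "(\<lambda>n. norm (?f n x)) sums exp (norm z * \<bar>x\<bar>)" for x
    using exp_converges[of "norm z * \<bar>x\<bar>"]
    by (simp add: norm_mult norm_power)
  let ?n = "\<lambda>n. \<integral>x. norm (?f n x) \<partial>M" and ?e = "\<lambda>x :: real. exp (norm z * \<bar>x\<bar>)"
  have intn: "integrable M (\<lambda>x. ?f n x)" for n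
  proof (rule Bochner_Integration.integrable_bound[OF int_abs[of "norm z"]])
    show "AE x in M. norm (?f n x) \<le> norm (?e x)"
    proof (rule AE_I2)
      fix x
      have "sum (\<lambda>n. norm (?f n x)) {n} \<le> (\<Sum>n. norm (?f n x))"
        using expn[of x] by (intro sum_le_suminf) (auto simp: sums_iff)
      then show "norm (?f n x) \<le> norm (?e x)"
        using expn[of x] by (simp add: sums_iff)
    qed
  qed simp
  have "(\<lambda>n. \<integral>x. ?f n x \<partial>M) sums (\<integral>x. (\<Sum>n. ?f n x) \<partial>M)"
  proof (rule sums_integral)
    show "AE x in M. summable (\<lambda>n. norm (?f n x))"
      using expn by (auto simp: sums_iff)
    show "summable (\<lambda>n. \<integral>x. norm (?f n x) \<partial>M)"
    proof (rule bounded_imp_summable)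
      fix n
      show "(\<Sum>k\<le>n. ?n k) \<le> (\<integral>x. ?e x \<partial>M)"
      proof -
        have "(\<Sum>k\<le>n. ?n k) = (\<integral>x. (\<Sum>k\<le>n. norm (?f k x)) \<partial>M)"
          using intn by (intro Bochner_Integration.integral_sum[symmetric] integrable_norm) auto
        also have "\<dots> \<le> (\<integral>x. ?e x \<partial>M)"
        proof (rule integral_mono)
          fix x
          have "(\<Sum>k\<le>n. norm (?f k x)) \<le> (\<Sum>n. norm (?f n x))"
            using expn[of x] by (intro sum_le_suminf) (auto simp: sums_iff)
          then show "(\<Sum>k\<le>n. norm (?f k x)) \<le> ?e x"
            using expn[of x] by (simp add: sums_iff)
        qed (intro Bochner_Integration.integrable_sum integrable_norm intn int_abs)+
        finally show ?thesis .
      qed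
    qed simp
  qed (rule intn)
  moreover have "(\<Sum>n. ?f n x) = exp (z * of_real x)" for x
    by (simp add: exp_def)
  moreover have "(\<integral>x. ?f n x \<partial>M) = of_real ((\<integral>x. x ^ n \<partial>M) / fact n) * z ^ n" for n
  proof -
    have "(\<integral>x. ?f n x \<partial>M) = (\<integral>x. z ^ n /\<^sub>R fact n * of_real (x ^ n) \<partial>M)"
      by (simp add: power_mult_distrib)
    also have "\<dots> = z ^ n /\<^sub>R fact n * of_real (\<integral>x. x ^ n \<partial>M)"
      by (simp only: integral_mult_right_zero integral_complex_of_real)
    finally show ?thesis
      by (simp add: scaleR_conv_of_real divide_inverse mult_ac)
  qed
  ultimately show ?thesis by simp
qed

lemma real_distribution_eqI_exp_moments:
  fixes M1 M2 :: "real measure"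
  assumes M1: "real_distribution M1" and M2: "real_distribution M2"
    and int: "\<And>c. integrable M1 (\<lambda>x. exp (c * x))" "\<And>c. integrable M2 (\<lambda>x. exp (c * x))"
    and eq: "\<And>c::real. (\<integral>x. exp (c * x) \<partial>M1) = (\<integral>x. exp (c * x) \<partial>M2)"
  shows "M1 = M2"
proof (rule Levy_uniqueness[OF M1 M2])
  interpret M1: real_distribution M1 by fact
  interpret M2: real_distribution M2 by fact
  note s1 = exp_moments_power_series[OF M1.events_eq_borel int(1)]
  note s2 = exp_moments_power_series[OF M2.events_eq_borel int(2)]
  let ?a = "\<lambda>n. (\<integral>x. x ^ n \<partial>M1) / fact n - (\<integral>x. x ^ n \<partial>M2) / fact n"
  have "?a n = 0" for n
  proof (rule powser_zero_imp_coeff_zero)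
    fix c :: real
    have ce: "exp (complex_of_real c * of_real x) = of_real (exp (c * x))" for x
      by (metis exp_of_real of_real_mult)
    have "(\<lambda>n. complex_of_real (?a n * c ^ n)) sums
        ((\<integral>x. exp (of_real c * of_real x) \<partial>M1) - (\<integral>x. exp (of_real c * of_real x) \<partial>M2))"
      using sums_diff[OF s1[of "of_real c"] s2[of "of_real c"]]
      by (simp add: algebra_simps)
    also have "(\<integral>x. exp (of_real c * of_real x) \<partial>M1) - (\<integral>x. exp (of_real c * of_real x) \<partial>M2) = complex_of_real 0"
      unfolding ce by (simp add: eq)
    finally show "(\<lambda>n. ?a n * c ^ n) sums 0"
      by (simp only: sums_of_real_iff)
  qed
  then have "of_real ((\<integral>x. x ^ n \<partial>M1) / fact n) = complex_of_real ((\<integral>x. x ^ n \<partial>M2) / fact n)" for n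
    by simp
  then have "(\<integral>x. exp (z * of_real x) \<partial>M1) = (\<integral>x. exp (z * of_real x) \<partial>M2)" for z :: complex
    using s1[of z] s2[of z] sums_unique2 by fastforce
  from this[of "\<i> * of_real t" for t] show "char M1 = char M2"
    by (auto simp: char_def fun_eq_iff mult.assoc)
qed

text \<open>Normalising by the total mass, which is the exponential moment at \<open>0\<close>, removes the
  restriction to probability measures.\<close>

lemma finite_measure_eqI_exp_moments:
  fixes M1 M2 :: "real measure"
  assumes sets1[measurable_cong]: "sets M1 = sets borel" and sets2[measurable_cong]: "sets M2 = sets borel"
    and fin: "\<And>c. (\<integral>\<^sup>+x. ennreal (exp (c * x)) \<partial>M1) < \<infinity>"
    and eq: "\<And>c. (\<integral>\<^sup>+x. ennreal (exp (c * x)) \<partial>M1) = (\<integral>\<^sup>+x. ennreal (exp (c * x)) \<partial>M2)"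
  shows "M1 = M2"
proof -
  have sp: "space M1 = UNIV" "space M2 = UNIV"
    using sets_eq_imp_space_eq[OF sets1] sets_eq_imp_space_eq[OF sets2] by auto
  define m where "m = emeasure M1 UNIV"
  have m1: "emeasure M1 (space M1) = m" and m2: "emeasure M2 (space M2) = m" and mfin: "m < \<infinity>"
    using eq[of 0] fin[of 0] by (auto simp: m_def sp)
  show ?thesis
  proof (cases "m = 0")
    case True
    then have "emeasure M1 X = emeasure M2 X" for X
      using m1 m2 by (metis emeasure_eq_0 emeasure_notin_sets sets.sets_into_space sets.top)
    with sets1 sets2 show ?thesis by (intro measure_eqI) auto
  next
    case False
    define r where "r = enn2real m"
    have r: "r > 0" "m = ennreal r"
      using False mfin by (auto simp: r_def enn2real_positive_iff less_top[symmetric] zero_less_iff_neq_zero)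
    define N where "N M = scale_measure (ennreal (1 / r)) M" for M :: "real measure"
    have N: "real_distribution (N M)" if "sets M = sets borel" "emeasure M (space M) = m" for M
      unfolding N_def real_distribution_def real_distribution_axioms_def using that r
      by (auto intro!: prob_spaceI simp: space_scale_measure ennreal_mult[symmetric])
    have nni: "(\<integral>\<^sup>+x. ennreal (exp (c * x)) \<partial>N M) = ennreal (1/r) * (\<integral>\<^sup>+x. ennreal (exp (c * x)) \<partial>M)"
      if [measurable_cong]: "sets M = sets borel" for c M
      unfolding N_def by (subst nn_integral_scale_measure) auto
    have integ: "integrable (N M) (\<lambda>x. exp (c * x))"
      if [measurable_cong]: "sets M = sets borel" and "(\<integral>\<^sup>+x. ennreal (exp (c * x)) \<partial>M) < \<infinity>" for c M
    proof (rule integrableI_nonneg)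
      have "sets (N M) = sets borel" by (simp add: N_def that(1))
      then show "(\<lambda>x. exp (c * x)) \<in> borel_measurable (N M)"
        by (simp cong: measurable_cong_sets)
      show "(\<integral>\<^sup>+x. ennreal (exp (c * x)) \<partial>N M) < \<infinity>"
        using that(2) by (subst nni[OF that(1)]) (auto simp: ennreal_mult_less_top)
    qed simp
    have "N M1 = N M2"
    proof (rule real_distribution_eqI_exp_moments)
      show "(\<integral>x. exp (c * x) \<partial>N M1) = (\<integral>x. exp (c * x) \<partial>N M2)" for c
        using eq[of c] nni[OF sets1] nni[OF sets2]
          integ[OF sets1 fin[of c]] integ[OF sets2, of c] fin[of c]
        by (auto simp: integral_eq_nn_integral[OF borel_measurable_integrable])
    qed (use N integ fin eq sets1 sets2 m1 m2 in auto)
    then have "scale_measure (ennreal r) (N M1) = scale_measure (ennreal r) (N M2)"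
      by simp
    then show ?thesis
      using r by (simp add: N_def scale_scale_measure ennreal_mult[symmetric])
  qed
qed

text \<open>The exponential moments of a finite family are turned into probabilities of rectangles
  one coordinate at a time: with some coordinates already restricted to Borel sets and the others
  still carrying their exponential weight, the law of one more coordinate is a finite measure
  on the line whose exponential moments are known by induction.\<close>

lemma exp_moments_determine_rectangles:
  fixes U :: "'i \<Rightarrow> 'a \<Rightarrow> real" and V :: "'i \<Rightarrow> 'b \<Rightarrow> real"
  assumes [measurable]: "\<And>i. U i \<in> borel_measurable M" "\<And>i. V i \<in> borel_measurable N"
    and fin: "\<And>L c. finite L \<Longrightarrow> (\<integral>\<^sup>+\<omega>. ennreal (exp (\<Sum>i\<in>L. c i * U i \<omega>)) \<partial>M) < \<infinity>"
    and eq: "\<And>L c. finite L \<Longrightarrow> (\<integral>\<^sup>+\<omega>. ennreal (exp (\<Sum>i\<in>L. c i * U i \<omega>)) \<partial>M) =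
                                   (\<integral>\<^sup>+\<omega>. ennreal (exp (\<Sum>i\<in>L. c i * V i \<omega>)) \<partial>N)"
    and "finite L" "K \<subseteq> L" and B: "\<And>i. i \<in> K \<Longrightarrow> B i \<in> sets borel"
  shows "(\<integral>\<^sup>+\<omega>. (\<Prod>i\<in>K. indicator (B i) (U i \<omega>)) * ennreal (exp (\<Sum>i\<in>L. c i * U i \<omega>)) \<partial>M) =
         (\<integral>\<^sup>+\<omega>. (\<Prod>i\<in>K. indicator (B i) (V i \<omega>)) * ennreal (exp (\<Sum>i\<in>L. c i * V i \<omega>)) \<partial>N)"
proof -
  have "finite K" using \<open>finite L\<close> \<open>K \<subseteq> L\<close> by (rule rev_finite_subset)
  from this \<open>K \<subseteq> L\<close> B show ?thesis
  proof (induction K arbitrary: c)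
    case empty
    show ?case using eq[OF \<open>finite L\<close>, of c] by simp
  next
    case (insert m K)
    note [measurable] = insert.prems(2)
    have [measurable]: "B i \<in> sets borel" if "i \<in> K" for i using that insert.prems by simp
    define wU wV
      where "wU = (\<lambda>\<omega>. (\<Prod>i\<in>K. indicator (B i) (U i \<omega>)) * ennreal (exp (\<Sum>i\<in>L. c i * U i \<omega>)))"
        and "wV = (\<lambda>\<omega>. (\<Prod>i\<in>K. indicator (B i) (V i \<omega>)) * ennreal (exp (\<Sum>i\<in>L. c i * V i \<omega>)))"
    have [measurable]: "wU \<in> borel_measurable M"
      unfolding wU_def wV_def by measurable
    have [measurable]: "wV \<in> borel_measurable N"
      unfolding wU_def wV_def by measurable
    define M1 where "M1 = distr (density M wU) borel (U m)"
    define N1 where "N1 = distr (density N wV) borel (V m)"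
    have shift: "(\<Prod>i\<in>K. indicator (B i) (X i \<omega>)) * ennreal (exp (\<Sum>i\<in>L. c i * X i \<omega>)) *
          ennreal (exp (t * X m \<omega>)) =
        (\<Prod>i\<in>K. indicator (B i) (X i \<omega>)) *
          ennreal (exp (\<Sum>i\<in>L. (c(m := c m + t)) i * X i \<omega>))"
      for X :: "'i \<Rightarrow> 'c \<Rightarrow> real" and \<omega> t
    proof -
      have "(\<Sum>i\<in>L. (c(m := c m + t)) i * X i \<omega>) = (\<Sum>i\<in>L. c i * X i \<omega>) + t * X m \<omega>"
        using \<open>finite L\<close> insert.prems(1)
        by (subst (1 2) sum.remove[of _ m]) (auto simp: algebra_simps intro!: sum.cong)
      then show ?thesis
        by (simp add: exp_add ennreal_mult mult.assoc)
    qed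
    let ?SU = "\<lambda>t \<omega>. \<Sum>i\<in>L. (c(m := c m + t)) i * U i \<omega>" and ?SV = "\<lambda>t \<omega>. \<Sum>i\<in>L. (c(m := c m + t)) i * V i \<omega>"
      and ?PU = "\<lambda>\<omega>. (\<Prod>i\<in>K. indicator (B i) (U i \<omega>)) :: ennreal" and ?PV = "\<lambda>\<omega>. (\<Prod>i\<in>K. indicator (B i) (V i \<omega>)) :: ennreal"
    have M1_exp: "(\<integral>\<^sup>+x. ennreal (exp (t * x)) \<partial>M1) =
       (\<integral>\<^sup>+\<omega>. ?PU \<omega> *
          ennreal (exp (?SU t \<omega>)) \<partial>M)" for t
      unfolding M1_def by (subst nn_integral_distr) (simp_all add: nn_integral_density wU_def wV_def shift)
    have N1_exp: "(\<integral>\<^sup>+x. ennreal (exp (t * x)) \<partial>N1) =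
       (\<integral>\<^sup>+\<omega>. ?PV \<omega> *
          ennreal (exp (?SV t \<omega>)) \<partial>N)" for t
      unfolding N1_def by (subst nn_integral_distr) (simp_all add: nn_integral_density wU_def wV_def shift)
    have "M1 = N1"
    proof (rule finite_measure_eqI_exp_moments)
      show "(\<integral>\<^sup>+x. ennreal (exp (t * x)) \<partial>M1) < \<infinity>" for t
      proof -
        have "(\<integral>\<^sup>+x. ennreal (exp (t * x)) \<partial>M1) \<le>
            (\<integral>\<^sup>+\<omega>. ennreal (exp (?SU t \<omega>)) \<partial>M)"
          unfolding M1_exp
        proof (rule nn_integral_mono)
          fix \<omega>
          have "?PU \<omega> \<le> (1 :: ennreal)"
            by (intro prod_le_1) (auto simp: indicator_def)
          from mult_right_mono[OF this, of "ennreal e" for e]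
          show "?PU \<omega> * ennreal (exp (?SU t \<omega>))
              \<le> ennreal (exp (?SU t \<omega>))"
            by simp
        qed
        also have "\<dots> < \<infinity>" using fin[OF \<open>finite L\<close>] by blast
        finally show ?thesis .
      qed
      show "(\<integral>\<^sup>+x. ennreal (exp (t * x)) \<partial>M1) = (\<integral>\<^sup>+x. ennreal (exp (t * x)) \<partial>N1)" for t
        unfolding M1_exp N1_exp using insert.prems by (intro insert.IH) auto
    qed (auto simp: M1_def N1_def)
    then have "emeasure M1 (B m) = emeasure N1 (B m)" by simp
    moreover have "emeasure M1 (B m) = (\<integral>\<^sup>+\<omega>. wU \<omega> * indicator (B m) (U m \<omega>) \<partial>M)"
      unfolding M1_def using insert.prems
      by (subst emeasure_distr) (auto simp: emeasure_density indicator_def space_density intro!: nn_integral_cong)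
    moreover have "emeasure N1 (B m) = (\<integral>\<^sup>+\<omega>. wV \<omega> * indicator (B m) (V m \<omega>) \<partial>N)"
      unfolding N1_def using insert.prems
      by (subst emeasure_distr) (auto simp: emeasure_density indicator_def space_density intro!: nn_integral_cong)
    ultimately show ?case
      using insert.hyps by (simp add: wU_def wV_def mult_ac)
  qed
qed

lemma distr_eqI_exp_moments:
  fixes U :: "'i \<Rightarrow> 'a \<Rightarrow> real" and V :: "'i \<Rightarrow> 'b \<Rightarrow> real"
  assumes [measurable]: "\<And>i. U i \<in> borel_measurable M" "\<And>i. V i \<in> borel_measurable N"
    and fin: "\<And>L c. finite L \<Longrightarrow> (\<integral>\<^sup>+\<omega>. ennreal (exp (\<Sum>i\<in>L. c i * U i \<omega>)) \<partial>M) < \<infinity>"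
    and eq: "\<And>L c. finite L \<Longrightarrow> (\<integral>\<^sup>+\<omega>. ennreal (exp (\<Sum>i\<in>L. c i * U i \<omega>)) \<partial>M) =
                                   (\<integral>\<^sup>+\<omega>. ennreal (exp (\<Sum>i\<in>L. c i * V i \<omega>)) \<partial>N)"
  shows "distr M (\<Pi>\<^sub>M i\<in>UNIV. borel) (\<lambda>\<omega> i. U i \<omega>) = distr N (\<Pi>\<^sub>M i\<in>UNIV. borel) (\<lambda>\<omega> i. V i \<omega>)"
proof (rule measure_eqI_PiM_infinite)
  let ?DU = "distr M (\<Pi>\<^sub>M i\<in>UNIV. borel) (\<lambda>\<omega> i. U i \<omega>)" and ?DV = "distr N (\<Pi>\<^sub>M i\<in>UNIV. borel) (\<lambda>\<omega> i. V i \<omega>)"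
  have mU: "(\<lambda>\<omega> i. U i \<omega>) \<in> measurable M (\<Pi>\<^sub>M i\<in>UNIV. borel)"
    and mV: "(\<lambda>\<omega> i. V i \<omega>) \<in> measurable N (\<Pi>\<^sub>M i\<in>UNIV. borel)"
    by (auto intro!: measurable_PiM_single')
  show "finite_measure ?DU"
  proof (rule finite_measureI)
    have "emeasure M (space M) < \<infinity>" using fin[of "{}"] by simp
    then show "emeasure ?DU
        (space ?DU) \<noteq> \<infinity>"
      using emeasure_space[of M] by (simp add: emeasure_distr[OF mU] less_top[symmetric] flip: top.not_eq_extremum)
         (metis infinity_ennreal_def leD less_top neq_top_trans)
  qed
  fix B and J :: "'i set"
  assume J: "finite J" and B: "\<And>i. i \<in> J \<Longrightarrow> B i \<in> sets (borel :: real measure)"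
  have emb: "prod_emb UNIV (\<lambda>_. borel) J (Pi\<^sub>E J B) = {x. \<forall>i\<in>J. x i \<in> B i}"
    by (auto simp: prod_emb_def space_PiM PiE_iff restrict_def)
  have meas: "{x. \<forall>i\<in>J. x i \<in> B i} \<in> sets (\<Pi>\<^sub>M i\<in>UNIV. borel)"
    using J B unfolding emb[symmetric] by (intro sets_PiM_I) auto
  have nn: "emeasure (distr K (\<Pi>\<^sub>M i\<in>UNIV. borel) (\<lambda>\<omega> i. X i \<omega>)) {x. \<forall>i\<in>J. x i \<in> B i} =
     (\<integral>\<^sup>+\<omega>. (\<Prod>i\<in>J. indicator (B i) (X i \<omega>)) * ennreal (exp (\<Sum>i\<in>J. 0 * X i \<omega>)) \<partial>K)"
    if [measurable]: "\<And>i. X i \<in> borel_measurable K" for X :: "'i \<Rightarrow> 'c \<Rightarrow> real" and K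
  proof -
    have mX: "(\<lambda>\<omega> i. X i \<omega>) \<in> measurable K (\<Pi>\<^sub>M i\<in>UNIV. borel)"
      by (auto intro!: measurable_PiM_single')
    have "emeasure (distr K (\<Pi>\<^sub>M i\<in>UNIV. borel) (\<lambda>\<omega> i. X i \<omega>)) {x. \<forall>i\<in>J. x i \<in> B i} =
       emeasure K ((\<lambda>\<omega> i. X i \<omega>) -` {x. \<forall>i\<in>J. x i \<in> B i} \<inter> space K)"
      using mX meas by (rule emeasure_distr)
    also have "\<dots> = (\<integral>\<^sup>+\<omega>. indicator ((\<lambda>\<omega> i. X i \<omega>) -` {x. \<forall>i\<in>J. x i \<in> B i} \<inter> space K) \<omega> \<partial>K)"
      using mX meas by (intro nn_integral_indicator[symmetric] measurable_sets)
    also have "\<dots> = (\<integral>\<^sup>+\<omega>. (\<Prod>i\<in>J. indicator (B i) (X i \<omega>)) \<partial>K)"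
    proof (rule nn_integral_cong)
      fix \<omega> assume "\<omega> \<in> space K"
      then show "indicator ((\<lambda>\<omega> i. X i \<omega>) -` {x. \<forall>i\<in>J. x i \<in> B i} \<inter> space K) \<omega> =
          ((\<Prod>i\<in>J. indicator (B i) (X i \<omega>)) :: ennreal)"
        using J by (cases "\<forall>i\<in>J. X i \<omega> \<in> B i") (auto simp: indicator_def prod_zero_iff intro!: prod.neutral[symmetric])
    qed
    finally show ?thesis by simp
  qed
  show "emeasure ?DU (prod_emb UNIV (\<lambda>_. borel) J (Pi\<^sub>E J B)) =
      emeasure ?DV (prod_emb UNIV (\<lambda>_. borel) J (Pi\<^sub>E J B))"
    unfolding emb nn[of U M, OF assms(1)] nn[of V N, OF assms(2)]
    by (rule exp_moments_determine_rectangles[OF assms(1,2) fin eq J order_refl B])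
qed auto

section \<open>Joint law of extremal integrals\<close>

text \<open>The distribution function tends to \<open>1\<close> at infinity.\<close>

lemma (in prob_space) AE_finite_of_frechet_cdf:
  fixes X :: "'a \<Rightarrow> ennreal"
  assumes [measurable]: "X \<in> borel_measurable M"
    and cdf: "\<And>x. x > 0 \<Longrightarrow> prob {\<omega> \<in> space M. X \<omega> \<le> ennreal x} = exp (- (c / x))"
  shows "AE \<omega> in M. X \<omega> < \<infinity>"
proof -
  have "exp (- (c / real (Suc n))) \<le> prob {\<omega> \<in> space M. X \<omega> < \<infinity>}" for n
  proof -
    have "exp (- (c / real (Suc n))) = prob {\<omega> \<in> space M. X \<omega> \<le> ennreal (real (Suc n))}"
      by (subst cdf) auto
    also have "\<dots> \<le> prob {\<omega> \<in> space M. X \<omega> < \<infinity>}"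
      by (intro finite_measure_mono) (auto intro: le_less_trans)
    finally show ?thesis .
  qed
  moreover have "(\<lambda>n. exp (- (c / real (Suc n)))) \<longlonglongrightarrow> exp (- 0)"
    by (intro tendsto_exp tendsto_minus real_tendsto_divide_at_top[OF tendsto_const]
        filterlim_compose[OF filterlim_real_sequentially filterlim_Suc])
  ultimately have "1 \<le> prob {\<omega> \<in> space M. X \<omega> < \<infinity>}"
    by (intro LIMSEQ_le_const2) auto
  then have "prob {\<omega> \<in> space M. X \<omega> < \<infinity>} = 1"
    using prob_le_1 by (intro antisym) auto
  then show ?thesis
    by (subst (asm) prob_Collect_eq_1) auto
qed

context frechet_sup_measure begin

text \<open>The formula for the distribution function puts all mass of \<open>M {}\<close> below every positive level.\<close>

lemma AE_empty_eq_0: "AE \<omega> in Q. M {} \<omega> = 0"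
proof -
  have [measurable]: "M {} \<in> borel_measurable Q" by (rule measurable) simp
  have "AE \<omega> in Q. M {} \<omega> \<le> ennreal (1 / Suc n)" for n
  proof -
    have "prob {\<omega> \<in> space Q. M {} \<omega> \<le> ennreal (1 / Suc n)} = 1"
      by (subst frechet) auto
    then show ?thesis
      by (subst (asm) prob_Collect_eq_1) auto
  qed
  then have "AE \<omega> in Q. \<forall>n. M {} \<omega> \<le> ennreal (1 / Suc n)"
    by (simp add: AE_all_countable)
  then show ?thesis
  proof eventually_elim
    case (elim \<omega>)
    have "(\<lambda>n. ennreal (1 / Suc n)) \<longlonglongrightarrow> ennreal 0"
      by (intro tendsto_ennrealI LIMSEQ_inverse_real_of_nat[unfolded inverse_eq_divide])
    with elim have "M {} \<omega> \<le> ennreal 0"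
      by (intro LIMSEQ_le_const) auto
    then show ?case by simp
  qed
qed

lemma AE_finite:
  assumes A: "A \<in> sets S" and fin: "emeasure S A < \<infinity>"
  shows "AE \<omega> in Q. M A \<omega> < \<infinity>"
  by (rule AE_finite_of_frechet_cdf[OF measurable[OF A]]) (use fin frechet[OF A] in auto)

lemma prob_mult_le_1:
  assumes A: "A \<in> sets S" and c: "c \<ge> 0" and fin: "c \<noteq> 0 \<Longrightarrow> emeasure S A < \<infinity>"
  shows "prob {\<omega> \<in> space Q. ennreal c * M A \<omega> \<le> 1} = exp (- c * measure S A)"
proof (cases "c = 0")
  case True
  then show ?thesis by (simp add: prob_space)
next
  case False
  have "ennreal c * m \<le> 1 \<longleftrightarrow> m \<le> ennreal (1 / c)" for m
    using False c
    by (cases m) (auto simp: ennreal_mult[symmetric] field_simps ennreal_mult_top top_unique ennreal_le_1)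
  then show ?thesis
    using False c fin by (simp add: frechet[OF A])
qed

lemma measurable_simple_extremal_integral:
  assumes simple: "simple_function S h"
  shows "simple_extremal_integral S M h \<in> borel_measurable Q"
proof -
  have "countable (h ` space S)"
    using simple_functionD(1)[OF simple] by (rule countable_finite)
  moreover have "M (h -` {a} \<inter> space S) \<in> borel_measurable Q" for a
    using simple_functionD(2)[OF simple] by (rule measurable)
  ultimately have "(\<lambda>\<omega>. SUP a \<in> h ` space S. ennreal a * M (h -` {a} \<inter> space S) \<omega>) \<in> borel_measurable Q"
    by (intro borel_measurable_SUP) auto
  then show ?thesis
    unfolding simple_extremal_integral_def by (rule measurable_compose) simp
qed

text \<open>The joint level sets of the functions \<open>h i\<close> form one finite partition \<open>B\<close> on whose cells all of them
  are constant. Almost surely each extremal integral is then a maximum over the cells, the event splits into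
  one condition per cell, and the conditions are independent. Cells of infinite measure impose no
  condition, since integrable functions vanish there. The levels are written as
  \<open>c i * I \<le> 1\<close> because this makes the exponent linear in a common factor of the \<open>c i\<close>.\<close>

lemma prob_simple_extremal_integrals:
  fixes h :: "'i \<Rightarrow> 's \<Rightarrow> real"
  assumes J: "finite J"
    and simple: "\<And>i. i \<in> J \<Longrightarrow> simple_function S (h i)"
    and integ: "\<And>i. i \<in> J \<Longrightarrow> integrable S (h i)"
    and nonneg: "\<And>i s. i \<in> J \<Longrightarrow> s \<in> space S \<Longrightarrow> h i s \<ge> 0"
    and c: "\<And>i. i \<in> J \<Longrightarrow> c i > 0"
  shows "prob {\<omega> \<in> space Q. \<forall>i\<in>J. c i * simple_extremal_integral S M (h i) \<omega> \<le> 1} =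
         exp (- enn2real (\<integral>\<^sup>+s. (SUP i\<in>J. ennreal (c i * h i s)) \<partial>S))"
proof -
  have [measurable]: "h i \<in> borel_measurable S" if "i \<in> J" for i
    using integ[OF that] by simp
  define \<phi> where "\<phi> s = (\<lambda>i\<in>J. h i s)" for s
  have "\<phi> ` space S \<subseteq> (\<Pi>\<^sub>E i\<in>J. h i ` space S)"
    by (auto simp: \<phi>_def)
  then have "finite (\<phi> ` space S)"
    by (rule finite_subset) (intro finite_PiE J simple_functionD(1)[OF simple])
  then obtain e N where e: "bij_betw e {0..<N::nat} (\<phi> ` space S)"
    using ex_bij_betw_nat_finite by blast
  define B where "B n = (if n < N then {s \<in> space S. \<phi> s = e n} else {})" for n
  have B_sets[measurable]: "B n \<in> sets S" for n
  proof (cases "n < N")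
    case True
    then have "e n \<in> \<phi> ` space S"
      using e by (auto simp: bij_betw_def)
    then have "e n \<in> extensional J"
      by (auto simp: \<phi>_def)
    then have "{s \<in> space S. \<phi> s = e n} = {s \<in> space S. \<forall>i\<in>J. h i s = e n i}"
      by (auto simp: \<phi>_def fun_eq_iff extensional_def restrict_def)
    also have "\<dots> \<in> sets S"
      using J by measurable
    finally show ?thesis by (simp add: B_def True)
  qed (simp add: B_def)
  have B_disj: "disjoint_family B"
    using e by (auto simp: disjoint_family_on_def B_def bij_betw_def inj_on_def)
  have h_B: "h i s = e n i" if "s \<in> B n" "i \<in> J" for i s n
    using that by (auto simp: B_def \<phi>_def fun_eq_iff split: if_splits)
  have e_image: "e ` {0..<N} = \<phi> ` space S"
    using e by (simp add: bij_betw_def)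
  have B_cover: "\<exists>n<N. s \<in> B n" if s: "s \<in> space S" for s
  proof -
    have "\<phi> s \<in> e ` {0..<N}" using s by (simp add: e_image)
    then obtain n where "\<phi> s = e n" "n < N" by auto
    with s have "s \<in> B n" by (simp add: B_def)
    with \<open>n < N\<close> show ?thesis by blast
  qed
  have B_nonempty: "\<exists>s. s \<in> B n" if n: "n < N" for n
  proof -
    have "e n \<in> e ` {0..<N}" using n by simp
    then obtain s where "s \<in> space S" "e n = \<phi> s" unfolding e_image by blast
    with n have "s \<in> B n" by (simp add: B_def)
    then show ?thesis by blast
  qed
  have e_nonneg: "e n i \<ge> 0" if n: "n < N" and i: "i \<in> J" for n i
  proof -
    obtain s where s: "s \<in> B n" using B_nonempty[OF n] by blast
    then have "s \<in> space S" using sets.sets_into_space[OF B_sets[of n]] by blast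
    then show ?thesis using nonneg[OF i] h_B[OF s i] by metis
  qed
  have B_fin: "emeasure S (B n) < \<infinity>" if "n < N" "i \<in> J" "e n i \<noteq> 0" for n i
  proof -
    have "ennreal (e n i) * emeasure S (B n) = (\<integral>\<^sup>+s. ennreal (e n i) * indicator (B n) s \<partial>S)"
      by (simp add: nn_integral_cmult_indicator)
    also have "\<dots> \<le> (\<integral>\<^sup>+s. ennreal (h i s) \<partial>S)"
      using that(2) by (intro nn_integral_mono) (auto simp: indicator_def h_B)
    also have "\<dots> < \<infinity>"
      using integ[OF that(2)] nonneg[OF that(2)]
      by (subst nn_integral_eq_integral) auto
    finally show ?thesis
      using that e_nonneg[OF that(1,2)] by (auto simp: ennreal_mult_less_top)
  qed
  \<comment> \<open>The binding level on cell \<open>n\<close>. Inserting \<open>0\<close> covers the case of an empty \<open>J\<close>; the index \<open>N\<close>, whose cell is empty, keeps the range of the later product nonempty.\<close>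
  define d where "d n = (if n < N then Max (insert 0 ((\<lambda>i. c i * e n i) ` J)) else 0)" for n
  have d_nonneg: "d n \<ge> 0" for n
    using J by (simp add: d_def)
  have d_fin: "emeasure S (B n) < \<infinity>" if "d n \<noteq> 0" for n
  proof -
    have n: "n < N" using that by (auto simp: d_def split: if_splits)
    have "Max (insert 0 ((\<lambda>i. c i * e n i) ` J)) \<in> insert 0 ((\<lambda>i. c i * e n i) ` J)"
      using J by (intro Max_in) auto
    with that n obtain i where "i \<in> J" "e n i \<noteq> 0" by (auto simp: d_def)
    with n show ?thesis by (intro B_fin)
  qed
  have d_le: "(\<forall>i\<in>J. ennreal (c i * e n i) * m \<le> 1) \<longleftrightarrow> ennreal (d n) * m \<le> 1"
    if n: "n < N" for n and m :: ennreal
  proof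
    assume *: "\<forall>i\<in>J. ennreal (c i * e n i) * m \<le> 1"
    have "Max (insert 0 ((\<lambda>i. c i * e n i) ` J)) \<in> insert 0 ((\<lambda>i. c i * e n i) ` J)"
      using J by (intro Max_in) auto
    with * n show "ennreal (d n) * m \<le> 1" by (auto simp: d_def)
  next
    assume *: "ennreal (d n) * m \<le> 1"
    show "\<forall>i\<in>J. ennreal (c i * e n i) * m \<le> 1"
    proof
      fix i assume "i \<in> J"
      then have "ennreal (c i * e n i) \<le> ennreal (d n)"
        using J n by (auto simp: d_def intro!: ennreal_leI Max_ge)
      then have "ennreal (c i * e n i) * m \<le> ennreal (d n) * m"
        by (rule mult_right_mono) simp
      with * show "ennreal (c i * e n i) * m \<le> 1" by simp
    qed
  qed

  note meas_I = measurable_simple_extremal_integral[OF simple]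
  have [measurable]: "M (B n) \<in> borel_measurable Q" for n
    by (rule measurable) simp

  have level: "AE \<omega> in Q. M (h i -` {a} \<inter> space S) \<omega> =
      (SUP n. M (if n < N \<and> e n i = a then B n else {}) \<omega>)" if i: "i \<in> J" for i a
  proof -
    let ?B = "\<lambda>n. if n < N \<and> e n i = a then B n else {}"
    have "h i -` {a} \<inter> space S = (\<Union>n. ?B n)"
    proof (intro set_eqI iffI)
      fix s assume s: "s \<in> h i -` {a} \<inter> space S"
      then obtain n where n: "n < N" "s \<in> B n" using B_cover by blast
      then have "s \<in> ?B n" using h_B[OF n(2) i] s by simp
      then show "s \<in> (\<Union>n. ?B n)" by blast
    next
      fix s assume "s \<in> (\<Union>n. ?B n)"
      then obtain n where "s \<in> ?B n" by blast
      then have n: "s \<in> B n" "e n i = a" by (simp_all split: if_splits)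
      then show "s \<in> h i -` {a} \<inter> space S"
        using h_B[OF n(1) i] sets.sets_into_space[OF B_sets[of n]] by auto
    qed
    moreover have "AE \<omega> in Q. M (\<Union>n. ?B n) \<omega> = (SUP n. M (?B n) \<omega>)"
      using B_disj by (intro sup_additive) (auto simp: disjoint_family_on_def)
    ultimately show ?thesis by simp
  qed
  let ?I = "\<lambda>i. simple_extremal_integral S M (h i)"
  have AE1: "AE \<omega> in Q. \<forall>i\<in>J. \<forall>a\<in>h i ` space S. M (h i -` {a} \<inter> space S) \<omega> =
      (SUP n. M (if n < N \<and> e n i = a then B n else {}) \<omega>)"
    using level simple_functionD(1)[OF simple] J
    by (intro AE_finite_allI) auto
  have AE2: "AE \<omega> in Q. \<forall>n\<in>{..<N}. (\<exists>i\<in>J. e n i \<noteq> 0) \<longrightarrow> M (B n) \<omega> < \<infinity>"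
  proof (intro AE_finite_allI)
    fix n assume "n \<in> {..<N}"
    then show "AE \<omega> in Q. (\<exists>i\<in>J. e n i \<noteq> 0) \<longrightarrow> M (B n) \<omega> < \<infinity>"
      using AE_finite[OF B_sets B_fin] by (cases "\<exists>i\<in>J. e n i \<noteq> 0") auto
  qed simp
  have "AE \<omega> in Q. (\<forall>i\<in>J. c i * ?I i \<omega> \<le> 1) \<longleftrightarrow>
      (\<forall>n\<in>{..N}. ennreal (d n) * M (B n) \<omega> \<le> 1)"
    using AE1 AE2 AE_empty_eq_0
  proof eventually_elim
    case (elim \<omega>)
    have fin: "ennreal (e n i) * M (B n) \<omega> < \<infinity>" if "n < N" "i \<in> J" for n i
      using elim(2) that by (cases "e n i = 0") (auto simp: ennreal_mult_less_top)
    let ?lhs = "\<lambda>i. SUP a \<in> h i ` space S. ennreal a * M (h i -` {a} \<inter> space S) \<omega>"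
      and ?rhs = "\<lambda>i. SUP n\<in>{..<N}. ennreal (e n i) * M (B n) \<omega>"
    have sup: "?lhs i =
        ?rhs i" if i: "i \<in> J" for i
    proof (rule antisym)
      show "?lhs i \<le>
          ?rhs i"
      proof (rule SUP_least)
        fix a assume a: "a \<in> h i ` space S"
        have "ennreal a * M (h i -` {a} \<inter> space S) \<omega> =
            (SUP n. ennreal a * M (if n < N \<and> e n i = a then B n else {}) \<omega>)"
          by (simp only: elim(1)[rule_format, OF i a] SUP_mult_left_ennreal)
        also have "\<dots> \<le> ?rhs i"
          using elim(3) by (intro SUP_least) (auto intro!: SUP_upper)
        finally show "ennreal a * M (h i -` {a} \<inter> space S) \<omega> \<le> ?rhs i" .
      qed
      show "?rhs i \<le>
          ?lhs i"
      proof (rule SUP_least)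
        fix n assume n: "n \<in> {..<N}"
        then obtain s where s: "s \<in> B n" using B_nonempty by auto
        then have mem: "e n i \<in> h i ` space S"
          using h_B[OF s i] B_sets[THEN sets.sets_into_space] by (metis imageI subsetD)
        have "M (B n) \<omega> \<le> (SUP k. M (if k < N \<and> e k i = e n i then B k else {}) \<omega>)"
          using n by (intro SUP_upper2[of n]) auto
        also have "\<dots> = M (h i -` {e n i} \<inter> space S) \<omega>"
          using elim(1)[rule_format, OF i mem] by simp
        finally have "ennreal (e n i) * M (B n) \<omega> \<le> ennreal (e n i) * M (h i -` {e n i} \<inter> space S) \<omega>"
          by (rule mult_left_mono) simp
        also have "\<dots> \<le> ?lhs i"
          using mem by (rule SUP_upper)
        finally show "ennreal (e n i) * M (B n) \<omega> \<le>
            ?lhs i" .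
      qed
    qed
    have one: "c i * ?I i \<omega> \<le> 1 \<longleftrightarrow>
        (\<forall>n<N. ennreal (c i * e n i) * M (B n) \<omega> \<le> 1)" if i: "i \<in> J" for i
    proof -
      define X where "X = ?rhs i"
      have "X < \<infinity>"
      proof (cases "N = 0")
        case False
        have "X = Max ((\<lambda>n. ennreal (e n i) * M (B n) \<omega>) ` {..<N})"
          unfolding X_def using False by (intro Max_Sup[symmetric]) (auto simp: lessThan_empty_iff)
        also have "\<dots> < \<infinity>"
          using False fin[OF _ i] by (subst Max_less_iff) (auto simp: lessThan_empty_iff)
        finally show ?thesis .
      qed (simp add: X_def bot_ennreal)
      then obtain x where x: "X = ennreal x" "x \<ge> 0" by (cases X) auto
      have "c i * ?I i \<omega> \<le> 1 \<longleftrightarrow> c i * x \<le> 1"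
        using x by (simp add: simple_extremal_integral_def sup[OF i] flip: X_def)
      also have "\<dots> \<longleftrightarrow> ennreal (c i) * X \<le> 1"
        using x c[OF i] by (simp add: ennreal_mult[symmetric] ennreal_le_1)
      also have "ennreal (c i) * X = (SUP n\<in>{..<N}. ennreal (c i * e n i) * M (B n) \<omega>)"
        unfolding X_def using c[OF i] e_nonneg[OF _ i]
        by (cases "N = 0") (auto simp: SUP_mult_left_ennreal ennreal_mult mult.assoc bot_ennreal intro!: SUP_cong)
      finally show ?thesis by (auto simp: SUP_le_iff)
    qed
    have "(\<forall>i\<in>J. c i * ?I i \<omega> \<le> 1) \<longleftrightarrow>
        (\<forall>n<N. \<forall>i\<in>J. ennreal (c i * e n i) * M (B n) \<omega> \<le> 1)"
      using one by blast
    also have "\<dots> \<longleftrightarrow> (\<forall>n<N. ennreal (d n) * M (B n) \<omega> \<le> 1)"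
      using d_le by blast
    also have "\<dots> \<longleftrightarrow> (\<forall>n\<in>{..N}. ennreal (d n) * M (B n) \<omega> \<le> 1)"
      by (auto simp: le_less d_def)
    finally show ?case .
  qed
  then have "prob {\<omega> \<in> space Q. \<forall>i\<in>J. c i * ?I i \<omega> \<le> 1} =
      prob {\<omega> \<in> space Q. \<forall>n\<in>{..N}. ennreal (d n) * M (B n) \<omega> \<le> 1}"
    using meas_I J by (intro finite_measure_eq_AE) (auto intro!: sets.sets_Collect_finite_All')
  also have "{\<omega> \<in> space Q. \<forall>n\<in>{..N}. ennreal (d n) * M (B n) \<omega> \<le> 1} =
      (\<Inter>n\<in>{..N}. M (B n) -` {m. ennreal (d n) * m \<le> 1} \<inter> space Q)"
    by auto
  also have "prob \<dots> = (\<Prod>n\<in>{..N}. prob (M (B n) -` {m. ennreal (d n) * m \<le> 1} \<inter> space Q))"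
    by (intro indep_varsD_finite[OF indep_vars_subset[OF indep_disjoint]] B_disj) auto
  also have "\<dots> = (\<Prod>n\<in>{..N}. exp (- d n * measure S (B n)))"
  proof (rule prod.cong)
    fix n
    have "M (B n) -` {m. ennreal (d n) * m \<le> 1} \<inter> space Q = {\<omega> \<in> space Q. ennreal (d n) * M (B n) \<omega> \<le> 1}"
      by auto
    then show "prob (M (B n) -` {m. ennreal (d n) * m \<le> 1} \<inter> space Q) = exp (- d n * measure S (B n))"
      using prob_mult_le_1[OF B_sets d_nonneg d_fin] by simp
  qed simp
  also have "\<dots> = exp (- (\<Sum>n\<in>{..N}. d n * measure S (B n)))"
    by (simp add: exp_sum[symmetric] sum_negf)
  also have "(\<Sum>n\<in>{..N}. d n * measure S (B n)) = enn2real (\<integral>\<^sup>+s. (SUP i\<in>J. ennreal (c i * h i s)) \<partial>S)"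
  proof -
    have "(\<integral>\<^sup>+s. (SUP i\<in>J. ennreal (c i * h i s)) \<partial>S) =
        (\<integral>\<^sup>+s. (\<Sum>n\<in>{..N}. ennreal (d n) * indicator (B n) s) \<partial>S)"
    proof (rule nn_integral_cong)
      fix s assume s: "s \<in> space S"
      then obtain n where n: "n < N" "s \<in> B n" using B_cover by blast
      have "(\<Sum>n\<in>{..N}. ennreal (d n) * indicator (B n) s) = (\<Sum>k\<in>{..N}. if k = n then ennreal (d n) else 0)"
        using n B_disj by (intro sum.cong) (auto simp: indicator_def disjoint_family_on_def)
      also have "\<dots> = ennreal (d n)" using n by simp
      also have "\<dots> = (SUP i\<in>J. ennreal (c i * h i s))"
      proof (rule antisym)
        have "Max (insert 0 ((\<lambda>i. c i * e n i) ` J)) \<in> insert 0 ((\<lambda>i. c i * e n i) ` J)"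
          using J by (intro Max_in) auto
        then show "ennreal (d n) \<le> (SUP i\<in>J. ennreal (c i * h i s))"
          using n h_B[OF n(2)] by (auto simp: d_def intro: SUP_upper2)
        show "(SUP i\<in>J. ennreal (c i * h i s)) \<le> ennreal (d n)"
          using n h_B[OF n(2)] J by (auto simp: d_def intro!: SUP_least ennreal_leI Max_ge)
      qed
      finally show "(SUP i\<in>J. ennreal (c i * h i s)) = (\<Sum>n\<in>{..N}. ennreal (d n) * indicator (B n) s)" ..
    qed
    also have "\<dots> = (\<Sum>n\<in>{..N}. ennreal (d n) * emeasure S (B n))"
      by (subst nn_integral_sum) (auto simp: nn_integral_cmult_indicator)
    also have "\<dots> = (\<Sum>n\<in>{..N}. ennreal (d n * measure S (B n)))"
    proof (rule sum.cong)
      fix n show "ennreal (d n) * emeasure S (B n) = ennreal (d n * measure S (B n))"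
        using d_fin[of n] d_nonneg[of n]
        by (cases "d n = 0") (auto simp: ennreal_mult emeasure_eq_ennreal_measure)
    qed simp
    also have "\<dots> = ennreal (\<Sum>n\<in>{..N}. d n * measure S (B n))"
      using d_nonneg by (subst sum_ennreal) auto
    finally show ?thesis
      using d_nonneg by (simp add: sum_nonneg)
  qed
  finally show ?thesis .
qed

end

text \<open>The exponent of the joint law is Lipschitz in the spectral functions for the \<open>L\<^sup>1\<close> distance; this is what
  carries the formula from simple functions to limits.\<close>

lemma nn_integral_SUP_le_add_L1:
  fixes f g :: "'i \<Rightarrow> 's \<Rightarrow> real"
  assumes J: "finite J"
    and f: "\<And>i. i \<in> J \<Longrightarrow> integrable S (f i)" and g: "\<And>i. i \<in> J \<Longrightarrow> integrable S (g i)"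
    and c: "\<And>i. i \<in> J \<Longrightarrow> c i > 0"
  shows "(\<integral>\<^sup>+s. (SUP i\<in>J. ennreal (c i * f i s)) \<partial>S) \<le>
    (\<integral>\<^sup>+s. (SUP i\<in>J. ennreal (c i * g i s)) \<partial>S) + ennreal (\<Sum>i\<in>J. c i * (\<integral>s. \<bar>f i s - g i s\<bar> \<partial>S))"
proof -
  let ?D = "\<lambda>s. \<Sum>i\<in>J. ennreal (c i * \<bar>f i s - g i s\<bar>)" and ?G = "\<lambda>s. SUP i\<in>J. ennreal (c i * g i s)"
    and ?d = "\<lambda>i. \<integral>s. \<bar>f i s - g i s\<bar> \<partial>S"
  have [measurable]: "f i \<in> borel_measurable S" "g i \<in> borel_measurable S" if "i \<in> J" for i
    using f g that by auto
  have "(\<integral>\<^sup>+s. (SUP i\<in>J. ennreal (c i * f i s)) \<partial>S) \<le>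
      (\<integral>\<^sup>+s. ?G s + ?D s \<partial>S)"
  proof (intro nn_integral_mono SUP_least)
    fix s i assume i: "i \<in> J"
    have "c i * f i s \<le> c i * g i s + c i * \<bar>f i s - g i s\<bar>"
      using c[OF i] by (simp flip: distrib_left)
    then have "ennreal (c i * f i s) \<le> ennreal (c i * g i s + c i * \<bar>f i s - g i s\<bar>)"
      by (rule ennreal_leI)
    also have "\<dots> \<le> ennreal (c i * g i s) + ennreal (c i * \<bar>f i s - g i s\<bar>)"
      using c[OF i] by (cases "c i * g i s \<ge> 0")
        (auto simp: ennreal_plus ennreal_neg intro!: ennreal_leI)
    also have "ennreal (c i * \<bar>f i s - g i s\<bar>) \<le> ?D s"
      using i J by (intro member_le_sum) auto
    also have "ennreal (c i * g i s) \<le> ?G s"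
      using i by (rule SUP_upper)
    finally show "ennreal (c i * f i s) \<le> ?G s + ?D s"
      by (simp add: add_mono)
  qed
  also have "\<dots> = (\<integral>\<^sup>+s. ?G s \<partial>S) +
      (\<Sum>i\<in>J. \<integral>\<^sup>+s. ennreal (c i * \<bar>f i s - g i s\<bar>) \<partial>S)"
    using J by (subst nn_integral_add) (auto intro!: borel_measurable_SUP countable_finite simp: nn_integral_sum)
  also have "(\<Sum>i\<in>J. \<integral>\<^sup>+s. ennreal (c i * \<bar>f i s - g i s\<bar>) \<partial>S) =
      (\<Sum>i\<in>J. ennreal (c i * ?d i))"
  proof (rule sum.cong)
    fix i assume i: "i \<in> J"
    have "(\<integral>\<^sup>+s. ennreal (c i * \<bar>f i s - g i s\<bar>) \<partial>S) = ennreal (\<integral>s. c i * \<bar>f i s - g i s\<bar> \<partial>S)"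
      using f[OF i] g[OF i] c[OF i]
      by (intro nn_integral_eq_integral integrable_mult_right integrable_abs Bochner_Integration.integrable_diff)
         (auto intro!: mult_nonneg_nonneg less_imp_le)
    then show "(\<integral>\<^sup>+s. ennreal (c i * \<bar>f i s - g i s\<bar>) \<partial>S) = ennreal (c i * ?d i)"
      by simp
  qed simp
  also have "\<dots> = ennreal (\<Sum>i\<in>J. c i * ?d i)"
    using c by (intro sum_ennreal mult_nonneg_nonneg) (auto intro: less_imp_le)
  finally show ?thesis .
qed

lemma nn_integral_SUP_finite:
  fixes f :: "'i \<Rightarrow> 's \<Rightarrow> real"
  assumes J: "finite J" and f: "\<And>i. i \<in> J \<Longrightarrow> integrable S (f i)" and c: "\<And>i. i \<in> J \<Longrightarrow> c i > 0"
  shows "(\<integral>\<^sup>+s. (SUP i\<in>J. ennreal (c i * f i s)) \<partial>S) < \<infinity>"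
proof -
  have "(\<integral>\<^sup>+s. (SUP i\<in>J. ennreal (c i * f i s)) \<partial>S) \<le>
      (\<integral>\<^sup>+s. (SUP i\<in>J. ennreal (c i * 0)) \<partial>S) + ennreal (\<Sum>i\<in>J. c i * (\<integral>s. \<bar>f i s - 0\<bar> \<partial>S))"
    by (rule nn_integral_SUP_le_add_L1[OF J f _ c, where g="\<lambda>_ _. 0"]) auto
  also have "(SUP i\<in>J. ennreal (c i * 0)) = 0"
    by (cases "J = {}") (auto simp: bot_ennreal)
  finally show ?thesis by (auto simp: le_less_trans)
qed

lemma nn_integral_SUP_scale:
  fixes f :: "'i \<Rightarrow> 's \<Rightarrow> real"
  assumes J: "finite J" and f: "\<And>i. i \<in> J \<Longrightarrow> f i \<in> borel_measurable S" and t: "t \<ge> 0"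
  shows "(\<integral>\<^sup>+s. (SUP i\<in>J. ennreal (t * c i * f i s)) \<partial>S) = ennreal t * (\<integral>\<^sup>+s. (SUP i\<in>J. ennreal (c i * f i s)) \<partial>S)"
proof -
  have "(SUP i\<in>J. ennreal (t * c i * f i s)) = ennreal t * (SUP i\<in>J. ennreal (c i * f i s))" for s
    using t by (cases "J = {}") (auto simp: SUP_mult_left_ennreal ennreal_mult' mult.assoc bot_ennreal)
  moreover have "(\<lambda>s. SUP i\<in>J. ennreal (c i * f i s)) \<in> borel_measurable S"
    using J f by (intro borel_measurable_SUP countable_finite) auto
  ultimately show ?thesis
    by (simp add: nn_integral_cmult)
qed

context frechet_sup_measure begin

lemma simple_extremal_integral_nonneg: "simple_extremal_integral S M h \<omega> \<ge> 0"
  by (simp add: simple_extremal_integral_def)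

text \<open>An event about the limits and the corresponding event about the approximating integrals differ by small
  probabilities once the levels are spread by a factor \<open>\<theta> > 1\<close>. Spreading the levels only rescales the
  exponent, so the two bounds meet as \<open>\<theta>\<close> tends to \<open>1\<close>.\<close>

lemma prob_extremal_integrals:
  fixes f :: "'i \<Rightarrow> 's \<Rightarrow> real"
  assumes J: "finite J"
    and Y: "\<And>i. i \<in> J \<Longrightarrow> has_extremal_integral Q S M (f i) (Y i)"
    and c: "\<And>i. i \<in> J \<Longrightarrow> c i > 0"
  shows "prob {\<omega> \<in> space Q. \<forall>i\<in>J. c i * Y i \<omega> \<le> 1} =
         exp (- enn2real (\<integral>\<^sup>+s. (SUP i\<in>J. ennreal (c i * f i s)) \<partial>S))"
proof -
  have f: "integrable S (f i)" and Ym[measurable]: "Y i \<in> borel_measurable Q" if "i \<in> J" for i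
    using Y[OF that] by (auto simp: has_extremal_integral_def)
  have "\<forall>i\<in>J. \<exists>h :: nat \<Rightarrow> 's \<Rightarrow> real.
      (\<forall>n. simple_function S (h n) \<and> integrable S (h n) \<and> (\<forall>s\<in>space S. h n s \<ge> 0)) \<and>
      (\<lambda>n. \<integral>s. \<bar>h n s - f i s\<bar> \<partial>S) \<longlonglongrightarrow> 0 \<and>
      tendsto_in_prob Q (\<lambda>n. simple_extremal_integral S M (h n)) (Y i)"
    using Y by (auto simp: has_extremal_integral_def)
  from bchoice[OF this] obtain h :: "'i \<Rightarrow> nat \<Rightarrow> 's \<Rightarrow> real" where
    h_all: "\<forall>i\<in>J.
      (\<forall>n. simple_function S (h i n) \<and> integrable S (h i n) \<and> (\<forall>s\<in>space S. h i n s \<ge> 0)) \<and>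
      (\<lambda>n. \<integral>s. \<bar>h i n s - f i s\<bar> \<partial>S) \<longlonglongrightarrow> 0 \<and>
      tendsto_in_prob Q (\<lambda>n. simple_extremal_integral S M (h i n)) (Y i)" ..
  have h: "\<And>i n. i \<in> J \<Longrightarrow> simple_function S (h i n)" "\<And>i n. i \<in> J \<Longrightarrow> integrable S (h i n)"
       "\<And>i n s. i \<in> J \<Longrightarrow> s \<in> space S \<Longrightarrow> h i n s \<ge> 0"
    and L1: "\<And>i. i \<in> J \<Longrightarrow> (\<lambda>n. \<integral>s. \<bar>h i n s - f i s\<bar> \<partial>S) \<longlonglongrightarrow> 0"
    and P: "\<And>i. i \<in> J \<Longrightarrow> tendsto_in_prob Q (\<lambda>n. simple_extremal_integral S M (h i n)) (Y i)"
    using h_all by blast+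
  let ?I = "\<lambda>i n. simple_extremal_integral S M (h i n)"
  have [measurable]: "?I i n \<in> borel_measurable Q" if "i \<in> J" for i n
    by (rule measurable_simple_extremal_integral[OF h(1)[OF that]])
  define R where "R = (\<integral>\<^sup>+s. (SUP i\<in>J. ennreal (c i * f i s)) \<partial>S)"
  define Rn where "Rn n = (\<integral>\<^sup>+s. (SUP i\<in>J. ennreal (c i * h i n s)) \<partial>S)" for n
  define \<delta> where "\<delta> n = (\<Sum>i\<in>J. c i * (\<integral>s. \<bar>h i n s - f i s\<bar> \<partial>S))" for n
  have \<delta>0: "\<delta> \<longlonglongrightarrow> 0"
    unfolding \<delta>_def by (intro tendsto_null_sum tendsto_mult_right_zero L1)
  have \<delta>_nonneg: "\<delta> n \<ge> 0" for n
    unfolding \<delta>_def using c by (intro sum_nonneg mult_nonneg_nonneg) (auto intro: less_imp_le)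
  have R_fin: "R < \<infinity>" unfolding R_def by (rule nn_integral_SUP_finite[OF J f c])
  have Rn_fin: "Rn n < \<infinity>" for n unfolding Rn_def by (rule nn_integral_SUP_finite[OF J h(2) c])
  have real_le: "enn2real a \<le> enn2real b + e" if "a \<le> b + ennreal e" "b < \<infinity>" "e \<ge> 0" for a b e
    using enn2real_mono[OF that(1)] that(2,3) by (simp add: enn2real_plus)
  have "Rn n \<le> R + ennreal (\<delta> n)" for n
    unfolding Rn_def R_def \<delta>_def by (rule nn_integral_SUP_le_add_L1[OF J h(2) f c])
  then have up: "enn2real (Rn n) \<le> enn2real R + \<delta> n" for n
    using real_le[OF _ R_fin \<delta>_nonneg] by blast
  have "R \<le> Rn n + ennreal (\<delta> n)" for n
    unfolding Rn_def R_def \<delta>_def abs_minus_commute[of "h _ n _"]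
    by (rule nn_integral_SUP_le_add_L1[OF J f h(2) c])
  then have lo: "enn2real R \<le> enn2real (Rn n) + \<delta> n" for n
    using real_le[OF _ Rn_fin \<delta>_nonneg] by blast
  have Rlim: "(\<lambda>n. enn2real (Rn n)) \<longlonglongrightarrow> enn2real R"
  proof (rule tendsto_sandwich)
    show "(\<lambda>n. enn2real R - \<delta> n) \<longlonglongrightarrow> enn2real R" "(\<lambda>n. enn2real R + \<delta> n) \<longlonglongrightarrow> enn2real R"
      using tendsto_diff[OF tendsto_const \<delta>0] tendsto_add[OF tendsto_const \<delta>0] by auto
  qed (use up lo in \<open>auto simp: diff_le_eq\<close>)
  have In: "prob {\<omega> \<in> space Q. \<forall>i\<in>J. t * c i * ?I i n \<omega> \<le> 1} = exp (- (t * enn2real (Rn n)))"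
    if t: "t > 0" for t n
  proof -
    have "prob {\<omega> \<in> space Q. \<forall>i\<in>J. t * c i * ?I i n \<omega> \<le> 1} =
        exp (- enn2real (\<integral>\<^sup>+s. (SUP i\<in>J. ennreal (t * c i * h i n s)) \<partial>S))"
      using t c by (intro prob_simple_extremal_integrals J h) auto
    also have "(\<integral>\<^sup>+s. (SUP i\<in>J. ennreal (t * c i * h i n s)) \<partial>S) = ennreal t * Rn n"
      unfolding Rn_def using t h(2) by (intro nn_integral_SUP_scale J) auto
    finally show ?thesis using t by (simp add: enn2real_mult)
  qed
  define p where "p \<epsilon> n = (\<Sum>i\<in>J. prob {\<omega> \<in> space Q. \<bar>?I i n \<omega> - Y i \<omega>\<bar> > \<epsilon> / c i})" for \<epsilon> n
  have p0: "p \<epsilon> \<longlonglongrightarrow> 0" if "\<epsilon> > 0" for \<epsilon>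
    unfolding p_def using P c that by (intro tendsto_null_sum) (auto simp: tendsto_in_prob_def)
  let ?far = "\<lambda>\<epsilon> n. \<Union>i\<in>J. {\<omega> \<in> space Q. \<bar>?I i n \<omega> - Y i \<omega>\<bar> > \<epsilon> / c i}"
    and ?Y1 = "{\<omega> \<in> space Q. \<forall>i\<in>J. c i * Y i \<omega> \<le> 1}"
    and ?I1 = "\<lambda>t n. {\<omega> \<in> space Q. \<forall>i\<in>J. t * c i * ?I i n \<omega> \<le> 1}"
  have meas_All: "{\<omega> \<in> space Q. \<forall>i\<in>J. Z i \<omega> \<le> 1} \<in> events"
    if "\<And>i. i \<in> J \<Longrightarrow> Z i \<in> borel_measurable Q" for Z :: "'i \<Rightarrow> 'q \<Rightarrow> real"
    using J that by (intro sets.sets_Collect_finite_All) auto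
  have meas_far: "{\<omega> \<in> space Q. \<bar>?I i n \<omega> - Y i \<omega>\<bar> > \<epsilon>} \<in> events" if [simp]: "i \<in> J" for i n \<epsilon>
    by measurable
  have meas_Far: "(?far \<epsilon> n) \<in> events" for n \<epsilon>
    using J meas_far by (intro sets.finite_UN) auto
  have prob_Far: "prob (?far \<epsilon> n) \<le> p \<epsilon> n" for n \<epsilon>
    unfolding p_def using J meas_far by (intro finite_measure_subadditive_finite) auto
  define F where "F = prob ?Y1"
  have close: "\<bar>c * x - c * y\<bar> \<le> \<epsilon>" if "\<not> \<bar>x - y\<bar> > \<epsilon> / c" "c > 0" for x y \<epsilon> c :: real
  proof -
    have "\<bar>c * x - c * y\<bar> = \<bar>x - y\<bar> * c"
      using that(2) by (simp add: abs_mult mult.commute flip: right_diff_distrib)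
    also have "\<dots> \<le> \<epsilon>"
      using that by (simp add: not_less pos_le_divide_eq)
    finally show ?thesis .
  qed
  have upper: "F \<le> exp (- (enn2real R / \<theta>))" if \<theta>: "\<theta> > 1" for \<theta>
  proof -
    have "F \<le> exp (- (1 / \<theta> * enn2real (Rn n))) + p (\<theta> - 1) n" for n
    proof -
      have "F \<le> prob (?I1 (1 / \<theta>) n \<union>
          (?far (\<theta> - 1) n))"
        unfolding F_def
      proof (rule finite_measure_mono)
        show "?Y1 \<subseteq> (?I1 (1 / \<theta>) n) \<union>
          (?far (\<theta> - 1) n)"
        proof safe
          fix \<omega> i assume *: "\<forall>i\<in>J. c i * Y i \<omega> \<le> 1" "i \<in> J"
            "\<omega> \<notin> (?far (\<theta> - 1) n)" "\<omega> \<in> space Q"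
          then have "\<bar>c i * ?I i n \<omega> - c i * Y i \<omega>\<bar> \<le> \<theta> - 1"
            using c by (intro close) auto
          with * have "c i * ?I i n \<omega> \<le> \<theta>" by fastforce
          then show "1 / \<theta> * c i * ?I i n \<omega> \<le> 1"
            using \<theta> by (simp add: field_simps)
        qed
        show "(?I1 (1 / \<theta>) n) \<union>
            (?far (\<theta> - 1) n) \<in> events"
          by (intro sets.Un meas_All meas_Far) auto
      qed
      also have "\<dots> \<le> prob (?I1 (1 / \<theta>) n) +
          prob (?far (\<theta> - 1) n)"
        by (intro measure_Un_le meas_All meas_Far) auto
      also have "\<dots> \<le> prob (?I1 (1 / \<theta>) n) + p (\<theta> - 1) n"
        by (intro add_left_mono prob_Far)
      finally show ?thesis using \<theta> by (subst (asm) In) auto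
    qed
    moreover have "(\<lambda>n. exp (- (1 / \<theta> * enn2real (Rn n))) + p (\<theta> - 1) n) \<longlonglongrightarrow> exp (- (1 / \<theta> * enn2real R)) + 0"
      using \<theta> by (intro tendsto_intros Rlim p0) auto
    ultimately have "F \<le> exp (- (1 / \<theta> * enn2real R)) + 0"
      by (intro LIMSEQ_le_const) auto
    then show ?thesis by simp
  qed
  have lower: "exp (- (enn2real R * \<theta>)) \<le> F" if \<theta>: "\<theta> > 1" for \<theta>
  proof -
    have "exp (- (\<theta> * enn2real (Rn n))) - p (1 - 1 / \<theta>) n \<le> F" for n
    proof -
      have "prob (?I1 \<theta> n) \<le>
         prob (?Y1 \<union>
          (?far (1 - 1 / \<theta>) n))"
      proof (rule finite_measure_mono)
        show "(?I1 \<theta> n) \<subseteq> ?Y1 \<union>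
          (?far (1 - 1 / \<theta>) n)"
        proof safe
          fix \<omega> i assume *: "\<forall>i\<in>J. \<theta> * c i * ?I i n \<omega> \<le> 1" "i \<in> J"
            "\<omega> \<notin> (?far (1 - 1 / \<theta>) n)" "\<omega> \<in> space Q"
          then have 1: "\<bar>c i * ?I i n \<omega> - c i * Y i \<omega>\<bar> \<le> 1 - 1 / \<theta>"
            using c by (intro close) auto
          have "c i * ?I i n \<omega> \<le> 1 / \<theta>" using * \<theta> by (auto simp: field_simps)
          with 1 show "c i * Y i \<omega> \<le> 1" by linarith
        qed
        show "?Y1 \<union>
            (?far (1 - 1 / \<theta>) n) \<in> events"
          by (intro sets.Un meas_All meas_Far) auto
      qed
      also have "\<dots> \<le> F + prob (?far (1 - 1 / \<theta>) n)"
        unfolding F_def by (intro measure_Un_le meas_All meas_Far) auto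
      also have "\<dots> \<le> F + p (1 - 1 / \<theta>) n"
        by (intro add_left_mono prob_Far)
      finally show ?thesis using \<theta> by (subst (asm) In) auto
    qed
    moreover have "(\<lambda>n. exp (- (\<theta> * enn2real (Rn n))) - p (1 - 1 / \<theta>) n) \<longlonglongrightarrow> exp (- (\<theta> * enn2real R)) - 0"
      using \<theta> by (intro tendsto_intros Rlim p0) auto
    ultimately have "exp (- (\<theta> * enn2real R)) - 0 \<le> F"
      by (intro LIMSEQ_le_const2) auto
    then show ?thesis by (simp add: mult.commute)
  qed
  have lim1: "((\<lambda>\<theta>. exp (- (enn2real R / \<theta>))) \<longlongrightarrow> exp (- (enn2real R / 1))) (at_right (1::real))"
    by (intro tendsto_intros) auto
  have lim2: "((\<lambda>\<theta>. exp (- (enn2real R * \<theta>))) \<longlongrightarrow> exp (- (enn2real R * 1))) (at_right (1::real))"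
    by (intro tendsto_intros)
  have ev: "eventually (\<lambda>\<theta>. \<theta> > 1) (at_right (1::real))"
    by (rule eventually_at_right_less)
  have "F \<le> exp (- (enn2real R / 1))"
    using eventually_mono[OF ev upper] by (intro tendsto_lowerbound[OF lim1]) auto
  moreover have "exp (- (enn2real R * 1)) \<le> F"
    using eventually_mono[OF ev lower] by (intro tendsto_upperbound[OF lim2]) auto
  ultimately show ?thesis unfolding F_def R_def by simp
qed

lemma AE_extremal_integral_nonneg:
  assumes Y: "has_extremal_integral Q S M f Y"
  shows "AE \<omega> in Q. Y \<omega> \<ge> 0"
proof -
  from Y obtain h where h: "\<And>n. simple_function S (h n)"
    and P: "tendsto_in_prob Q (\<lambda>n. simple_extremal_integral S M (h n)) Y"
    and [measurable]: "Y \<in> borel_measurable Q"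
    by (auto simp: has_extremal_integral_def)
  note [measurable] = measurable_simple_extremal_integral[OF h]
  let ?far = "\<lambda>n k. {\<omega> \<in> space Q. \<bar>simple_extremal_integral S M (h n) \<omega> - Y \<omega>\<bar> > 1 / Suc k}"
    and ?neg = "\<lambda>k. {\<omega> \<in> space Q. Y \<omega> < - (1 / Suc k)}"
  have "AE \<omega> in Q. - (1 / Suc k) \<le> Y \<omega>" for k
  proof -
    have "prob (?neg k) \<le>
        prob (?far n k)" for n
    proof (rule finite_measure_mono)
      show "?neg k \<subseteq>
          ?far n k"
      proof safe
        fix \<omega> assume "Y \<omega> < - (1 / Suc k)"
        then show "\<bar>simple_extremal_integral S M (h n) \<omega> - Y \<omega>\<bar> > 1 / Suc k"
          using simple_extremal_integral_nonneg[of "h n" \<omega>] by linarith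
      qed
    qed measurable
    moreover have "(\<lambda>n. prob (?far n k)) \<longlonglongrightarrow> 0"
      using P unfolding tendsto_in_prob_def by (elim allE[of _ "1 / Suc k"]) auto
    ultimately have "prob (?neg k) \<le> 0"
      by (intro LIMSEQ_le_const) auto
    then have "prob (?neg k) = 0"
      using measure_nonneg antisym by blast
    then have "AE \<omega> in Q. \<not> Y \<omega> < - (1 / Suc k)"
      by (subst (asm) prob_Collect_eq_0) auto
    then show ?thesis by (simp add: not_less)
  qed
  then have "AE \<omega> in Q. \<forall>k. - (1 / Suc k) \<le> Y \<omega>"
    by (simp add: AE_all_countable)
  then show ?thesis
  proof eventually_elim
    case (elim \<omega>)
    have "(\<lambda>k. - (1 / Suc k)) \<longlonglongrightarrow> - 0"
      by (intro tendsto_minus LIMSEQ_inverse_real_of_nat[unfolded inverse_eq_divide])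
    with elim show ?case by (intro LIMSEQ_le_const2[of _ "0::real"]) auto
  qed
qed

end

text \<open>As for exponential moments, half-lines are replaced by Borel sets one coordinate at a time.\<close>

lemma joint_cdf_determines_rectangles:
  fixes X :: "'i \<Rightarrow> 'a \<Rightarrow> real" and Y :: "'i \<Rightarrow> 'b \<Rightarrow> real"
  assumes M: "prob_space M" and N: "prob_space N" and J: "finite J"
    and X: "\<And>i. i \<in> J \<Longrightarrow> X i \<in> borel_measurable M" and Y: "\<And>i. i \<in> J \<Longrightarrow> Y i \<in> borel_measurable N"
    and cdf: "\<And>x. measure M {\<omega> \<in> space M. \<forall>i\<in>J. X i \<omega> \<le> x i} = measure N {\<omega> \<in> space N. \<forall>i\<in>J. Y i \<omega> \<le> x i}"
    and K: "K \<subseteq> J" and B: "\<And>i. i \<in> K \<Longrightarrow> B i \<in> sets borel"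
  shows "measure M {\<omega> \<in> space M. (\<forall>i\<in>K. X i \<omega> \<in> B i) \<and> (\<forall>i\<in>J - K. X i \<omega> \<le> x i)} =
         measure N {\<omega> \<in> space N. (\<forall>i\<in>K. Y i \<omega> \<in> B i) \<and> (\<forall>i\<in>J - K. Y i \<omega> \<le> x i)}"
proof -
  have "finite K" using J K by (rule rev_finite_subset)
  from this K B show ?thesis
  proof (induction K arbitrary: x)
    case empty
    show ?case using cdf by simp
  next
    case (insert m K)
    have meas: "{\<omega> \<in> space L. (\<forall>i\<in>K. Z i \<omega> \<in> B i) \<and> (\<forall>i\<in>J - insert m K. Z i \<omega> \<le> x i)} \<in> sets L"
      if "\<And>i. i \<in> J \<Longrightarrow> Z i \<in> borel_measurable L" for Z :: "'i \<Rightarrow> 'c \<Rightarrow> real" and L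
    proof (intro sets.sets_Collect_conj sets.sets_Collect_finite_All)
      fix i assume "i \<in> K"
      then have "i \<in> J" "B i \<in> sets borel" using insert.prems by auto
      from measurable_sets[OF that[OF this(1)] this(2)]
      show "{\<omega> \<in> space L. Z i \<omega> \<in> B i} \<in> sets L" by (simp add: vimage_def Int_def conj_commute)
    next
      fix i assume "i \<in> J - insert m K"
      then show "{\<omega> \<in> space L. Z i \<omega> \<le> x i} \<in> sets L" using that[of i] by simp
    qed (use J insert.hyps in auto)
    let ?A = "{\<omega> \<in> space M. (\<forall>i\<in>K. X i \<omega> \<in> B i) \<and> (\<forall>i\<in>J - insert m K. X i \<omega> \<le> x i)}"
    let ?C = "{\<omega> \<in> space N. (\<forall>i\<in>K. Y i \<omega> \<in> B i) \<and> (\<forall>i\<in>J - insert m K. Y i \<omega> \<le> x i)}"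
    have A: "?A \<in> sets M" and C: "?C \<in> sets N" using meas X Y by auto
    define M1 where "M1 = distr (density M (indicator ?A)) borel (X m)"
    define N1 where "N1 = distr (density N (indicator ?C)) borel (Y m)"
    have m: "m \<in> J" using insert.prems by simp
    note [measurable] = X[OF m] Y[OF m] A C
    interpret M: prob_space M by fact
    interpret N: prob_space N by fact
    have M1: "emeasure M1 S = emeasure M {\<omega> \<in> ?A. X m \<omega> \<in> S}" if [measurable]: "S \<in> sets borel" for S
    proof -
      have "emeasure M1 S = emeasure M (?A \<inter> (X m -` S \<inter> space M))"
        unfolding M1_def by (simp add: emeasure_distr emeasure_density nn_integral_indicator flip: indicator_inter_arith)
      then show ?thesis by (simp add: Int_def vimage_def conj_ac cong: conj_cong)
    qed
    have N1: "emeasure N1 S = emeasure N {\<omega> \<in> ?C. Y m \<omega> \<in> S}" if [measurable]: "S \<in> sets borel" for S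
    proof -
      have "emeasure N1 S = emeasure N (?C \<inter> (Y m -` S \<inter> space N))"
        unfolding N1_def by (simp add: emeasure_distr emeasure_density nn_integral_indicator flip: indicator_inter_arith)
      then show ?thesis by (simp add: Int_def vimage_def conj_ac cong: conj_cong)
    qed
    have "M1 = N1"
    proof (rule cdf_unique')
      show "finite_borel_measure M1"
        using M1[of UNIV] by (intro finite_borel_measure.intro finite_measureI finite_borel_measure_axioms.intro)
          (auto simp: M1_def)
      show "finite_borel_measure N1"
        using N1[of UNIV] by (intro finite_borel_measure.intro finite_measureI finite_borel_measure_axioms.intro)
          (auto simp: N1_def)
      show "cdf M1 = cdf N1"
      proof
        fix t
        have "{\<omega> \<in> space L. (\<forall>i\<in>K. Z i \<omega> \<in> B i) \<and> (\<forall>i\<in>J - K. Z i \<omega> \<le> (x(m := t)) i)} =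
            {\<omega> \<in> {\<omega> \<in> space L. (\<forall>i\<in>K. Z i \<omega> \<in> B i) \<and> (\<forall>i\<in>J - insert m K. Z i \<omega> \<le> x i)}. Z m \<omega> \<in> {..t}}"
          for Z :: "'i \<Rightarrow> 'c \<Rightarrow> real" and L
          using m insert.hyps by auto
        note eq = this
        have "measure M {\<omega> \<in> ?A. X m \<omega> \<in> {..t}} = measure N {\<omega> \<in> ?C. Y m \<omega> \<in> {..t}}"
          unfolding eq[symmetric] using insert.prems by (intro insert.IH) auto
        then show "cdf M1 t = cdf N1 t"
          using M1[of "{..t}"] N1[of "{..t}"] by (simp add: cdf_def measure_def)
      qed
    qed
    then have "emeasure M1 (B m) = emeasure N1 (B m)" by simp
    then have "measure M {\<omega> \<in> ?A. X m \<omega> \<in> B m} = measure N {\<omega> \<in> ?C. Y m \<omega> \<in> B m}"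
      using insert.prems(2)[of m] by (simp add: M1 N1 measure_def)
    moreover have "{\<omega> \<in> {\<omega> \<in> space L. (\<forall>i\<in>K. Z i \<omega> \<in> B i) \<and> (\<forall>i\<in>J - insert m K. Z i \<omega> \<le> x i)}. Z m \<omega> \<in> B m} =
        {\<omega> \<in> space L. (\<forall>i\<in>insert m K. Z i \<omega> \<in> B i) \<and> (\<forall>i\<in>J - insert m K. Z i \<omega> \<le> x i)}"
      for Z :: "'i \<Rightarrow> 'c \<Rightarrow> real" and L by auto
    ultimately show ?case by metis
  qed
qed

lemma distr_eqI_joint_cdf:
  fixes X :: "'i \<Rightarrow> 'a \<Rightarrow> real" and Y :: "'i \<Rightarrow> 'b \<Rightarrow> real"
  assumes M: "prob_space M" and N: "prob_space N" and J: "finite J"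
    and X: "\<And>i. i \<in> J \<Longrightarrow> X i \<in> borel_measurable M" and Y: "\<And>i. i \<in> J \<Longrightarrow> Y i \<in> borel_measurable N"
    and cdf: "\<And>x. measure M {\<omega> \<in> space M. \<forall>i\<in>J. X i \<omega> \<le> x i} = measure N {\<omega> \<in> space N. \<forall>i\<in>J. Y i \<omega> \<le> x i}"
  shows "distr M (\<Pi>\<^sub>M i\<in>J. borel) (\<lambda>\<omega>. \<lambda>i\<in>J. X i \<omega>) = distr N (\<Pi>\<^sub>M i\<in>J. borel) (\<lambda>\<omega>. \<lambda>i\<in>J. Y i \<omega>)"
proof (rule measure_eqI_PiM_finite[OF J])
  let ?DX = "distr M (\<Pi>\<^sub>M i\<in>J. borel) (\<lambda>\<omega>. \<lambda>i\<in>J. X i \<omega>)" and ?DY = "distr N (\<Pi>\<^sub>M i\<in>J. borel) (\<lambda>\<omega>. \<lambda>i\<in>J. Y i \<omega>)"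
  interpret M: prob_space M by fact
  interpret N: prob_space N by fact
  have mX: "(\<lambda>\<omega>. \<lambda>i\<in>J. X i \<omega>) \<in> measurable M (\<Pi>\<^sub>M i\<in>J. borel)"
    and mY: "(\<lambda>\<omega>. \<lambda>i\<in>J. Y i \<omega>) \<in> measurable N (\<Pi>\<^sub>M i\<in>J. borel)"
    using X Y by (auto intro!: measurable_restrict)
  show "emeasure ?DX (Pi\<^sub>E J B) =
      emeasure ?DY (Pi\<^sub>E J B)"
    if B: "\<And>i. i \<in> J \<Longrightarrow> B i \<in> sets (borel :: real measure)" for B
  proof -
    have "Pi\<^sub>E J B \<in> sets (\<Pi>\<^sub>M i\<in>J. borel)" using B J by (intro sets_PiM_I_finite) auto
    moreover have pre: "(\<lambda>\<omega>. \<lambda>i\<in>J. Z i \<omega>) -` Pi\<^sub>E J B \<inter> space L = {\<omega> \<in> space L. \<forall>i\<in>J. Z i \<omega> \<in> B i}"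
      for Z :: "'i \<Rightarrow> 'c \<Rightarrow> real" and L by (auto simp: PiE_iff)
    ultimately show ?thesis
      using joint_cdf_determines_rectangles[OF M N J X Y cdf order_refl, of B "\<lambda>_. 0"] B
      by (simp add: emeasure_distr pre mX mY M.emeasure_eq_measure N.emeasure_eq_measure)
  qed
  show "range (\<lambda>_. \<Pi>\<^sub>E i\<in>J. (UNIV :: real set)) \<subseteq> prod_algebra J (\<lambda>_. borel)"
    using J by (auto intro!: prod_algebraI_finite)
  show "(\<Union>i::nat. (\<Pi>\<^sub>E i\<in>J. UNIV)) = space (\<Pi>\<^sub>M i\<in>J. (borel :: real measure))"
    by (simp add: space_PiM)
  interpret D: prob_space ?DX
    using mX by (rule M.prob_space_distr)
  show "emeasure ?DX (\<Pi>\<^sub>E i\<in>J. UNIV) \<noteq> \<infinity>"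
    by simp
qed auto

text \<open>The formula for the joint law covers positive levels only; level \<open>0\<close> is reached by continuity from above,
  and below \<open>0\<close> both distribution functions vanish because extremal integrals are almost surely nonnegative.\<close>

lemma eq_fdd_extremal_integrals:
  assumes M: "frechet_sup_measure Q S M" and M': "frechet_sup_measure Q' S' M'"
    and Y: "\<And>t. has_extremal_integral Q S M (f t) (Y t)"
    and Y': "\<And>t. has_extremal_integral Q' S' M' (f' t) (Y' t)"
    and eq: "\<And>J c. finite J \<Longrightarrow> (\<And>t. t \<in> J \<Longrightarrow> c t > 0) \<Longrightarrow>
      (\<integral>\<^sup>+s. (SUP t\<in>J. ennreal (c t * f t s)) \<partial>S) = (\<integral>\<^sup>+s. (SUP t\<in>J. ennreal (c t * f' t s)) \<partial>S')"
  shows "eq_fdd Q Y Q' Y'"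
  unfolding eq_fdd_def
proof (intro allI impI)
  fix J :: "real set" assume J: "finite J"
  interpret M: frechet_sup_measure Q S M by fact
  interpret M': frechet_sup_measure Q' S' M' by fact
  have Ym[measurable]: "Y t \<in> borel_measurable Q" and Ym'[measurable]: "Y' t \<in> borel_measurable Q'" for t
    using Y Y' by (auto simp: has_extremal_integral_def)
  have nonneg: "AE \<omega> in Q. Y t \<omega> \<ge> 0" and nonneg': "AE \<omega> in Q'. Y' t \<omega> \<ge> 0" for t
    using M.AE_extremal_integral_nonneg[OF Y] M'.AE_extremal_integral_nonneg[OF Y'] by auto
  have sets1[measurable]: "{\<omega> \<in> space Q. \<forall>t\<in>J. Y t \<omega> \<le> x t} \<in> sets Q"
    and sets2[measurable]: "{\<omega> \<in> space Q'. \<forall>t\<in>J. Y' t \<omega> \<le> x t} \<in> sets Q'" for x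
    using J by (auto intro!: sets.sets_Collect_finite_All)
  have pos: "measure Q {\<omega> \<in> space Q. \<forall>t\<in>J. Y t \<omega> \<le> x t} = measure Q' {\<omega> \<in> space Q'. \<forall>t\<in>J. Y' t \<omega> \<le> x t}"
    if x: "\<And>t. t \<in> J \<Longrightarrow> x t > 0" for x
  proof -
    have c: "1 / x t > 0" if "t \<in> J" for t using x[OF that] by simp
    have "(\<forall>t\<in>J. Z t \<le> x t) \<longleftrightarrow> (\<forall>t\<in>J. 1 / x t * Z t \<le> 1)" for Z :: "real \<Rightarrow> real"
      using x by (auto simp: divide_le_eq)
    then show ?thesis
      using M.prob_extremal_integrals[OF J Y c] M'.prob_extremal_integrals[OF J Y' c] eq[OF J c]
      by simp
  qed
  have "measure Q {\<omega> \<in> space Q. \<forall>t\<in>J. Y t \<omega> \<le> x t} = measure Q' {\<omega> \<in> space Q'. \<forall>t\<in>J. Y' t \<omega> \<le> x t}" for x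
  proof (cases "\<exists>t\<in>J. x t < 0")
    case True
    then obtain t where t: "t \<in> J" "x t < 0" by blast
    have "AE \<omega> in Q. \<not> (\<forall>t\<in>J. Y t \<omega> \<le> x t)" "AE \<omega> in Q'. \<not> (\<forall>t\<in>J. Y' t \<omega> \<le> x t)"
      using nonneg[of t] nonneg'[of t] t by (force elim!: eventually_mono)+
    then show ?thesis
      using M.prob_Collect_eq_0[OF sets1[of x]] M'.prob_Collect_eq_0[OF sets2[of x]] by simp
  next
    case False
    have step: "x t + 1 / (2 + real n) \<le> x t + 1 / (1 + real n)" for t n
      by (simp add: divide_left_mono)
    let ?A = "\<lambda>n. {\<omega> \<in> space Q. \<forall>t\<in>J. Y t \<omega> \<le> x t + 1 / Suc n}"
      and ?A' = "\<lambda>n. {\<omega> \<in> space Q'. \<forall>t\<in>J. Y' t \<omega> \<le> x t + 1 / Suc n}"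
    have "(\<lambda>n. measure Q (?A n)) \<longlonglongrightarrow>
        measure Q (\<Inter>n. ?A n)"
      by (intro M.finite_Lim_measure_decseq) (auto simp: decseq_Suc_iff intro!: order_trans[OF _ step])
    moreover have "(\<lambda>n. measure Q' (?A' n)) \<longlonglongrightarrow>
        measure Q' (\<Inter>n. ?A' n)"
      by (intro M'.finite_Lim_measure_decseq) (auto simp: decseq_Suc_iff intro!: order_trans[OF _ step])
    moreover have "measure Q (?A n) =
        measure Q' (?A' n)" for n
      using False by (intro pos) (auto simp: not_less intro: add_nonneg_pos)
    moreover have inter: "(\<Inter>n. {\<omega> \<in> space L. \<forall>t\<in>J. Z t \<omega> \<le> x t + 1 / Suc n}) = {\<omega> \<in> space L. \<forall>t\<in>J. Z t \<omega> \<le> x t}"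
      for Z :: "real \<Rightarrow> 'z \<Rightarrow> real" and L
    proof (intro set_eqI iffI)
      fix \<omega> assume *: "\<omega> \<in> (\<Inter>n. {\<omega> \<in> space L. \<forall>t\<in>J. Z t \<omega> \<le> x t + 1 / Suc n})"
      have "Z t \<omega> \<le> x t" if "t \<in> J" for t
      proof (rule LIMSEQ_le_const)
        show "(\<lambda>n. x t + 1 / Suc n) \<longlonglongrightarrow> x t"
          using tendsto_add[OF tendsto_const LIMSEQ_inverse_real_of_nat] by (simp add: inverse_eq_divide)
      qed (use * that in auto)
      with * show "\<omega> \<in> {\<omega> \<in> space L. \<forall>t\<in>J. Z t \<omega> \<le> x t}" by auto
    next
      fix \<omega> assume "\<omega> \<in> {\<omega> \<in> space L. \<forall>t\<in>J. Z t \<omega> \<le> x t}"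
      then show "\<omega> \<in> (\<Inter>n. {\<omega> \<in> space L. \<forall>t\<in>J. Z t \<omega> \<le> x t + 1 / Suc n})"
        by (auto intro: add_increasing2)
    qed
    ultimately show ?thesis
      unfolding inter by (simp add: LIMSEQ_unique)
  qed
  then show "distr Q (\<Pi>\<^sub>M t\<in>J. borel) (\<lambda>\<omega>. \<lambda>t\<in>J. Y t \<omega>) = distr Q' (\<Pi>\<^sub>M t\<in>J. borel) (\<lambda>\<omega>. \<lambda>t\<in>J. Y' t \<omega>)"
    by (intro distr_eqI_joint_cdf J M.prob_space_axioms M'.prob_space_axioms) auto
qed

section \<open>Random point sets with Poisson avoidance probabilities\<close>

text \<open>Cutting the space into cells of measure \<open>1\<close> allows a Poisson process to be assembled from independent
  cells with a Poisson number (of mean \<open>1\<close>) of independent points each, without degenerate cells.\<close>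

definition unit_cells :: "'a measure \<Rightarrow> (nat \<Rightarrow> 'a set) \<Rightarrow> bool" where
  "unit_cells \<mu> D \<longleftrightarrow> range D \<subseteq> sets \<mu> \<and> disjoint_family D \<and> (\<Union>i. D i) = space \<mu> \<and> (\<forall>i. emeasure \<mu> (D i) = 1)"

lemma unit_cells_lborel: "unit_cells lborel (\<lambda>i. {real_of_int (int_decode i)..<real_of_int (int_decode i) + 1})"
proof -
  have "x \<in> (\<Union>i. {real_of_int (int_decode i)..<real_of_int (int_decode i) + 1})" for x :: real
    using floor_correct[of x] by (intro UN_I[of "int_encode \<lfloor>x\<rfloor>"]) auto
  moreover have "disjoint_family (\<lambda>i. {real_of_int (int_decode i)..<real_of_int (int_decode i) + 1})"
  proof (unfold disjoint_family_on_def, safe)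
    fix m n :: nat and x :: real
    assume mn: "m \<noteq> n" and "x \<in> {real_of_int (int_decode m)..<real_of_int (int_decode m) + 1}"
      and "x \<in> {real_of_int (int_decode n)..<real_of_int (int_decode n) + 1}"
    then have "int_decode m = \<lfloor>x\<rfloor>" "int_decode n = \<lfloor>x\<rfloor>" by (auto simp: floor_unique)
    then have "int_decode m = int_decode n" by simp
    then have "m = n" by (metis int_decode_inverse)
    with mn show "x \<in> {}" by simp
  qed
  ultimately show ?thesis
    by (auto simp: unit_cells_def)
qed

lemma unit_cells_sigma_finite: "unit_cells \<mu> D \<Longrightarrow> sigma_finite_measure \<mu>"
  by (standard, rule exI[of _ "range D"]) (auto simp: unit_cells_def)

lemma unit_cells_prob_pair:
  assumes N: "prob_space N" and D: "unit_cells \<mu> D"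
  shows "unit_cells (N \<Otimes>\<^sub>M \<mu>) (\<lambda>i. space N \<times> D i)"
proof -
  interpret \<mu>: sigma_finite_measure \<mu> using D by (rule unit_cells_sigma_finite)
  interpret N: prob_space N by fact
  show ?thesis
    using D by (auto simp: unit_cells_def disjoint_family_on_def space_pair_measure
      \<mu>.emeasure_pair_measure_Times N.emeasure_space_1)
qed

lemma unit_cells_pair:
  assumes C: "unit_cells \<nu> C" and D: "unit_cells \<mu> D"
  shows "unit_cells (\<nu> \<Otimes>\<^sub>M \<mu>) (\<lambda>i. C (fst (prod_decode i)) \<times> D (snd (prod_decode i)))"
proof -
  let ?a = "\<lambda>i. fst (prod_decode i)" and ?b = "\<lambda>i. snd (prod_decode i)"
  interpret \<mu>: sigma_finite_measure \<mu> using D by (rule unit_cells_sigma_finite)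
  have "(x, y) \<in> (\<Union>i. C (?a i) \<times> D (?b i))"
    if "x \<in> space \<nu>" "y \<in> space \<mu>" for x y
  proof -
    have "x \<in> (\<Union>a. C a)" "y \<in> (\<Union>b. D b)" using that C D by (auto simp: unit_cells_def)
    then obtain a b where "x \<in> C a" "y \<in> D b" by blast
    then show ?thesis by (intro UN_I[of "prod_encode (a, b)"]) auto
  qed
  moreover have disj: "disjoint_family (\<lambda>i. C (?a i) \<times> D (?b i))"
  proof (unfold disjoint_family_on_def, safe)
    fix m n x y assume *: "m \<noteq> n" "x \<in> C (fst (prod_decode m))" "y \<in> D (snd (prod_decode m))"
      "x \<in> C (fst (prod_decode n))" "y \<in> D (snd (prod_decode n))"
    then have "fst (prod_decode m) = fst (prod_decode n)" "snd (prod_decode m) = snd (prod_decode n)"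
      using C D unfolding unit_cells_def disjoint_family_on_def by blast+
    then have "m = n" by (metis prod_decode_inverse prod.expand)
    with * show "(x, y) \<in> {}" by simp
  qed
  moreover have "C (?a i) \<subseteq> space \<nu>" "D (?b i) \<subseteq> space \<mu>" for i
    using C D by (auto simp: unit_cells_def)
  ultimately have "(\<Union>i. C (?a i) \<times> D (?b i)) = space (\<nu> \<Otimes>\<^sub>M \<mu>)"
    unfolding space_pair_measure by (intro equalityI subsetI) fast+
  moreover have "C a \<in> sets \<nu>" "D b \<in> sets \<mu>" "emeasure \<nu> (C a) = 1" "emeasure \<mu> (D b) = 1" for a b
    using C D by (auto simp: unit_cells_def)
  ultimately show ?thesis
    using disj unfolding unit_cells_def
    by (intro conjI) (auto simp: \<mu>.emeasure_pair_measure_Times simp del: UN_simps)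
qed

text \<open>The probability that a Poisson process has no point in a set of measure \<open>m\<close>, with \<open>exp (- \<infinity>) = 0\<close>.\<close>

definition exp_uminus :: "ennreal \<Rightarrow> real" where
  "exp_uminus m = (if m = \<infinity> then 0 else exp (- enn2real m))"

lemma exp_uminus_ennreal[simp]: "r \<ge> 0 \<Longrightarrow> exp_uminus (ennreal r) = exp (- r)"
  by (simp add: exp_uminus_def)

lemma exp_uminus_nonneg[simp]: "exp_uminus m \<ge> 0"
  by (simp add: exp_uminus_def)

lemma exp_uminus_top[simp]: "exp_uminus \<top> = 0"
  by (simp add: exp_uminus_def)

lemma exp_uminus_0[simp]: "exp_uminus 0 = 1"
  by (simp add: exp_uminus_def)

lemma exp_uminus_sum: "finite I \<Longrightarrow> exp_uminus (\<Sum>i\<in>I. m i) = (\<Prod>i\<in>I. exp_uminus (m i))"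
proof (induction I rule: finite_induct)
  case (insert i I)
  have "exp_uminus (a + b) = exp_uminus a * exp_uminus b" for a b
    by (cases a; cases b) (auto simp: exp_uminus_def ennreal_plus[symmetric] exp_add[symmetric] simp del: ennreal_plus)
  with insert show ?case by simp
qed simp

lemma exp_uminus_partial_sums: "(\<lambda>n. exp_uminus (\<Sum>i<n. m i)) \<longlonglongrightarrow> exp_uminus (\<Sum>i. m i)"
proof (cases "(\<Sum>i. m i) = \<infinity>")
  case False
  then have fin: "m i < \<infinity>" for i
    using ennreal_suminf_lessD less_top by (metis infinity_ennreal_def)
  have lim: "(\<lambda>n. \<Sum>i<n. m i) \<longlonglongrightarrow> (\<Sum>i. m i)"
    by (rule summable_LIMSEQ[OF summableI])
  have "(\<lambda>n. enn2real (\<Sum>i<n. m i)) \<longlonglongrightarrow> enn2real (\<Sum>i. m i)"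
  proof (rule tendsto_enn2real[OF _ enn2real_nonneg])
    have "ennreal (enn2real (\<Sum>i. m i)) = (\<Sum>i. m i)"
      using False by (simp add: less_top)
    then show "(\<lambda>n. \<Sum>i<n. m i) \<longlonglongrightarrow> ennreal (enn2real (\<Sum>i. m i))"
      by (simp only: lim)
  qed
  then have "(\<lambda>n. exp (- enn2real (\<Sum>i<n. m i))) \<longlonglongrightarrow> exp (- enn2real (\<Sum>i. m i))"
    by (intro tendsto_exp tendsto_minus)
  then show ?thesis
    using False less_imp_neq[OF fin] by (simp add: exp_uminus_def)
next
  case True
  have lim: "(\<lambda>n. \<Sum>i<n. m i) \<longlonglongrightarrow> \<infinity>"
    unfolding True[symmetric] by (rule summable_LIMSEQ[OF summableI])
  have "\<forall>\<^sub>F n in sequentially. exp_uminus (\<Sum>i<n. m i) < e" if e: "e > 0" for e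
  proof -
    define K where "K = max 0 (- ln e)"
    have K: "K \<ge> 0" "- ln e \<le> K" by (auto simp: K_def)
    have "\<forall>\<^sub>F n in sequentially. ennreal K < (\<Sum>i<n. m i)"
      using lim by (rule order_tendstoD(1)) simp
    then show ?thesis
    proof eventually_elim
      case (elim n)
      show ?case
      proof (cases "\<Sum>i<n. m i")
        case (real r)
        with elim K have "- ln e < r" by (simp add: ennreal_less_iff)
        then have "exp (- r) < e" using e by (metis exp_less_mono exp_ln minus_less_iff)
        with real show ?thesis by simp
      qed (use e in \<open>simp add: exp_uminus_def\<close>)
    qed
  qed
  then show ?thesis
    using True by (auto simp: tendsto_iff dist_real_def abs_of_nonneg)
qed

text \<open>Only the avoidance probabilities of the random point set \<open>pts\<close> matter for suprema over its
  points; these are the ones of a Poisson process with intensity \<open>\<mu>\<close>.\<close>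

definition poisson_avoidance :: "'q measure \<Rightarrow> 'a measure \<Rightarrow> ('q \<Rightarrow> 'a set) \<Rightarrow> bool" where
  "poisson_avoidance Q \<mu> pts \<longleftrightarrow> prob_space Q \<and> (\<forall>\<omega>\<in>space Q. pts \<omega> \<subseteq> space \<mu>) \<and>
     (\<forall>B\<in>sets \<mu>. {\<omega> \<in> space Q. pts \<omega> \<inter> B = {}} \<in> sets Q \<and>
        measure Q {\<omega> \<in> space Q. pts \<omega> \<inter> B = {}} = exp_uminus (emeasure \<mu> B))"

text \<open>With probability \<open>(1 - p) ^ n\<close> none of \<open>n\<close> points hits \<open>B\<close>; averaging over a Poisson number of mean \<open>1\<close>
  turns this into \<open>exp (- p)\<close>.\<close>

lemma poisson_number_avoidance:
  fixes N :: "'a measure"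
  assumes N: "prob_space N" and B[measurable]: "B \<in> sets N"
  defines "C \<equiv> measure_pmf (poisson_pmf 1) \<Otimes>\<^sub>M (\<Pi>\<^sub>M k\<in>(UNIV :: nat set). N)"
  shows "{\<omega> \<in> space C. \<forall>k<fst \<omega>. snd \<omega> k \<notin> B} \<in> sets C"
    and "measure C {\<omega> \<in> space C. \<forall>k<fst \<omega>. snd \<omega> k \<notin> B} = exp (- measure N B)"
proof -
  interpret N: prob_space N by fact
  interpret P: product_prob_space "\<lambda>_. N" "UNIV :: nat set" by standard
  interpret pois: prob_space "measure_pmf (poisson_pmf 1)" by (rule prob_space_measure_pmf)
  interpret C: pair_prob_space "measure_pmf (poisson_pmf 1)" "\<Pi>\<^sub>M k\<in>(UNIV :: nat set). N" ..
  have [measurable]: "fst \<in> measurable C (count_space UNIV)"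
    unfolding C_def by simp
  have [measurable]: "(\<lambda>\<omega>. snd \<omega> k) \<in> measurable C N" for k
    unfolding C_def by measurable
  show meas: "{\<omega> \<in> space C. \<forall>k<fst \<omega>. snd \<omega> k \<notin> B} \<in> sets C"
    by measurable
  let ?A = "{\<omega> \<in> space C. \<forall>k<fst \<omega>. snd \<omega> k \<notin> B}"
  have "emeasure C ?A = (\<integral>\<^sup>+n. emeasure (\<Pi>\<^sub>M k\<in>UNIV. N) (Pair n -` ?A) \<partial>measure_pmf (poisson_pmf 1))"
    using meas unfolding C_def by (rule P.P.emeasure_pair_measure_alt)
  also have "\<dots> = (\<integral>\<^sup>+n. ennreal ((1 - measure N B) ^ n) \<partial>measure_pmf (poisson_pmf 1))"
  proof (rule nn_integral_cong)
    fix n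
    have "Pair n -` ?A = {x \<in> space (\<Pi>\<^sub>M k\<in>UNIV. N). \<forall>k\<in>{..<n}. x k \<in> space N - B}"
      by (auto simp: C_def space_pair_measure space_PiM)
    also have "emeasure (\<Pi>\<^sub>M k\<in>UNIV. N) \<dots> = (\<Prod>k\<in>{..<n}. emeasure N (space N - B))"
      by (rule P.emeasure_PiM_Collect) auto
    also have "\<dots> = ennreal ((1 - measure N B) ^ n)"
      by (simp add: N.emeasure_eq_measure N.prob_compl ennreal_power)
    finally show "emeasure (\<Pi>\<^sub>M k\<in>UNIV. N) (Pair n -` ?A) = ennreal ((1 - measure N B) ^ n)" .
  qed
  also have "\<dots> = (\<Sum>n. ennreal ((1 - measure N B) ^ n / fact n * exp (- 1)))"
    by (simp add: nn_integral_measure_pmf nn_integral_count_space_nat ennreal_mult[symmetric] mult_ac)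
  also have "\<dots> = ennreal (exp (1 - measure N B) * exp (- 1))"
  proof -
    have "(\<lambda>n. (1 - measure N B) ^ n / fact n * exp (- 1)) sums (exp (1 - measure N B) * exp (- 1))"
      using exp_converges[of "1 - measure N B"] by (intro sums_mult2) (simp add: divide_inverse mult.commute)
    then have "(\<lambda>n. ennreal ((1 - measure N B) ^ n / fact n * exp (- 1))) sums ennreal (exp (1 - measure N B) * exp (- 1))"
      by (subst sums_ennreal) auto
    then show ?thesis by (rule sums_unique[symmetric])
  qed
  finally show "measure C ?A = exp (- measure N B)"
    by (simp add: measure_def exp_add[symmetric])
qed

text \<open>Coordinate \<open>i\<close> of \<open>\<omega>\<close> holds the number of points in cell \<open>i\<close> and an infinite sequence of candidate points,
  of which only that many count. The cells are avoided independently, so their exponents add up.\<close>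

lemma unit_cells_poisson_avoidance:
  fixes \<mu> :: "'a measure"
  assumes D: "unit_cells \<mu> D"
  obtains Q :: "(nat \<Rightarrow> nat \<times> (nat \<Rightarrow> 'a)) measure" and pts where "poisson_avoidance Q \<mu> pts"
proof -
  have D_sets[measurable]: "D i \<in> sets \<mu>" and D_1: "emeasure \<mu> (D i) = 1" for i
    using D by (auto simp: unit_cells_def)
  define N where "N i = density \<mu> (indicator (D i))" for i
  have N_sets[measurable_cong]: "sets (N i) = sets \<mu>" and N_space: "space (N i) = space \<mu>" for i
    by (simp_all add: N_def)
  have N_eq: "emeasure (N i) B = emeasure \<mu> (D i \<inter> B)" if "B \<in> sets \<mu>" for i B
    using that by (simp add: N_def emeasure_density nn_integral_indicator flip: indicator_inter_arith)
  have N_prob: "prob_space (N i)" for i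
    using D_1[of i] sets.sets_into_space[OF D_sets[of i]]
    by (intro prob_spaceI) (simp add: N_space N_eq Int_absorb2)
  define C where "C i = measure_pmf (poisson_pmf 1) \<Otimes>\<^sub>M (\<Pi>\<^sub>M k\<in>(UNIV :: nat set). N i)" for i
  have C_prob: "prob_space (C i)" for i
    unfolding C_def by (intro prob_space_pair prob_space_PiM N_prob prob_space_measure_pmf)
  interpret Q: product_prob_space C "UNIV :: nat set"
    by (intro product_prob_spaceI C_prob)
  define Q where "Q = (\<Pi>\<^sub>M i\<in>(UNIV :: nat set). C i)"
  define pts where "pts \<omega> = {snd (\<omega> i) k | i k. k < fst (\<omega> i)}" for \<omega> :: "nat \<Rightarrow> nat \<times> (nat \<Rightarrow> 'a)"
  have "poisson_avoidance Q \<mu> pts"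
    unfolding poisson_avoidance_def
  proof (intro conjI ballI)
    show "prob_space Q" unfolding Q_def by (rule Q.prob_space_axioms)
    fix \<omega> assume \<omega>: "\<omega> \<in> space Q"
    then show "pts \<omega> \<subseteq> space \<mu>"
      by (auto simp: pts_def Q_def C_def space_PiM space_pair_measure N_space PiE_iff mem_Times_iff)
  next
    fix B assume B: "B \<in> sets \<mu>"
    define A where "A i = {\<omega> \<in> space (C i). \<forall>k<fst \<omega>. snd \<omega> k \<notin> B}" for i
    have A_sets[measurable]: "A i \<in> sets (C i)" for i
      using poisson_number_avoidance(1)[OF N_prob] B by (simp add: A_def C_def N_sets)
    have A_measure: "measure (C i) (A i) = exp_uminus (emeasure \<mu> (D i \<inter> B))" for i
    proof -
      interpret N: prob_space "N i" by (rule N_prob)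
      show ?thesis
        using poisson_number_avoidance(2)[OF N_prob, of B i] B N.emeasure_eq_measure[of B]
        by (simp add: A_def C_def N_sets exp_uminus_def N_eq)
    qed
    let ?A = "\<lambda>n. {\<omega> \<in> space Q. \<forall>i\<in>{..<n}. \<omega> i \<in> A i}" and ?V = "{\<omega> \<in> space Q. pts \<omega> \<inter> B = {}}"
    have ev: "?V = (\<Inter>n. ?A n)"
      by (auto simp: pts_def A_def Q_def space_PiM PiE_iff)
    have E_sets: "?A n \<in> sets Q" for n
      unfolding Q_def by measurable
    then show "?V \<in> sets Q"
      unfolding ev by (intro sets.countable_INT) auto
    have finite_n: "measure Q (?A n) = exp_uminus (\<Sum>i<n. emeasure \<mu> (D i \<inter> B))" for n
    proof -
      have "emeasure Q (?A n) = (\<Prod>i<n. emeasure (C i) (A i))"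
        unfolding Q_def by (rule Q.emeasure_PiM_Collect) auto
      also have "\<dots> = ennreal (\<Prod>i<n. measure (C i) (A i))"
        by (simp add: prod_ennreal Q.M.emeasure_eq_measure)
      finally show ?thesis
        by (simp add: measure_def[of Q] A_measure exp_uminus_sum prod_nonneg)
    qed
    have "(\<lambda>n. measure Q (?A n)) \<longlonglongrightarrow>
        measure Q ?V"
      unfolding ev unfolding Q_def
      by (rule Q.P.finite_Lim_measure_decseq) (use E_sets in \<open>auto simp: Q_def decseq_Suc_iff\<close>)
    then have "measure Q ?V = exp_uminus (\<Sum>i. emeasure \<mu> (D i \<inter> B))"
      unfolding finite_n by (rule LIMSEQ_unique[OF _ exp_uminus_partial_sums])
    also have "(\<Sum>i. emeasure \<mu> (D i \<inter> B)) = emeasure \<mu> (\<Union>i. D i \<inter> B)"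
      using D B by (intro suminf_emeasure) (auto simp: unit_cells_def disjoint_family_on_def)
    also have "(\<Union>i. D i \<inter> B) = B"
      using D sets.sets_into_space[OF B] by (auto simp: unit_cells_def)
    finally show "measure Q ?V = exp_uminus (emeasure \<mu> B)" .
  qed
  then show thesis by (rule that)
qed

text \<open>The outcomes are relabelled along an injection, and their sigma-algebra is carried along.\<close>

lemma poisson_avoidance_embed:
  assumes pts: "poisson_avoidance Q \<mu> pts" and e: "inj e"
  shows "poisson_avoidance (embed_measure Q e) \<mu> (\<lambda>\<omega>. pts (inv e \<omega>))"
proof -
  interpret Q: prob_space Q using pts by (simp add: poisson_avoidance_def)
  have ev: "{\<omega> \<in> space (embed_measure Q e). P (inv e \<omega>)} = e ` {\<omega> \<in> space Q. P \<omega>}" for P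
    using e by (auto simp: space_embed_measure)
  have em: "emeasure (embed_measure Q e) (e ` A) = emeasure Q A" if "A \<in> sets Q" for A
    using e that by (rule emeasure_embed_measure_image)
  have "prob_space (embed_measure Q e)"
    using em[of "space Q"] by (intro prob_spaceI) (simp add: space_embed_measure Q.emeasure_space_1)
  moreover have m: "measure (embed_measure Q e) (e ` A) = measure Q A" if "A \<in> sets Q" for A
    using em[OF that] by (simp add: measure_def)
  ultimately show ?thesis
    unfolding poisson_avoidance_def
  proof (intro conjI ballI)
    fix \<omega> assume "\<omega> \<in> space (embed_measure Q e)"
    then show "pts (inv e \<omega>) \<subseteq> space \<mu>"
      using pts e by (auto simp: space_embed_measure poisson_avoidance_def)
  next
    fix B assume "B \<in> sets \<mu>"
    then have B: "{\<omega> \<in> space Q. pts \<omega> \<inter> B = {}} \<in> sets Q"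
        "measure Q {\<omega> \<in> space Q. pts \<omega> \<inter> B = {}} = exp_uminus (emeasure \<mu> B)"
      using pts by (auto simp: poisson_avoidance_def)
    show "{\<omega> \<in> space (embed_measure Q e). pts (inv e \<omega>) \<inter> B = {}} \<in> sets (embed_measure Q e)"
      unfolding ev[of "\<lambda>\<omega>. pts \<omega> \<inter> B = {}"] using B(1) by (rule in_sets_embed_measure)
    show "measure (embed_measure Q e) {\<omega> \<in> space (embed_measure Q e). pts (inv e \<omega>) \<inter> B = {}} =
        exp_uminus (emeasure \<mu> B)"
      unfolding ev[of "\<lambda>\<omega>. pts \<omega> \<inter> B = {}"] using B m by simp
  qed
qed

section \<open>Sup-measures built from point sets\<close>

text \<open>The contribution \<open>f s / \<gamma>\<close> of a point \<open>(\<gamma>, s)\<close>; points with \<open>\<gamma> \<le> 0\<close> are discarded, so that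
  the intensity can be Lebesgue measure on the whole line.\<close>

definition spectral_weight :: "('s \<Rightarrow> real) \<Rightarrow> real \<times> 's \<Rightarrow> ennreal" where
  "spectral_weight f z = (if fst z > 0 then ennreal (f (snd z) / fst z) else 0)"

definition point_sup_measure :: "('q \<Rightarrow> (real \<times> 's) set) \<Rightarrow> 's set \<Rightarrow> 'q \<Rightarrow> ennreal" where
  "point_sup_measure pts A \<omega> = (SUP z\<in>pts \<omega>. spectral_weight (indicator A) z)"

lemma measurable_spectral_weight[measurable]:
  assumes [measurable]: "f \<in> borel_measurable S"
  shows "spectral_weight f \<in> borel_measurable (lborel \<Otimes>\<^sub>M S)"
  unfolding spectral_weight_def by measurable

lemma avoidance_SUP_le:
  fixes F :: "'a \<Rightarrow> ennreal"
  assumes pts: "poisson_avoidance Q \<mu> pts" and [measurable]: "F \<in> borel_measurable \<mu>"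
  shows "{\<omega> \<in> space Q. (SUP z\<in>pts \<omega>. F z) \<le> c} \<in> sets Q"
    and "measure Q {\<omega> \<in> space Q. (SUP z\<in>pts \<omega>. F z) \<le> c} = exp_uminus (emeasure \<mu> {z \<in> space \<mu>. c < F z})"
proof -
  let ?L = "{\<omega> \<in> space Q. (SUP z\<in>pts \<omega>. F z) \<le> c}" and ?B = "{z \<in> space \<mu>. c < F z}"
  have "(SUP z\<in>pts \<omega>. F z) \<le> c \<longleftrightarrow> pts \<omega> \<inter> ?B = {}" if "\<omega> \<in> space Q" for \<omega>
  proof -
    have "pts \<omega> \<subseteq> space \<mu>" using pts that by (simp add: poisson_avoidance_def)
    then show ?thesis unfolding SUP_le_iff not_le[symmetric] by blast
  qed
  then have "?L = {\<omega> \<in> space Q. pts \<omega> \<inter> ?B = {}}"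
    by blast
  moreover have "?B \<in> sets \<mu>" by measurable
  ultimately show "?L \<in> sets Q"
    and "measure Q ?L = exp_uminus (emeasure \<mu> ?B)"
    using pts by (auto simp: poisson_avoidance_def)
qed

lemma measurable_avoidance_SUP:
  fixes F :: "'a \<Rightarrow> ennreal"
  assumes "poisson_avoidance Q \<mu> pts" "F \<in> borel_measurable \<mu>"
  shows "(\<lambda>\<omega>. SUP z\<in>pts \<omega>. F z) \<in> borel_measurable Q"
  by (rule borel_measurableI_le) (rule avoidance_SUP_le(1)[OF assms])

text \<open>The section over \<open>s\<close> is the interval of all \<open>\<gamma>\<close> between \<open>0\<close> and \<open>f s / x\<close>.\<close>

lemma emeasure_spectral_weight_greater:
  assumes S: "sigma_finite_measure S" and [measurable]: "f \<in> borel_measurable S"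
    and f: "\<And>s. s \<in> space S \<Longrightarrow> f s \<ge> 0" and x: "x > 0"
  shows "emeasure (lborel \<Otimes>\<^sub>M S) {z \<in> space (lborel \<Otimes>\<^sub>M S). ennreal x < spectral_weight f z} =
    ennreal (1 / x) * (\<integral>\<^sup>+s. ennreal (f s) \<partial>S)"
proof -
  interpret S: sigma_finite_measure S by fact
  interpret pair_sigma_finite lborel S ..
  let ?X = "{z \<in> space (lborel \<Otimes>\<^sub>M S). ennreal x < spectral_weight f z}"
  have "?X \<in> sets (lborel \<Otimes>\<^sub>M S)" by measurable
  then have "emeasure (lborel \<Otimes>\<^sub>M S) ?X = (\<integral>\<^sup>+s. emeasure lborel ((\<lambda>\<gamma>. (\<gamma>, s)) -` ?X) \<partial>S)"
    by (rule emeasure_pair_measure_alt2)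
  also have "\<dots> = (\<integral>\<^sup>+s. ennreal (1 / x) * ennreal (f s) \<partial>S)"
  proof (rule nn_integral_cong)
    fix s assume s: "s \<in> space S"
    have "(\<lambda>\<gamma>. (\<gamma>, s)) -` ?X = {0<..<f s / x}"
      using s f[OF s] x by (auto simp: space_pair_measure spectral_weight_def ennreal_less_iff field_simps split: if_splits)
    then show "emeasure lborel ((\<lambda>\<gamma>. (\<gamma>, s)) -` ?X) = ennreal (1 / x) * ennreal (f s)"
      using f[OF s] x by (simp add: ennreal_mult[symmetric])
  qed
  also have "\<dots> = ennreal (1 / x) * (\<integral>\<^sup>+s. ennreal (f s) \<partial>S)"
    by (rule nn_integral_cmult) measurable
  finally show ?thesis .
qed

lemma prob_SUP_spectral_weight:
  assumes pts: "poisson_avoidance Q (lborel \<Otimes>\<^sub>M S) pts" and S: "sigma_finite_measure S"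
    and f: "f \<in> borel_measurable S" "\<And>s. s \<in> space S \<Longrightarrow> f s \<ge> 0" and x: "x > 0"
  shows "measure Q {\<omega> \<in> space Q. (SUP z\<in>pts \<omega>. spectral_weight f z) \<le> ennreal x} =
    exp_uminus (ennreal (1 / x) * (\<integral>\<^sup>+s. ennreal (f s) \<partial>S))"
  using avoidance_SUP_le(2)[OF pts measurable_spectral_weight[OF f(1)]] emeasure_spectral_weight_greater[OF S f x]
  by simp

text \<open>Factorization of joint distribution functions suffices, as the closed half-lines are an intersection-stable
  generator of the Borel sets.\<close>

lemma (in prob_space) indep_vars_ennrealI:
  fixes X :: "'i \<Rightarrow> 'a \<Rightarrow> ennreal"
  assumes X: "\<And>i. i \<in> I \<Longrightarrow> X i \<in> borel_measurable M"
    and cdf: "\<And>J c. J \<noteq> {} \<Longrightarrow> J \<subseteq> I \<Longrightarrow> finite J \<Longrightarrow>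
      prob {\<omega> \<in> space M. \<forall>j\<in>J. X j \<omega> \<le> c j} = (\<Prod>j\<in>J. prob {\<omega> \<in> space M. X j \<omega> \<le> c j})"
  shows "indep_vars (\<lambda>_. borel) X I"
proof -
  let ?G = "\<lambda>i. {X i -` A \<inter> space M | A. A \<in> range atMost}"
  have gen: "sets (borel :: ennreal measure) = sigma_sets UNIV (range atMost)"
  proof -
    have "(borel :: ennreal measure) = sigma UNIV (range atMost)"
      unfolding borel_Ioi
    proof (intro sigma_eqI sigma_sets_eqI)
      fix A :: "ennreal set" assume "A \<in> range greaterThan"
      then obtain x where "A = UNIV - {..x}" by (auto simp: Compl_atMost[symmetric] Compl_eq_Diff_UNIV)
      then show "A \<in> sigma_sets UNIV (range atMost)"
        by (simp only:) (rule sigma_sets.Compl, simp add: sigma_sets.Basic)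
    next
      fix A :: "ennreal set" assume "A \<in> range atMost"
      then obtain x where "A = UNIV - {x<..}" by (auto simp: Compl_greaterThan[symmetric] Compl_eq_Diff_UNIV)
      then show "A \<in> sigma_sets UNIV (range greaterThan)"
        by (simp only:) (rule sigma_sets.Compl, simp add: sigma_sets.Basic)
    qed auto
    then have "sets (borel :: ennreal measure) = sets (sigma UNIV (range atMost))" by (rule arg_cong)
    also have "\<dots> = sigma_sets UNIV (range atMost)" by (rule sets_measure_of) simp
    finally show ?thesis .
  qed
  have "indep_sets ?G I"
  proof (rule indep_setsI)
    fix i assume "i \<in> I"
    then show "?G i \<subseteq> events" using X by (auto intro!: measurable_sets)
  next
    fix A J assume J: "J \<noteq> {}" "J \<subseteq> I" "finite J" and "\<forall>j\<in>J. A j \<in> ?G j"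
    then have *: "\<exists>B. A j = X j -` B \<inter> space M \<and> B \<in> range atMost" if "j \<in> J" for j
      using that by blast
    have "\<forall>j\<in>J. \<exists>c. A j = {\<omega> \<in> space M. X j \<omega> \<le> c}"
    proof
      fix j assume "j \<in> J"
      then obtain c where "A j = X j -` {..c} \<inter> space M" using * by blast
      then have "A j = {\<omega> \<in> space M. X j \<omega> \<le> c}" by auto
      then show "\<exists>c. A j = {\<omega> \<in> space M. X j \<omega> \<le> c}" ..
    qed
    from bchoice[OF this] obtain c where c: "\<forall>j\<in>J. A j = {\<omega> \<in> space M. X j \<omega> \<le> c j}" ..
    then have "(\<Inter>j\<in>J. A j) = {\<omega> \<in> space M. \<forall>j\<in>J. X j \<omega> \<le> c j}"
      using J(1) by auto
    with cdf[OF J, of c] c show "prob (\<Inter>j\<in>J. A j) = (\<Prod>j\<in>J. prob (A j))" by simp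
  qed
  moreover have "Int_stable (?G i)" for i
  proof (rule Int_stableI)
    fix a b assume "a \<in> ?G i" "b \<in> ?G i"
    then obtain x y where "a = X i -` {..x} \<inter> space M" "b = X i -` {..y} \<inter> space M" by auto
    then have "a \<inter> b = X i -` {..min x y} \<inter> space M" by auto
    then show "a \<inter> b \<in> ?G i" by blast
  qed
  ultimately have "indep_sets (\<lambda>i. sigma_sets (space M) (?G i)) I"
    by (rule indep_sets_sigma)
  moreover have "sigma_sets (space M) (?G i) = {X i -` A \<inter> space M | A. A \<in> sets borel}" for i
    unfolding gen by (rule sigma_sets_vimage_commute[symmetric]) auto
  ultimately show ?thesis
    using X by (simp add: indep_vars_def2)
qed

text \<open>The event that finitely many of the \<open>M (B j)\<close> stay below given levels is the event that the point set
  avoids a union of sets, which are disjoint when the \<open>B j\<close> are. Independence over disjoint sets is thus the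
  multiplicativity of the avoidance probabilities. Sup-additivity holds outcome by outcome.\<close>

lemma frechet_point_sup_measure:
  fixes S :: "'s measure"
  assumes pts: "poisson_avoidance Q (lborel \<Otimes>\<^sub>M S) pts" and S: "sigma_finite_measure S"
  shows "frechet_sup_measure Q S (point_sup_measure pts)"
proof -
  interpret Q: prob_space Q using pts by (simp add: poisson_avoidance_def)
  let ?M = "point_sup_measure pts"
  let ?\<mu> = "lborel \<Otimes>\<^sub>M S"
  have ind[measurable]: "spectral_weight (indicator A) \<in> borel_measurable ?\<mu>" if "A \<in> sets S" for A
    using that by (intro measurable_spectral_weight) simp
  have meas: "?M A \<in> borel_measurable Q" if "A \<in> sets S" for A
    unfolding point_sup_measure_def using that by (intro measurable_avoidance_SUP[OF pts]) simp
  show ?thesis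
  proof (unfold_locales)
    fix A assume A: "A \<in> sets S"
    show "?M A \<in> borel_measurable Q" using A by (rule meas)
    fix x :: real assume x: "x > 0"
    have "(\<integral>\<^sup>+s. ennreal (indicator A s) \<partial>S) = emeasure S A"
      using A by (simp add: ennreal_indicator)
    moreover have "emeasure S A < \<infinity> \<Longrightarrow> exp_uminus (ennreal (1 / x) * emeasure S A) = exp (- measure S A / x)"
      using x by (simp add: emeasure_eq_ennreal_measure less_top ennreal_mult[symmetric])
    moreover have "ennreal (1 / x) * \<infinity> = \<infinity>"
      using x by (simp add: ennreal_mult_top)
    ultimately show "measure Q {\<omega> \<in> space Q. ?M A \<omega> \<le> ennreal x} = (if emeasure S A = \<infinity> then 0 else exp (- measure S A / x))"
      using prob_SUP_spectral_weight[OF pts S, of "indicator A" x] A x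
      by (simp add: point_sup_measure_def less_top)
  next
    fix B :: "nat \<Rightarrow> 's set" assume B: "range B \<subseteq> sets S" "disjoint_family B"
    have "?M (\<Union>i. B i) \<omega> = (SUP i. ?M (B i) \<omega>)" for \<omega>
    proof -
      have sw: "spectral_weight (indicator (\<Union>i. B i)) z = (SUP i. spectral_weight (indicator (B i)) z)" (is "?l = ?r") for z :: "real \<times> 's"
      proof (rule antisym)
        show "?l \<le> ?r"
        proof (cases "snd z \<in> (\<Union>i. B i)")
          case True
          then obtain i where "snd z \<in> B i" by blast
          then have "?l = spectral_weight (indicator (B i)) z"
            using True by (simp add: spectral_weight_def)
          then show ?thesis by (auto intro!: SUP_upper)
        qed (simp add: spectral_weight_def)
        show "?r \<le> ?l"
          by (rule SUP_least) (auto simp: spectral_weight_def indicator_def)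
      qed
      show ?thesis
        unfolding point_sup_measure_def sw by (rule SUP_commute)
    qed
    then show "AE \<omega> in Q. ?M (\<Union>i. B i) \<omega> = (SUP i. ?M (B i) \<omega>)" by simp
    have B_sets: "B i \<in> sets S" for i using B by auto
    show "Q.indep_vars (\<lambda>_. borel) (\<lambda>i. ?M (B i)) UNIV"
    proof (rule Q.indep_vars_ennrealI)
      show "?M (B i) \<in> borel_measurable Q" for i using B by (intro meas) auto
      fix J :: "nat set" and c assume J: "finite J"
      define D where "D j = {z \<in> space ?\<mu>. c j < spectral_weight (indicator (B j)) z}" for j
      have D_sets: "D j \<in> sets ?\<mu>" for j
        unfolding D_def using ind[OF B_sets] by measurable
      have "disjoint_family_on D J"
      proof (unfold disjoint_family_on_def, safe)
        fix i j a b assume "i \<noteq> j" "(a, b) \<in> D i" "(a, b) \<in> D j"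
        moreover have "b \<in> B k" if "(a, b) \<in> D k" for k
          using that by (cases "b \<in> B k") (auto simp: D_def spectral_weight_def split: if_splits)
        ultimately have "b \<in> B i \<inter> B j" by blast
        with \<open>i \<noteq> j\<close> show "(a, b) \<in> {}" using B(2) unfolding disjoint_family_on_def by blast
      qed
      then have D_sum: "emeasure ?\<mu> (\<Union>j\<in>J. D j) = (\<Sum>j\<in>J. emeasure ?\<mu> (D j))"
        using D_sets J by (intro sum_emeasure[symmetric]) auto
      have "{\<omega> \<in> space Q. \<forall>j\<in>J. ?M (B j) \<omega> \<le> c j} = {\<omega> \<in> space Q. pts \<omega> \<inter> (\<Union>j\<in>J. D j) = {}}"
      proof -
        have "(\<forall>j\<in>J. ?M (B j) \<omega> \<le> c j) \<longleftrightarrow> pts \<omega> \<inter> (\<Union>j\<in>J. D j) = {}" if "\<omega> \<in> space Q" for \<omega>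
        proof -
          have "pts \<omega> \<subseteq> space ?\<mu>" using pts that by (simp add: poisson_avoidance_def)
          then show ?thesis
            unfolding point_sup_measure_def SUP_le_iff D_def not_le[symmetric] by blast
        qed
        then show ?thesis by blast
      qed
      then have "Q.prob {\<omega> \<in> space Q. \<forall>j\<in>J. ?M (B j) \<omega> \<le> c j} = exp_uminus (emeasure ?\<mu> (\<Union>j\<in>J. D j))"
        using pts D_sets J by (simp add: poisson_avoidance_def sets.finite_UN)
      also have "\<dots> = (\<Prod>j\<in>J. Q.prob {\<omega> \<in> space Q. ?M (B j) \<omega> \<le> c j})"
        unfolding D_sum exp_uminus_sum[OF J]
        by (simp add: D_def point_sup_measure_def avoidance_SUP_le(2)[OF pts ind[OF B_sets]])
      finally show "Q.prob {\<omega> \<in> space Q. \<forall>j\<in>J. ?M (B j) \<omega> \<le> c j} = (\<Prod>j\<in>J. Q.prob {\<omega> \<in> space Q. ?M (B j) \<omega> \<le> c j})" .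
    qed
  qed
qed

text \<open>For this sup-measure the extremal integral of a simple function is a supremum over the points, outcome by
  outcome; the same formula therefore yields the integral of a general \<open>f\<close>.\<close>

lemma simple_extremal_integral_point_sup_measure:
  assumes pts: "pts \<omega> \<subseteq> space (lborel \<Otimes>\<^sub>M S)" and h: "\<And>s. s \<in> space S \<Longrightarrow> h s \<ge> 0"
  shows "simple_extremal_integral S (point_sup_measure pts) h \<omega> = enn2real (SUP z\<in>pts \<omega>. spectral_weight h z)"
proof -
  let ?M = "\<lambda>a. point_sup_measure pts (h -` {a} \<inter> space S) \<omega>"
    and ?w = "\<lambda>a. spectral_weight (indicator (h -` {a} \<inter> space S))"
  have "(SUP a \<in> h ` space S. ennreal a * ?M a) =
      (SUP z\<in>pts \<omega>. spectral_weight h z)" (is "?l = ?r")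
  proof (rule antisym)
    show "?l \<le> ?r"
    proof (rule SUP_least)
      fix a assume a: "a \<in> h ` space S"
      have "ennreal a * ?M a =
          (SUP z\<in>pts \<omega>. ennreal a * ?w a z)"
        by (cases "pts \<omega> = {}") (auto simp: point_sup_measure_def SUP_mult_left_ennreal bot_ennreal)
      also have "\<dots> \<le> ?r"
      proof (intro SUP_mono bexI)
        fix z assume "z \<in> pts \<omega>"
        show "ennreal a * ?w a z \<le> spectral_weight h z"
          using a h by (auto simp: spectral_weight_def indicator_def ennreal_mult'[symmetric])
      qed
      finally show "ennreal a * ?M a \<le> ?r" .
    qed
    show "?r \<le> ?l"
    proof (rule SUP_least)
      fix z assume z: "z \<in> pts \<omega>"
      with pts have s: "snd z \<in> space S" by (auto simp: space_pair_measure)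
      let ?a = "h (snd z)"
      have "spectral_weight h z = ennreal ?a * ?w ?a z"
        using s h[OF s] by (auto simp: spectral_weight_def ennreal_mult'[symmetric])
      also have "\<dots> \<le> ennreal ?a * ?M ?a"
        unfolding point_sup_measure_def using z by (intro mult_left_mono SUP_upper) auto
      also have "\<dots> \<le> ?l"
        using s by (intro SUP_upper) auto
      finally show "spectral_weight h z \<le> ?l" .
    qed
  qed
  then show ?thesis by (simp add: simple_extremal_integral_def)
qed

lemma integrable_simple_approximation:
  assumes f: "integrable S f" and nonneg: "\<And>s. s \<in> space S \<Longrightarrow> f s \<ge> (0::real)"
  obtains h where "\<And>n. simple_function S (h n)" "\<And>n. integrable S (h n)" "\<And>n s. s \<in> space S \<Longrightarrow> h n s \<ge> (0::real)"
    "(\<lambda>n. \<integral>s. \<bar>h n s - f s\<bar> \<partial>S) \<longlonglongrightarrow> 0"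
proof -
  have [measurable]: "f \<in> borel_measurable S" using f by simp
  obtain u where u: "\<And>i. simple_function S (u i)" "incseq u" "\<And>i x. u i x < top"
    "\<And>x. (SUP i. u i x) = ennreal (f x)"
    using borel_measurable_implies_simple_function_sequence'[of "\<lambda>s. ennreal (f s)" S] by auto
  define h where "h n s = enn2real (u n s)" for n s
  have u_le: "u n s \<le> ennreal (f s)" for n s
    unfolding u(4)[symmetric] by (rule SUP_upper) simp
  have h_le: "h n s \<le> f s" if "s \<in> space S" for n s
    using enn2real_mono[OF u_le[of n s]] nonneg[OF that] by (simp add: h_def)
  have simple: "simple_function S (h n)" for n
    unfolding h_def by (rule simple_function_compose1[OF u(1)])
  have [measurable]: "h n \<in> borel_measurable S" for n
    using simple by (rule borel_measurable_simple_function)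
  have "integrable S (h n)" for n
    by (rule Bochner_Integration.integrable_bound[OF f]) (use h_le nonneg in \<open>auto simp: h_def\<close>)
  moreover have "(\<lambda>n. \<integral>s. \<bar>h n s - f s\<bar> \<partial>S) \<longlonglongrightarrow> (\<integral>s. 0 \<partial>S)"
  proof (rule integral_dominated_convergence[where w = f])
    show "AE s in S. (\<lambda>n. \<bar>h n s - f s\<bar>) \<longlonglongrightarrow> 0"
    proof (rule AE_I2)
      fix s assume s: "s \<in> space S"
      have "(\<lambda>n. u n s) \<longlonglongrightarrow> ennreal (f s)"
        unfolding u(4)[symmetric] using u(2) by (intro LIMSEQ_SUP) (auto simp: incseq_def le_fun_def)
      then have "(\<lambda>n. h n s) \<longlonglongrightarrow> f s"
        unfolding h_def using nonneg[OF s] by (rule tendsto_enn2real)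
      then have "(\<lambda>n. \<bar>h n s - f s\<bar>) \<longlonglongrightarrow> \<bar>f s - f s\<bar>"
        by (intro tendsto_intros)
      then show "(\<lambda>n. \<bar>h n s - f s\<bar>) \<longlonglongrightarrow> 0" by simp
    qed
    show "AE s in S. norm \<bar>h n s - f s\<bar> \<le> f s" for n
      using h_le nonneg by (intro AE_I2) (auto simp: h_def)
  qed (use f in simp_all)
  ultimately show thesis
    using simple by (intro that[of h]) (auto simp: h_def)
qed

text \<open>The suprema for \<open>f\<close> and for an approximation \<open>h\<close> differ by at most the supremum for \<open>\<bar>h - f\<bar>\<close>, whose
  distribution function \<open>exp (- \<parallel>h - f\<parallel> / \<epsilon>)\<close> is explicit.\<close>

lemma has_extremal_integral_point_sup_measure:
  fixes S :: "'s measure"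
  assumes pts: "poisson_avoidance Q (lborel \<Otimes>\<^sub>M S) pts" and S: "sigma_finite_measure S"
    and f: "integrable S f" and nonneg: "\<And>s. s \<in> space S \<Longrightarrow> f s \<ge> 0"
  shows "has_extremal_integral Q S (point_sup_measure pts) f (\<lambda>\<omega>. enn2real (SUP z\<in>pts \<omega>. spectral_weight f z))"
proof -
  interpret Q: prob_space Q using pts by (simp add: poisson_avoidance_def)
  define V where "V f \<omega> = (SUP z\<in>pts \<omega>. spectral_weight f z)" for f :: "'s \<Rightarrow> real" and \<omega>
  have V_meas[measurable]: "V g \<in> borel_measurable Q" if "g \<in> borel_measurable S" for g
    unfolding V_def using that by (intro measurable_avoidance_SUP[OF pts] measurable_spectral_weight)
  have V_prob: "Q.prob {\<omega> \<in> space Q. V g \<omega> \<le> ennreal x} = exp (- (integral\<^sup>L S g / x))"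
    if g: "integrable S g" "\<And>s. s \<in> space S \<Longrightarrow> g s \<ge> 0" and x: "x > 0" for g x
  proof -
    have "(\<integral>\<^sup>+s. ennreal (g s) \<partial>S) = ennreal (integral\<^sup>L S g)"
      using g by (intro nn_integral_eq_integral) auto
    moreover have "integral\<^sup>L S g \<ge> 0" using g by (intro integral_nonneg_AE) auto
    ultimately show ?thesis
      unfolding V_def using prob_SUP_spectral_weight[OF pts S borel_measurable_integrable[OF g(1)] g(2) x] x
      by (simp add: ennreal_mult[symmetric])
  qed
  obtain h where h: "\<And>n. simple_function S (h n)" "\<And>n. integrable S (h n)" "\<And>n s. s \<in> space S \<Longrightarrow> h n s \<ge> 0"
    and L1: "(\<lambda>n. \<integral>s. \<bar>h n s - f s\<bar> \<partial>S) \<longlonglongrightarrow> 0"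
    using integrable_simple_approximation[OF f nonneg] by blast
  let ?I = "\<lambda>n. simple_extremal_integral S (point_sup_measure pts) (h n)"
    and ?d = "\<lambda>n. \<integral>s. \<bar>h n s - f s\<bar> \<partial>S" and ?D = "\<lambda>n. V (\<lambda>s. \<bar>h n s - f s\<bar>)"
  have [measurable]: "f \<in> borel_measurable S" "h n \<in> borel_measurable S" for n
    using f h(2) by auto
  have V_fin: "AE \<omega> in Q. V f \<omega> < \<infinity>"
    by (rule Q.AE_finite_of_frechet_cdf) (use V_prob[OF f nonneg] in auto)
  have V_le: "V f \<omega> \<le> V g \<omega> + ?D n \<omega>" "V g \<omega> \<le> V f \<omega> + ?D n \<omega>"
    if "\<omega> \<in> space Q" and g: "g = h n" for \<omega> n g
  proof -
    have sp: "snd z \<in> space S" if "z \<in> pts \<omega>" for z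
    proof -
      have "pts \<omega> \<subseteq> space (lborel \<Otimes>\<^sub>M S)"
        using pts \<open>\<omega> \<in> space Q\<close> by (simp add: poisson_avoidance_def)
      with that show ?thesis by (auto simp: space_pair_measure)
    qed
    have *: "spectral_weight a z \<le> spectral_weight b z + spectral_weight (\<lambda>s. \<bar>h n s - f s\<bar>) z"
      if "z \<in> pts \<omega>" "b (snd z) \<ge> 0" "a (snd z) \<le> b (snd z) + \<bar>h n (snd z) - f (snd z)\<bar>" for a b z
      using that by (auto simp: spectral_weight_def ennreal_plus[symmetric] add_divide_distrib[symmetric]
          divide_right_mono intro!: ennreal_leI simp del: ennreal_plus)
    have **: "V a \<omega> \<le> V b \<omega> + ?D n \<omega>"
      if "\<And>s. s \<in> space S \<Longrightarrow> b s \<ge> 0" "\<And>s. a s \<le> b s + \<bar>h n s - f s\<bar>" for a b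
      unfolding V_def
    proof (rule SUP_least)
      fix z assume z: "z \<in> pts \<omega>"
      have "spectral_weight a z \<le> spectral_weight b z + spectral_weight (\<lambda>s. \<bar>h n s - f s\<bar>) z"
        using z that sp by (intro *) auto
      also have "\<dots> \<le> (SUP z\<in>pts \<omega>. spectral_weight b z) + (SUP z\<in>pts \<omega>. spectral_weight (\<lambda>s. \<bar>h n s - f s\<bar>) z)"
        using z by (intro add_mono SUP_upper)
      finally show "spectral_weight a z \<le> (SUP z\<in>pts \<omega>. spectral_weight b z) + (SUP z\<in>pts \<omega>. spectral_weight (\<lambda>s. \<bar>h n s - f s\<bar>) z)" .
    qed
    show "V f \<omega> \<le> V g \<omega> + ?D n \<omega>"
      unfolding g using h(3) by (intro **) auto
    show "V g \<omega> \<le> V f \<omega> + ?D n \<omega>"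
      unfolding g using nonneg by (intro **) auto
  qed
  have I_V: "?I n \<omega> = enn2real (V (h n) \<omega>)"
    if "\<omega> \<in> space Q" for n \<omega>
    unfolding V_def using pts that h(3)
    by (intro simple_extremal_integral_point_sup_measure) (auto simp: poisson_avoidance_def)
  have "tendsto_in_prob Q (\<lambda>n. ?I n) (\<lambda>\<omega>. enn2real (V f \<omega>))"
    unfolding tendsto_in_prob_def
  proof (intro allI impI)
    fix \<epsilon> :: real assume \<epsilon>: "\<epsilon> > 0"
    let ?far = "\<lambda>n. {\<omega> \<in> space Q. \<bar>?I n \<omega> - enn2real (V f \<omega>)\<bar> > \<epsilon>}"
      and ?large = "\<lambda>n. {\<omega> \<in> space Q. \<not> ?D n \<omega> \<le> ennreal \<epsilon>}"
    have diff: "\<bar>enn2real a - enn2real b\<bar> \<le> \<epsilon>" if "a \<le> b + d" "b \<le> a + d" "b < \<infinity>" "d \<le> ennreal \<epsilon>" for a b d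
    proof -
      have "d < \<infinity>" using that(4) by (rule le_less_trans) simp
      with that have "a < \<infinity>" by (metis ennreal_add_less_top infinity_ennreal_def le_less_trans)
      obtain x where x: "a = ennreal x" "x \<ge> 0" using \<open>a < \<infinity>\<close> by (cases a) auto
      obtain y where y: "b = ennreal y" "y \<ge> 0" using \<open>b < \<infinity>\<close> by (cases b) auto
      obtain e where e: "d = ennreal e" "e \<ge> 0" using \<open>d < \<infinity>\<close> by (cases d) auto
      have "x \<le> y + e" "y \<le> x + e" "e \<le> \<epsilon>"
        using that(1,2,4) x y e \<epsilon> by (simp_all flip: ennreal_plus)
      then show ?thesis using x y by (simp add: abs_le_iff)
    qed
    have "Q.prob (?far n)
        \<le> 1 - exp (- (?d n / \<epsilon>))" for n
    proof -
      have "Q.prob (?far n)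
          \<le> Q.prob (?large n)"
      proof (rule Q.finite_measure_mono_AE)
        show "AE \<omega> in Q. \<omega> \<in> ?far n \<longrightarrow>
            \<omega> \<in> ?large n"
          using V_fin
        proof eventually_elim
          case (elim \<omega>)
          show ?case
            using diff[OF V_le(2,1)[OF _ refl, of \<omega> n] elim] I_V[of \<omega> n] by force
        qed
      qed measurable
      also have "\<dots> = 1 - Q.prob {\<omega> \<in> space Q. ?D n \<omega> \<le> ennreal \<epsilon>}"
        by (rule Q.prob_neg) measurable
      also have "\<dots> = 1 - exp (- (?d n / \<epsilon>))"
        using f h(2) \<epsilon> by (subst V_prob) auto
      finally show ?thesis .
    qed
    note le = this
    have "(\<lambda>n. 1 - exp (- (?d n / \<epsilon>))) \<longlonglongrightarrow> 1 - exp (- (0 / \<epsilon>))"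
      using \<epsilon> by (intro tendsto_intros L1) auto
    then have lim: "(\<lambda>n. 1 - exp (- (?d n / \<epsilon>))) \<longlonglongrightarrow> 0" by simp
    show "(\<lambda>n. Q.prob {\<omega> \<in> space Q. \<epsilon> < \<bar>?I n \<omega> - enn2real (V f \<omega>)\<bar>}) \<longlonglongrightarrow> 0"
      by (rule tendsto_sandwich[OF _ _ tendsto_const lim]) (use le in auto)
  qed
  then show ?thesis
    unfolding has_extremal_integral_def V_def[symmetric]
    using f nonneg h L1 by (auto intro!: exI[of _ h])
qed

section \<open>Gaussian processes with stationary increments\<close>

text \<open>In the normal case the integral of \<open>exp\<close> is found by completing the square in the density.\<close>

lemma (in prob_space) centered_gaussian_rv_square_integrable:
  assumes Z: "gaussian_rv M Z" and mean: "expectation Z = 0"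
  shows "integrable M (\<lambda>\<omega>. (Z \<omega>)\<^sup>2)"
    and "(\<integral>\<^sup>+\<omega>. ennreal (exp (Z \<omega>)) \<partial>M) = ennreal (exp (expectation (\<lambda>\<omega>. (Z \<omega>)\<^sup>2) / 2))"
proof -
  have [measurable]: "Z \<in> borel_measurable M" using Z by (simp add: gaussian_rv_def)
  have "integrable M (\<lambda>\<omega>. (Z \<omega>)\<^sup>2) \<and>
    (\<integral>\<^sup>+\<omega>. ennreal (exp (Z \<omega>)) \<partial>M) = ennreal (exp (expectation (\<lambda>\<omega>. (Z \<omega>)\<^sup>2) / 2))"
  proof (cases "\<exists>m. AE \<omega> in M. Z \<omega> = m")
    case True
    then obtain m where m: "AE \<omega> in M. Z \<omega> = m" ..
    then have "expectation Z = expectation (\<lambda>_. m)" by (intro integral_cong_AE) auto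
    with mean have "m = 0" by (simp add: prob_space)
    with m have Z0: "AE \<omega> in M. Z \<omega> = 0" by simp
    then have "integrable M (\<lambda>\<omega>. (Z \<omega>)\<^sup>2) \<longleftrightarrow> integrable M (\<lambda>\<omega>. 0 :: real)"
      by (intro integrable_cong_AE) auto
    moreover have "expectation (\<lambda>\<omega>. (Z \<omega>)\<^sup>2) = expectation (\<lambda>\<omega>. 0)"
      using Z0 by (intro integral_cong_AE) auto
    moreover have "(\<integral>\<^sup>+\<omega>. ennreal (exp (Z \<omega>)) \<partial>M) = (\<integral>\<^sup>+\<omega>. 1 \<partial>M)"
      using Z0 by (intro nn_integral_cong_AE) auto
    ultimately show ?thesis by (simp add: emeasure_space_1)
  next
    case False
    with Z obtain m s where s: "s > 0" and D': "distributed M lborel Z (\<lambda>x. ennreal (normal_density m s x))"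
      by (auto simp: gaussian_rv_def)
    have "m = 0" using normal_distributed_expectation[OF s D'] mean by simp
    with D' have D: "distributed M lborel Z (\<lambda>x. ennreal (normal_density 0 s x))" by simp
    have var: "expectation (\<lambda>\<omega>. (Z \<omega>)\<^sup>2) = s\<^sup>2"
      using normal_distributed_variance[OF s D] mean by simp
    then have int: "integrable M (\<lambda>\<omega>. (Z \<omega>)\<^sup>2)"
      using s not_integrable_integral_eq by fastforce
    have "(\<integral>\<^sup>+\<omega>. ennreal (exp (Z \<omega>)) \<partial>M) = (\<integral>\<^sup>+x. ennreal (normal_density 0 s x) * ennreal (exp x) \<partial>lborel)"
      using distributed_nn_integral[OF D, of "\<lambda>x. ennreal (exp x)"] by simp
    also have "\<dots> = (\<integral>\<^sup>+x. ennreal (exp (s\<^sup>2 / 2)) * ennreal (normal_density (s\<^sup>2) s x) \<partial>lborel)"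
    proof (rule nn_integral_cong)
      fix x
      have "- (x - 0)\<^sup>2 / (2 * s\<^sup>2) + x = s\<^sup>2 / 2 + - (x - s\<^sup>2)\<^sup>2 / (2 * s\<^sup>2)"
        using s by (simp add: field_simps power2_eq_square)
      then have "normal_density 0 s x * exp x = exp (s\<^sup>2 / 2) * normal_density (s\<^sup>2) s x"
        unfolding normal_density_def by (simp add: exp_add[symmetric])
      then show "ennreal (normal_density 0 s x) * ennreal (exp x) = ennreal (exp (s\<^sup>2 / 2)) * ennreal (normal_density (s\<^sup>2) s x)"
        by (simp add: ennreal_mult[symmetric])
    qed
    also have "\<dots> = ennreal (exp (s\<^sup>2 / 2)) * emeasure (density lborel (normal_density (s\<^sup>2) s)) UNIV"
      by (simp add: nn_integral_cmult emeasure_density)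
    also have "emeasure (density lborel (normal_density (s\<^sup>2) s)) UNIV = 1"
      using prob_space.emeasure_space_1[OF prob_space_normal_density[OF s, of "s\<^sup>2"]] by simp
    finally show ?thesis using int by (simp add: var)
  qed
  then show "integrable M (\<lambda>\<omega>. (Z \<omega>)\<^sup>2)"
    "(\<integral>\<^sup>+\<omega>. ennreal (exp (Z \<omega>)) \<partial>M) = ennreal (exp (expectation (\<lambda>\<omega>. (Z \<omega>)\<^sup>2) / 2))" by auto
qed

text \<open>The times \<open>\<tau> i\<close> may repeat; grouping equal ones turns the sum into a combination of the form used in the
  definition of a Gaussian process.\<close>

lemma gaussian_process_exp_moment:
  fixes W :: "real \<Rightarrow> 'e \<Rightarrow> real" and c \<tau> :: "'i \<Rightarrow> real"
  assumes W: "zero_mean_gaussian_process E W" and I: "finite I"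
  shows "(\<integral>\<^sup>+\<omega>. ennreal (exp (\<Sum>i\<in>I. c i * W (\<tau> i) \<omega>)) \<partial>E) =
    ennreal (exp ((\<Sum>i\<in>I. \<Sum>j\<in>I. c i * c j * (\<integral>\<omega>. W (\<tau> i) \<omega> * W (\<tau> j) \<omega> \<partial>E)) / 2))"
proof -
  interpret prob_space E using W by (simp add: zero_mean_gaussian_process_def gaussian_process_def real_process_def)
  have [measurable]: "W t \<in> borel_measurable E" for t
    using W by (simp add: zero_mean_gaussian_process_def gaussian_process_def real_process_def)
  have gauss: "gaussian_rv E (\<lambda>\<omega>. \<Sum>t\<in>J. a t * W t \<omega>)" if "finite J" for J a
    using W that by (simp add: zero_mean_gaussian_process_def gaussian_process_def)
  have mean: "expectation (W t) = 0" for t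
    using W by (simp add: zero_mean_gaussian_process_def)
  have sq: "integrable E (\<lambda>\<omega>. (W t \<omega>)\<^sup>2)" for t
    using centered_gaussian_rv_square_integrable(1)[of "W t"] gauss[of "{t}" "\<lambda>_. 1"] mean by simp
  have int: "integrable E (W t)" for t
    by (rule square_integrable_imp_integrable[OF _ sq]) simp
  have prod: "integrable E (\<lambda>\<omega>. W s \<omega> * W t \<omega>)" for s t
  proof (rule Bochner_Integration.integrable_bound)
    show "integrable E (\<lambda>\<omega>. (W s \<omega>)\<^sup>2 + (W t \<omega>)\<^sup>2)" by (intro Bochner_Integration.integrable_add sq)
    show "AE \<omega> in E. norm (W s \<omega> * W t \<omega>) \<le> norm ((W s \<omega>)\<^sup>2 + (W t \<omega>)\<^sup>2)"
    proof (rule AE_I2)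
      fix \<omega>
      have "0 \<le> (\<bar>W s \<omega>\<bar> - \<bar>W t \<omega>\<bar>)\<^sup>2" by simp
      then have "2 * (\<bar>W s \<omega>\<bar> * \<bar>W t \<omega>\<bar>) \<le> (W s \<omega>)\<^sup>2 + (W t \<omega>)\<^sup>2"
        by (simp add: power2_diff)
      moreover have "0 \<le> \<bar>W s \<omega>\<bar> * \<bar>W t \<omega>\<bar>" by simp
      ultimately have "\<bar>W s \<omega>\<bar> * \<bar>W t \<omega>\<bar> \<le> (W s \<omega>)\<^sup>2 + (W t \<omega>)\<^sup>2" by linarith
      then show "norm (W s \<omega> * W t \<omega>) \<le> norm ((W s \<omega>)\<^sup>2 + (W t \<omega>)\<^sup>2)"
        by (simp add: abs_mult)
    qed
  qed simp
  let ?Z = "\<lambda>\<omega>. \<Sum>i\<in>I. c i * W (\<tau> i) \<omega>"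
  let ?G = "\<lambda>\<omega>. \<Sum>t\<in>\<tau> ` I. (\<Sum>i\<in>{i \<in> I. \<tau> i = t}. c i) * W t \<omega>"
    and ?p = "\<lambda>i j \<omega>. c i * c j * (W (\<tau> i) \<omega> * W (\<tau> j) \<omega>)"
  have Z: "?Z = (\<lambda>\<omega>. \<Sum>t\<in>\<tau> ` I. (\<Sum>i\<in>{i \<in> I. \<tau> i = t}. c i) * W t \<omega>)"
  proof
    fix \<omega>
    have "?Z \<omega> = (\<Sum>t\<in>\<tau> ` I. \<Sum>i\<in>{i \<in> I. \<tau> i = t}. c i * W (\<tau> i) \<omega>)"
      using I by (rule sum.image_gen)
    also have "\<dots> = ?G \<omega>"
      by (intro sum.cong refl) (simp add: sum_distrib_right)
    finally show "?Z \<omega> = ?G \<omega>" .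
  qed
  have "gaussian_rv E ?Z"
    unfolding Z using I by (intro gauss) simp
  moreover have "expectation ?Z = 0"
    by (subst Bochner_Integration.integral_sum) (intro integrable_mult_right int, simp add: mean)
  ultimately have "(\<integral>\<^sup>+\<omega>. ennreal (exp (?Z \<omega>)) \<partial>E) = ennreal (exp (expectation (\<lambda>\<omega>. (?Z \<omega>)\<^sup>2) / 2))"
    by (rule centered_gaussian_rv_square_integrable(2))
  also have "expectation (\<lambda>\<omega>. (?Z \<omega>)\<^sup>2) = expectation (\<lambda>\<omega>. \<Sum>i\<in>I. \<Sum>j\<in>I. ?p i j \<omega>)"
    unfolding power2_eq_square sum_product
    by (intro Bochner_Integration.integral_cong sum.cong refl) (simp only: mult_ac)
  also have "\<dots> = (\<Sum>i\<in>I. expectation (\<lambda>\<omega>. \<Sum>j\<in>I. ?p i j \<omega>))"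
    by (rule Bochner_Integration.integral_sum) (intro Bochner_Integration.integrable_sum integrable_mult_right prod)
  also have "\<dots> = (\<Sum>i\<in>I. \<Sum>j\<in>I. expectation (\<lambda>\<omega>. ?p i j \<omega>))"
    by (intro sum.cong refl Bochner_Integration.integral_sum integrable_mult_right prod)
  also have "\<dots> = (\<Sum>i\<in>I. \<Sum>j\<in>I. c i * c j * (\<integral>\<omega>. W (\<tau> i) \<omega> * W (\<tau> j) \<omega> \<partial>E))"
    by simp
  finally show ?thesis .
qed

text \<open>The covariance is expressed by the variance function \<open>v\<close>; this is the form it takes when the increments
  are stationary and \<open>W\<close> starts at \<open>0\<close>. Fractional Brownian motion is one instance.\<close>

locale stationary_increments_gaussian =
  fixes E :: "'e measure" and W :: "real \<Rightarrow> 'e \<Rightarrow> real" and v :: "real \<Rightarrow> real"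
  assumes gaussian: "zero_mean_gaussian_process E W"
    and covariance: "(\<integral>\<omega>. W t \<omega> * W s \<omega> \<partial>E) = (v t + v s - v (t - s)) / 2"
    and v_0: "v 0 = 0"

sublocale stationary_increments_gaussian \<subseteq> prob_space E
  using gaussian by (simp add: zero_mean_gaussian_process_def gaussian_process_def real_process_def)

context stationary_increments_gaussian begin

lemma measurable_W[measurable]: "W t \<in> borel_measurable E"
  using gaussian by (simp add: zero_mean_gaussian_process_def gaussian_process_def real_process_def)

lemma v_minus: "v (- t) = v t"
  using covariance[of t 0] covariance[of 0 t] v_0 by (simp add: mult.commute)

text \<open>The logarithm of the spectral function of the Brown--Resnick process.\<close>

definition drifted :: "real \<Rightarrow> 'e \<Rightarrow> real" where
  "drifted t \<omega> = W t \<omega> - v t / 2"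

lemma measurable_drifted[measurable]: "drifted t \<in> borel_measurable E"
  unfolding drifted_def by measurable

lemma brown_resnick_spectral_function_eq:
  "brown_resnick_spectral_function E W t \<omega> = exp (drifted t \<omega>)"
proof -
  have "expectation (W t) = 0" using gaussian by (simp add: zero_mean_gaussian_process_def)
  then have "variance (W t) = v t"
    using covariance[of t t] v_0 by (simp add: power2_eq_square)
  then show ?thesis by (simp add: brown_resnick_spectral_function_def drifted_def)
qed

lemma exp_moment_drifted:
  fixes c d :: "'i \<Rightarrow> real"
  assumes J: "finite J"
  shows "(\<integral>\<^sup>+\<omega>. ennreal (exp (\<Sum>i\<in>J. c i * drifted (d i) \<omega>)) \<partial>E) =
    ennreal (exp ((\<Sum>i\<in>J. c i) * (\<Sum>i\<in>J. c i * v (d i)) / 2 - (\<Sum>i\<in>J. c i * v (d i)) / 2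
      - (\<Sum>i\<in>J. \<Sum>j\<in>J. c i * c j * v (d i - d j)) / 4))"
proof -
  let ?A = "\<Sum>i\<in>J. c i * v (d i)" and ?V = "\<Sum>i\<in>J. \<Sum>j\<in>J. c i * c j * v (d i - d j)"
    and ?P = "(\<Sum>i\<in>J. c i) * (\<Sum>i\<in>J. c i * v (d i))"
    and ?R = "\<Sum>i\<in>J. \<Sum>j\<in>J. c i * c j * (\<integral>\<omega>. W (d i) \<omega> * W (d j) \<omega> \<partial>E)"
  have "(\<integral>\<^sup>+\<omega>. ennreal (exp (\<Sum>i\<in>J. c i * drifted (d i) \<omega>)) \<partial>E) =
      (\<integral>\<^sup>+\<omega>. ennreal (exp (- ?A / 2)) * ennreal (exp (\<Sum>i\<in>J. c i * W (d i) \<omega>)) \<partial>E)"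
    by (simp add: drifted_def ennreal_mult[symmetric] exp_add[symmetric] right_diff_distrib sum_subtractf sum_divide_distrib)
  also have "\<dots> = ennreal (exp (- ?A / 2)) *
      ennreal (exp (?R / 2))"
    by (subst nn_integral_cmult) (simp_all add: gaussian_process_exp_moment[OF gaussian J])
  also have "?R =
      ?P - ?V / 2"
  proof -
    have "?R =
        (\<Sum>i\<in>J. \<Sum>j\<in>J. c j * (c i * v (d i)) / 2 + c i * (c j * v (d j)) / 2 - c i * c j * v (d i - d j) / 2)"
      unfolding covariance by (intro sum.cong refl) (simp add: field_simps)
    also have "\<dots> = (\<Sum>i\<in>J. \<Sum>j\<in>J. c j * (c i * v (d i))) / 2 + (\<Sum>i\<in>J. \<Sum>j\<in>J. c i * (c j * v (d j))) / 2
        - ?V / 2"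
      by (simp add: sum.distrib sum_subtractf sum_divide_distrib)
    also have "(\<Sum>i\<in>J. \<Sum>j\<in>J. c i * (c j * v (d j))) = ?P"
      by (simp add: sum_product)
    also have "(\<Sum>i\<in>J. \<Sum>j\<in>J. c j * (c i * v (d i))) = ?P"
      by (subst sum.swap) (simp add: sum_product)
    finally show ?thesis by simp
  qed
  finally show ?thesis
    by (simp add: ennreal_mult[symmetric] exp_add[symmetric] field_simps)
qed

text \<open>Under the measure tilted by \<open>exp (drifted s)\<close>, the path minus its value at time \<open>s\<close> has the law of
  the original path delayed by \<open>s\<close>. Both sides have Gaussian exponential moments, and the quadratic forms
  in the exponents agree.\<close>

lemma tilted_distr:
  fixes d :: "'i \<Rightarrow> real"
  shows "distr (density E (\<lambda>\<omega>. ennreal (exp (drifted s \<omega>)))) (\<Pi>\<^sub>M i\<in>UNIV. borel) (\<lambda>\<omega> i. drifted (d i) \<omega> - drifted s \<omega>) =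
    distr E (\<Pi>\<^sub>M i\<in>UNIV. borel) (\<lambda>\<omega> i. drifted (d i - s) \<omega>)"
proof (rule distr_eqI_exp_moments)
  let ?T = "density E (\<lambda>\<omega>. ennreal (exp (drifted s \<omega>)))"
  show eq: "(\<integral>\<^sup>+\<omega>. ennreal (exp (\<Sum>i\<in>J. c i * (drifted (d i) \<omega> - drifted s \<omega>))) \<partial>?T) =
      (\<integral>\<^sup>+\<omega>. ennreal (exp (\<Sum>i\<in>J. c i * drifted (d i - s) \<omega>)) \<partial>E)" if J: "finite J" for J and c :: "'i \<Rightarrow> real"
  proof -
    define C where "C = sum c J"
    define A where "A = (\<Sum>i\<in>J. c i * v (d i))"
    define B where "B = (\<Sum>i\<in>J. c i * v (d i - s))"
    define V where "V = (\<Sum>i\<in>J. \<Sum>j\<in>J. c i * c j * v (d i - d j))"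
    \<comment> \<open>The tilt contributes one more time \<open>s\<close> with coefficient \<open>1 - C\<close>: once from the density and \<open>- C\<close> from centering the path at \<open>s\<close>. It is indexed by \<open>None\<close>.\<close>
    define K where "K = insert None (Some ` J)"
    define c' where "c' = case_option (1 - C) c"
    define d' where "d' = case_option s d"
    have K: "finite K" using J by (simp add: K_def)
    have sumK: "(\<Sum>k\<in>K. f k) = f None + (\<Sum>i\<in>J. f (Some i))" for f :: "'i option \<Rightarrow> real"
      using J unfolding K_def by (subst sum.insert) (auto simp: sum.reindex)
    have exponent: "drifted s \<omega> + (\<Sum>i\<in>J. c i * (drifted (d i) \<omega> - drifted s \<omega>)) = (\<Sum>k\<in>K. c' k * drifted (d' k) \<omega>)"
      for \<omega>
    proof -
      have "(\<Sum>i\<in>J. c i * (drifted (d i) \<omega> - drifted s \<omega>)) = (\<Sum>i\<in>J. c i * drifted (d i) \<omega>) - C * drifted s \<omega>"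
        by (simp add: right_diff_distrib sum_subtractf C_def sum_distrib_right)
      moreover have "(\<Sum>k\<in>K. c' k * drifted (d' k) \<omega>) = (1 - C) * drifted s \<omega> + (\<Sum>i\<in>J. c i * drifted (d i) \<omega>)"
        by (simp add: sumK c'_def d'_def)
      ultimately show ?thesis by (simp add: algebra_simps)
    qed
    have "(\<integral>\<^sup>+\<omega>. ennreal (exp (\<Sum>i\<in>J. c i * (drifted (d i) \<omega> - drifted s \<omega>))) \<partial>?T) =
        (\<integral>\<^sup>+\<omega>. ennreal (exp (\<Sum>k\<in>K. c' k * drifted (d' k) \<omega>)) \<partial>E)"
      by (subst nn_integral_density) (simp_all add: exponent[symmetric] ennreal_mult exp_add)
    also have "\<dots> = ennreal (exp ((\<Sum>i\<in>K. c' i) * (\<Sum>i\<in>K. c' i * v (d' i)) / 2 - (\<Sum>i\<in>K. c' i * v (d' i)) / 2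
      - (\<Sum>i\<in>K. \<Sum>j\<in>K. c' i * c' j * v (d' i - d' j)) / 4))"
      by (rule exp_moment_drifted[OF K])
    also have "(\<Sum>i\<in>K. c' i) = 1"
      by (simp add: sumK c'_def C_def)
    also have "(\<Sum>i\<in>K. c' i * v (d' i)) = (1 - C) * v s + A"
      by (simp add: sumK c'_def d'_def A_def)
    also have "(\<Sum>i\<in>K. \<Sum>j\<in>K. c' i * c' j * v (d' i - d' j)) = 2 * (1 - C) * B + V"
    proof -
      have "v (s - d i) = v (d i - s)" for i
        using v_minus[of "d i - s"] by simp
      moreover have "(\<Sum>i\<in>J. (1 - C) * c i * v (d i - s)) = (1 - C) * B" "(\<Sum>i\<in>J. c i * (1 - C) * v (d i - s)) = (1 - C) * B"
        by (simp_all add: B_def sum_distrib_left mult_ac)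
      ultimately show ?thesis
        by (simp add: sumK c'_def d'_def v_0 V_def sum.distrib)
    qed
    also have "1 * ((1 - C) * v s + A) / 2 - ((1 - C) * v s + A) / 2 - (2 * (1 - C) * B + V) / 4 =
        C * B / 2 - B / 2 - V / 4"
      by (simp add: field_simps)
    also have "ennreal (exp (C * B / 2 - B / 2 - V / 4)) =
        (\<integral>\<^sup>+\<omega>. ennreal (exp (\<Sum>i\<in>J. c i * drifted (d i - s) \<omega>)) \<partial>E)"
      by (simp add: exp_moment_drifted[OF J] C_def B_def V_def)
    finally show ?thesis .
  qed
  show "(\<integral>\<^sup>+\<omega>. ennreal (exp (\<Sum>i\<in>J. c i * (drifted (d i) \<omega> - drifted s \<omega>))) \<partial>?T) < \<infinity>"
    if J: "finite J" for J and c :: "'i \<Rightarrow> real"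
    unfolding eq[OF J] exp_moment_drifted[OF J] by simp
qed auto

lemma nn_integral_sqrt_spectral: "(\<integral>\<^sup>+\<omega>. ennreal (exp (drifted t \<omega> / 2)) \<partial>E) = ennreal (exp (- v t / 8))"
  using exp_moment_drifted[of "{()}" "\<lambda>_. 1 / 2" "\<lambda>_. t"] by (simp add: v_0)

lemma nn_integral_spectral_ratio:
  "(\<integral>\<^sup>+\<omega>. ennreal (exp (drifted t \<omega> - drifted s \<omega>)) \<partial>E) = ennreal (exp (v (t - s) / 2 - (v t - v s) / 2))"
proof -
  have "v (s - t) = v (t - s)" using v_minus[of "t - s"] by simp
  then show ?thesis
    using exp_moment_drifted[of UNIV "\<lambda>b. if b then 1 else -1" "\<lambda>b. if b then t else s"]
    by (simp add: UNIV_bool v_0 algebra_simps add_divide_distrib diff_divide_distrib)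
qed

end

section \<open>Integrability of the spectral functions over the line\<close>

lemma tendsto_dyadic_floor: "(\<lambda>n. real_of_int \<lfloor>t * 2 ^ n\<rfloor> / 2 ^ n) \<longlonglongrightarrow> t"
proof (rule tendsto_sandwich)
  have "(\<lambda>n. t - (1/2) ^ n) \<longlonglongrightarrow> t - 0"
    by (intro tendsto_intros LIMSEQ_realpow_zero) auto
  then show "(\<lambda>n. t - (1/2) ^ n) \<longlonglongrightarrow> t" by simp
  show "\<forall>\<^sub>F n in sequentially. t - (1/2) ^ n \<le> real_of_int \<lfloor>t * 2 ^ n\<rfloor> / 2 ^ n"
  proof (rule always_eventually, rule allI)
    fix n
    have "t * 2 ^ n - 1 \<le> real_of_int \<lfloor>t * 2 ^ n\<rfloor>" by linarith
    then have "(t * 2 ^ n - 1) / 2 ^ n \<le> real_of_int \<lfloor>t * 2 ^ n\<rfloor> / 2 ^ n"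
      by (rule divide_right_mono) simp
    then show "t - (1/2) ^ n \<le> real_of_int \<lfloor>t * 2 ^ n\<rfloor> / 2 ^ n"
      by (simp add: diff_divide_distrib power_one_over)
  qed
  show "\<forall>\<^sub>F n in sequentially. real_of_int \<lfloor>t * 2 ^ n\<rfloor> / 2 ^ n \<le> t"
    by (simp add: divide_le_eq)
qed simp

text \<open>Replacing the time by its dyadic floor leaves countably many times, each of which is handled by the
  measurability of one \<open>f t\<close>; continuity gives the limit.\<close>

lemma measurable_continuous_process:
  fixes f :: "real \<Rightarrow> 'e \<Rightarrow> real"
  assumes [measurable]: "\<And>t. f t \<in> borel_measurable E"
    and cont: "\<And>\<omega>. \<omega> \<in> space E \<Longrightarrow> continuous_on UNIV (\<lambda>t. f t \<omega>)"
  shows "(\<lambda>(t, \<omega>). f t \<omega>) \<in> borel_measurable (borel \<Otimes>\<^sub>M E)"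
proof (rule borel_measurable_LIMSEQ_real)
  fix n :: nat
  have "(\<lambda>z :: real \<times> 'e. (\<lambda>i z. f (real_of_int i / 2 ^ n) (snd z)) \<lfloor>fst z * 2 ^ n\<rfloor> z) \<in> borel_measurable (borel \<Otimes>\<^sub>M E)"
    by (rule measurable_compose_countable) measurable
  then show "(\<lambda>z :: real \<times> 'e. f (real_of_int \<lfloor>fst z * 2 ^ n\<rfloor> / 2 ^ n) (snd z)) \<in> borel_measurable (borel \<Otimes>\<^sub>M E)" .
next
  fix z :: "real \<times> 'e" assume "z \<in> space (borel \<Otimes>\<^sub>M E)"
  then have "isCont (\<lambda>t. f t (snd z)) (fst z)"
    using cont[of "snd z"] by (auto simp: space_pair_measure continuous_on_eq_continuous_at)
  from isCont_tendsto_compose[OF this tendsto_dyadic_floor]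
  show "(\<lambda>n. f (real_of_int \<lfloor>fst z * 2 ^ n\<rfloor> / 2 ^ n) (snd z)) \<longlonglongrightarrow> (case z of (t, \<omega>) \<Rightarrow> f t \<omega>)"
    by (simp add: case_prod_beta)
qed

lemma nn_integral_le_suminf_unit_intervals:
  fixes g :: "real \<Rightarrow> ennreal"
  assumes [measurable]: "g \<in> borel_measurable borel"
  shows "(\<integral>\<^sup>+t. g t \<partial>lborel) \<le> (\<Sum>n. \<integral>\<^sup>+u. g (real n + u) * indicator {0..<1} u \<partial>lborel) +
     (\<Sum>n. \<integral>\<^sup>+u. g (- (real n + u)) * indicator {0..<1} u \<partial>lborel)"
proof -
  let ?s = "\<lambda>g :: real \<Rightarrow> ennreal. \<Sum>n. \<integral>\<^sup>+u. g (real n + u) * indicator {0..<1} u \<partial>lborel"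
  have half: "(\<integral>\<^sup>+t. g' t * indicator {0..} t \<partial>lborel) \<le> ?s g'"
    if [measurable]: "g' \<in> borel_measurable borel" for g' :: "real \<Rightarrow> ennreal"
  proof -
    have "(\<integral>\<^sup>+t. g' t * indicator {0..} t \<partial>lborel) \<le> (\<integral>\<^sup>+t. (\<Sum>n. g' t * indicator {0..<1} (t - real n)) \<partial>lborel)"
    proof (rule nn_integral_mono)
      fix t :: real
      show "g' t * indicator {0..} t \<le> (\<Sum>n. g' t * indicator {0..<1} (t - real n))"
      proof (cases "t \<ge> 0")
        case True
        then have "t - real (nat \<lfloor>t\<rfloor>) \<in> {0..<1}" by (simp add: of_nat_nat) linarith
        then have "g' t * indicator {0..} t = (\<Sum>n\<in>{nat \<lfloor>t\<rfloor>}. g' t * indicator {0..<1} (t - real n))"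
          using True by simp
        also have "\<dots> \<le> (\<Sum>n. g' t * indicator {0..<1} (t - real n))"
          by (rule sum_le_suminf) (auto intro: summableI)
        finally show ?thesis .
      qed simp
    qed
    also have "\<dots> = (\<Sum>n. \<integral>\<^sup>+t. g' t * indicator {0..<1} (t - real n) \<partial>lborel)"
      by (rule nn_integral_suminf) measurable
    also have "\<dots> = ?s g'"
    proof (rule suminf_cong)
      fix n
      show "(\<integral>\<^sup>+t. g' t * indicator {0..<1} (t - real n) \<partial>lborel) = (\<integral>\<^sup>+u. g' (real n + u) * indicator {0..<1} u \<partial>lborel)"
        by (subst nn_integral_real_affine[of _ 1 "real n"]) simp_all
    qed
    finally show ?thesis .
  qed
  have "(\<integral>\<^sup>+t. g t \<partial>lborel) \<le> (\<integral>\<^sup>+t. g t * indicator {0..} t + g t * indicator {0..} (- t) \<partial>lborel)"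
  proof (rule nn_integral_mono)
    fix t show "g t \<le> g t * indicator {0..} t + g t * indicator {0..} (- t)"
      by (cases "t \<ge> 0") auto
  qed
  also have "\<dots> = (\<integral>\<^sup>+t. g t * indicator {0..} t \<partial>lborel) + (\<integral>\<^sup>+t. g t * indicator {0..} (- t) \<partial>lborel)"
    by (rule nn_integral_add) measurable
  also have "(\<integral>\<^sup>+t. g t * indicator {0..} (- t) \<partial>lborel) = (\<integral>\<^sup>+t. g (- t) * indicator {0..} t \<partial>lborel)"
    by (subst nn_integral_real_affine[of _ "-1" 0]) simp_all
  also have "(\<integral>\<^sup>+t. g t * indicator {0..} t \<partial>lborel) + (\<integral>\<^sup>+t. g (- t) * indicator {0..} t \<partial>lborel) \<le>
      ?s g +
      ?s (\<lambda>t. g (- t))"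
    using half[of g] half[of "\<lambda>t. g (- t)"] by (intro add_mono) simp_all
  finally show ?thesis .
qed

text \<open>This is used with \<open>x n = sqrt (f n)\<close> and with \<open>y n\<close> the integral of \<open>f (n + u) / f n\<close> over \<open>0 \<le> u < 1\<close>. Expectations of
  \<open>x n\<close> decay while those of \<open>y n\<close> are only bounded; the weights shift part of the decay from the first series to the
  second, so that both series on the right have finite expectation.\<close>

lemma suminf_le_weighted:
  fixes x y :: "nat \<Rightarrow> ennreal" and w :: "nat \<Rightarrow> real"
  assumes w: "\<And>n. w n \<ge> 0"
  shows "(\<Sum>n. x n * x n * y n) \<le> (\<Sum>n. ennreal (exp (w n)) * x n) * (\<Sum>n. ennreal (exp (w n)) * x n) *
    (\<Sum>n. ennreal (exp (- w n)) * y n)"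
proof -
  let ?S = "\<Sum>n. ennreal (exp (w n)) * x n"
  let ?a = "\<lambda>n. ennreal (exp (w n)) * x n" and ?b = "\<lambda>n. ennreal (exp (- w n)) * y n"
  have x_le: "?a n \<le> ?S" for n
    using sum_le_suminf[of "\<lambda>n. ennreal (exp (w n)) * x n" "{n}"] by (simp add: summableI)
  have "x n * x n * y n \<le> ?S * ?S * ?b n" for n
  proof -
    have "x n * x n * y n \<le> ?a n * ?a n * ?b n"
    proof -
      have "1 \<le> ennreal (exp (w n)) * ennreal (exp (w n)) * ennreal (exp (- w n))"
        using w[of n] by (simp add: ennreal_mult[symmetric] exp_add[symmetric] ennreal_1[symmetric] del: ennreal_1)
      from mult_right_mono[OF this, of "x n * x n * y n"] show ?thesis
        by (simp add: mult_ac)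
    qed
    also have "\<dots> \<le> ?S * ?S * ?b n"
      by (intro mult_mono x_le) auto
    finally show ?thesis .
  qed
  then have "(\<Sum>n. x n * x n * y n) \<le> (\<Sum>n. ?S * ?S * ?b n)"
    by (intro suminf_le) (auto intro: summableI)
  then show ?thesis by simp
qed

context stationary_increments_gaussian begin

text \<open>The sign \<open>\<epsilon>\<close> selects the half-line; on both of them one moves away from \<open>0\<close>, so that \<open>v\<close> increases from
  \<open>n\<close> to \<open>n + u\<close>.\<close>

lemma AE_one_sided_integral_finite:
  assumes jm: "(\<lambda>(t, \<omega>). drifted t \<omega>) \<in> borel_measurable (borel \<Otimes>\<^sub>M E)"
    and mono: "\<And>s t. \<bar>s\<bar> \<le> \<bar>t\<bar> \<Longrightarrow> v s \<le> v t"
    and summable: "summable (\<lambda>n. exp (- v (real n) / 16))"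
    and \<epsilon>: "\<bar>\<epsilon>\<bar> = 1"
  shows "AE \<omega> in E. (\<Sum>n. \<integral>\<^sup>+u. ennreal (exp (drifted (\<epsilon> * (real n + u)) \<omega>)) * indicator {0..<1} u \<partial>lborel) < \<infinity>"
proof -
  interpret pair_sigma_finite lborel E ..
  have [measurable]: "(\<lambda>z. drifted (fst z) (snd z)) \<in> borel_measurable (borel \<Otimes>\<^sub>M E)"
    using jm by (simp add: case_prod_beta')
  have drifted_comp[measurable]: "(\<lambda>z. drifted (a z) (b z)) \<in> borel_measurable N"
    if [measurable]: "a \<in> borel_measurable N" "b \<in> measurable N E" for a b and N :: "'n measure"
    using measurable_compose[of "\<lambda>z. (a z, b z)" N "borel \<Otimes>\<^sub>M E" "\<lambda>z. drifted (fst z) (snd z)" borel] by simp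
  have v_nonneg: "v t \<ge> 0" for t using mono[of 0 t] v_0 by simp
  have v_\<epsilon>: "v (\<epsilon> * t) = v t" for t
    using mono[of "\<epsilon> * t" t] mono[of t "\<epsilon> * t"] \<epsilon> by (simp add: abs_mult antisym)
  define x where "x n \<omega> = ennreal (exp (drifted (\<epsilon> * real n) \<omega> / 2))" for n \<omega>
  define y where "y n \<omega> = (\<integral>\<^sup>+u. ennreal (exp (drifted (\<epsilon> * (real n + u)) \<omega> - drifted (\<epsilon> * real n) \<omega>)) * indicator {0..<1} u \<partial>lborel)" for n \<omega>
  let ?r = "\<lambda>n \<omega> u. ennreal (exp (drifted (\<epsilon> * (real n + u)) \<omega> - drifted (\<epsilon> * real n) \<omega>)) * indicator {0..<1} u"
    and ?f = "\<lambda>n \<omega> u. ennreal (exp (drifted (\<epsilon> * (real n + u)) \<omega>)) * indicator {0..<1} u"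
    and ?e = "\<lambda>n u. ennreal (exp (v u / 2 - (v (real n + u) - v (real n)) / 2)) * indicator {0..<1} u"
  define w where "w n = v (real n) / 16" for n
  have w_nonneg: "w n \<ge> 0" for n using v_nonneg by (simp add: w_def)
  let ?S = "\<lambda>\<omega>. \<Sum>n. ennreal (exp (w n)) * x n \<omega>" and ?T = "\<lambda>\<omega>. \<Sum>n. ennreal (exp (- w n)) * y n \<omega>"
  have sum_w: "(\<Sum>n. ennreal (exp (- w n))) < \<infinity>"
    using summable unfolding w_def by (subst suminf_ennreal2) simp_all
  have x_meas[measurable]: "x n \<in> borel_measurable E" for n unfolding x_def by measurable
  have y_meas[measurable]: "y n \<in> borel_measurable E" for n unfolding y_def by measurable
  have "(\<integral>\<^sup>+\<omega>. ?S \<omega> \<partial>E) = (\<Sum>n. ennreal (exp (- w n)))"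
  proof -
    have "(\<integral>\<^sup>+\<omega>. ?S \<omega> \<partial>E) = (\<Sum>n. ennreal (exp (w n)) * (\<integral>\<^sup>+\<omega>. x n \<omega> \<partial>E))"
      by (subst nn_integral_suminf) (simp_all add: nn_integral_cmult)
    also have "\<dots> = (\<Sum>n. ennreal (exp (- w n)))"
      unfolding x_def nn_integral_sqrt_spectral v_\<epsilon>
      by (intro suminf_cong) (simp add: ennreal_mult[symmetric] exp_add[symmetric] w_def)
    finally show ?thesis .
  qed
  then have fin1: "AE \<omega> in E. ?S \<omega> \<noteq> \<infinity>"
    using sum_w by (intro nn_integral_noteq_infinite) auto
  have y_int: "(\<integral>\<^sup>+\<omega>. y n \<omega> \<partial>E) \<le> ennreal (exp (v 1 / 2))" for n
  proof -
    have "(\<integral>\<^sup>+\<omega>. y n \<omega> \<partial>E) = (\<integral>\<^sup>+u. (\<integral>\<^sup>+\<omega>. ?r n \<omega> u \<partial>E) \<partial>lborel)"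
      unfolding y_def by (rule Fubini') measurable
    also have "\<dots> = (\<integral>\<^sup>+u. ?e n u \<partial>lborel)"
    proof (rule nn_integral_cong)
      fix u
      have "\<epsilon> * (real n + u) - \<epsilon> * real n = \<epsilon> * u" by (simp add: algebra_simps)
      then show "(\<integral>\<^sup>+\<omega>. ?r n \<omega> u \<partial>E) =
          ?e n u"
        by (subst nn_integral_multc) (simp_all only: nn_integral_spectral_ratio v_\<epsilon>, measurable)
    qed
    also have "\<dots> \<le> (\<integral>\<^sup>+u. ennreal (exp (v 1 / 2)) * indicator {0..<1::real} u \<partial>lborel)"
    proof (rule nn_integral_mono)
      fix u :: real
      show "?e n u \<le> ennreal (exp (v 1 / 2)) * indicator {0..<1} u"
      proof (cases "u \<in> {0..<1}")
        case True
        then have "v u / 2 - (v (real n + u) - v (real n)) / 2 \<le> v 1 / 2"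
          using mono[of u 1] mono[of "real n" "real n + u"] by (simp add: diff_divide_distrib)
        with True show ?thesis by (simp add: ennreal_leI)
      qed simp
    qed
    also have "\<dots> = ennreal (exp (v 1 / 2))" by (simp add: nn_integral_cmult_indicator)
    finally show ?thesis .
  qed
  have "(\<integral>\<^sup>+\<omega>. ?T \<omega> \<partial>E) = (\<Sum>n. ennreal (exp (- w n)) * (\<integral>\<^sup>+\<omega>. y n \<omega> \<partial>E))"
    by (subst nn_integral_suminf) (simp_all add: nn_integral_cmult)
  also have "\<dots> \<le> (\<Sum>n. ennreal (exp (- w n)) * ennreal (exp (v 1 / 2)))"
    by (intro suminf_le mult_left_mono y_int) (auto intro: summableI)
  also have "\<dots> = (\<Sum>n. ennreal (exp (- w n))) * ennreal (exp (v 1 / 2))"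
    by simp
  also have "\<dots> < \<infinity>" using sum_w by (simp add: ennreal_mult_less_top)
  finally have fin2: "AE \<omega> in E. ?T \<omega> \<noteq> \<infinity>"
    by (intro nn_integral_noteq_infinite) auto
  have prod: "(\<integral>\<^sup>+u. ?f n \<omega> u \<partial>lborel) = x n \<omega> * x n \<omega> * y n \<omega>"
    if \<omega>: "\<omega> \<in> space E" for n \<omega>
  proof -
    have "(\<lambda>u. drifted (\<epsilon> * (real n + u)) \<omega>) \<in> borel_measurable borel"
      by (rule drifted_comp) (use \<omega> in simp_all)
    then have meas: "(\<lambda>u. ?r n \<omega> u)
        \<in> borel_measurable lborel"
      by (intro borel_measurable_times_ennreal measurable_compose[OF _ measurable_ennreal] borel_measurable_exp
          borel_measurable_diff borel_measurable_const borel_measurable_indicator) simp_all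
    have exp_cancel: "ennreal (exp a) * ennreal (exp (b - a)) = ennreal (exp b)" for a b :: real
      by (simp add: ennreal_mult[symmetric] exp_add[symmetric])
    have "x n \<omega> * x n \<omega> = ennreal (exp (drifted (\<epsilon> * real n) \<omega>))"
      by (simp add: x_def ennreal_mult[symmetric] exp_add[symmetric])
    then have "x n \<omega> * x n \<omega> * y n \<omega> = ennreal (exp (drifted (\<epsilon> * real n) \<omega>)) * y n \<omega>"
      by simp
    also have "\<dots> = (\<integral>\<^sup>+u. ennreal (exp (drifted (\<epsilon> * real n) \<omega>)) *
        (?r n \<omega> u) \<partial>lborel)"
      unfolding y_def by (rule nn_integral_cmult[symmetric, OF meas])
    also have "\<dots> = (\<integral>\<^sup>+u. ?f n \<omega> u \<partial>lborel)"
      by (simp only: mult.assoc[symmetric] exp_cancel)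
    finally show ?thesis ..
  qed
  show ?thesis
    using fin1 fin2 AE_space
  proof eventually_elim
    case (elim \<omega>)
    have "(\<Sum>n. x n \<omega> * x n \<omega> * y n \<omega>) \<le> ?S \<omega> * ?S \<omega> *
        ?T \<omega>"
      by (rule suminf_le_weighted[OF w_nonneg])
    also have "\<dots> < \<infinity>" using elim by (simp add: ennreal_mult_less_top less_top)
    finally show ?case using prod[OF elim(3)] by simp
  qed
qed

lemma AE_spectral_integral_finite:
  assumes jm: "(\<lambda>(t, \<omega>). drifted t \<omega>) \<in> borel_measurable (borel \<Otimes>\<^sub>M E)"
    and mono: "\<And>s t. \<bar>s\<bar> \<le> \<bar>t\<bar> \<Longrightarrow> v s \<le> v t"
    and summable: "summable (\<lambda>n. exp (- v (real n) / 16))"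
  shows "AE \<omega> in E. (\<integral>\<^sup>+t. ennreal (exp (drifted t \<omega>)) \<partial>lborel) < \<infinity>"
proof -
  let ?fin = "\<lambda>\<epsilon>. AE \<omega> in E. (\<Sum>n. \<integral>\<^sup>+u. ennreal (exp (drifted (\<epsilon> * (real n + u)) \<omega>)) * indicator {0..<1} u \<partial>lborel) < \<infinity>"
  have half: "?fin \<epsilon>"
    if "\<bar>\<epsilon>\<bar> = 1" for \<epsilon>
    using jm mono summable that by (rule AE_one_sided_integral_finite)
  have "?fin 1"
    "?fin (- 1)"
    by (rule half, simp)+
  then show ?thesis using AE_space
  proof eventually_elim
    case (elim \<omega>)
    have [measurable]: "(\<lambda>t. drifted t \<omega>) \<in> borel_measurable borel"
      using measurable_compose[OF measurable_Pair2'[OF elim(3)] jm] by simp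
    have "(\<integral>\<^sup>+t. ennreal (exp (drifted t \<omega>)) \<partial>lborel) \<le>
       (\<Sum>n. \<integral>\<^sup>+u. ennreal (exp (drifted (real n + u) \<omega>)) * indicator {0..<1} u \<partial>lborel) +
       (\<Sum>n. \<integral>\<^sup>+u. ennreal (exp (drifted (- (real n + u)) \<omega>)) * indicator {0..<1} u \<partial>lborel)"
      by (rule nn_integral_le_suminf_unit_intervals[of "\<lambda>t. ennreal (exp (drifted t \<omega>))"]) measurable
    also have "\<dots> < \<infinity>" using elim(1,2) by simp
    finally show ?case .
  qed
qed

end

section \<open>Moving maxima of normalized paths\<close>

definition dyadic_time :: "nat \<Rightarrow> real" where
  "dyadic_time k = real_of_int (int_decode (snd (prod_decode k))) / 2 ^ fst (prod_decode k)"

text \<open>Recovers a continuous path from its values at the dyadic rationals. Defining it by a limit makes it jointly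
  measurable in the sample sequence and the time.\<close>

definition path_of_samples :: "(nat \<Rightarrow> real) \<Rightarrow> real \<Rightarrow> real" where
  "path_of_samples x t = lim (\<lambda>n. x (prod_encode (n, int_encode \<lfloor>t * 2 ^ n\<rfloor>)))"

lemma path_of_samples_continuous:
  assumes "continuous_on UNIV g"
  shows "path_of_samples (\<lambda>k. g (dyadic_time k)) t = g t"
proof -
  have "isCont g t" using assms by (simp add: continuous_on_eq_continuous_at)
  from isCont_tendsto_compose[OF this tendsto_dyadic_floor]
  have "(\<lambda>n. g (real_of_int \<lfloor>t * 2 ^ n\<rfloor> / 2 ^ n)) \<longlonglongrightarrow> g t" .
  then show ?thesis
    by (simp add: path_of_samples_def dyadic_time_def limI)
qed

lemma measurable_path_of_samples[measurable]:
  "(\<lambda>z. path_of_samples (fst z) (snd z)) \<in> borel_measurable (borel \<Otimes>\<^sub>M borel)"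
  unfolding path_of_samples_def
proof (rule borel_measurable_lim_metric)
  fix n :: nat
  have [measurable]: "(\<lambda>x :: nat \<Rightarrow> real. x k) \<in> borel_measurable borel" for k
    by (rule borel_measurable_continuous_onI) (rule continuous_on_product_coordinates)
  have "(\<lambda>z :: (nat \<Rightarrow> real) \<times> real. (\<lambda>i z. fst z (prod_encode (n, int_encode i))) \<lfloor>snd z * 2 ^ n\<rfloor> z)
      \<in> borel_measurable (borel \<Otimes>\<^sub>M borel)"
    by (rule measurable_compose_countable) measurable
  then show "(\<lambda>z :: (nat \<Rightarrow> real) \<times> real. fst z (prod_encode (n, int_encode \<lfloor>snd z * 2 ^ n\<rfloor>)))
      \<in> borel_measurable (borel \<Otimes>\<^sub>M borel)" .
qed

definition path_mass :: "(nat \<Rightarrow> real) \<Rightarrow> ennreal" where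
  "path_mass x = (\<integral>\<^sup>+t. ennreal (exp (path_of_samples x t)) \<partial>lborel)"

definition normalized_path :: "(nat \<Rightarrow> real) \<times> real \<Rightarrow> real" where
  "normalized_path z = exp (path_of_samples (fst z) (snd z)) / enn2real (path_mass (fst z))"

lemma measurable_path_mass[measurable]: "path_mass \<in> borel_measurable borel"
proof -
  have "(\<lambda>z. ennreal (exp (path_of_samples (fst z) (snd z)))) \<in> borel_measurable (borel \<Otimes>\<^sub>M lborel)"
    by measurable
  from lborel.borel_measurable_nn_integral_fst[OF this] show ?thesis
    by (simp add: path_mass_def[abs_def])
qed

lemma measurable_normalized_path[measurable]: "normalized_path \<in> borel_measurable (borel \<Otimes>\<^sub>M borel)"
  unfolding normalized_path_def by measurable

lemma normalized_path_nonneg[simp]: "normalized_path z \<ge> 0"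
  by (simp add: normalized_path_def)

lemma normalized_path_continuous:
  assumes "continuous_on UNIV g"
  shows "normalized_path (\<lambda>k. g (dyadic_time k), t) = exp (g t) / enn2real (\<integral>\<^sup>+u. ennreal (exp (g u)) \<partial>lborel)"
  by (simp add: normalized_path_def path_mass_def path_of_samples_continuous[OF assms])

text \<open>An additive constant multiplies \<open>exp\<close> of the path and its integral by the same factor.\<close>

lemma normalized_path_shift:
  assumes "continuous_on UNIV g"
  shows "normalized_path (\<lambda>k. g (dyadic_time k) - a, t) = normalized_path (\<lambda>k. g (dyadic_time k), t)"
proof -
  have [measurable]: "g \<in> borel_measurable borel" using assms by (rule borel_measurable_continuous_onI)
  have "(\<integral>\<^sup>+u. ennreal (exp (g u - a)) \<partial>lborel) = ennreal (exp (- a)) * (\<integral>\<^sup>+u. ennreal (exp (g u)) \<partial>lborel)"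
    by (subst nn_integral_cmult[symmetric]) (simp_all add: ennreal_mult[symmetric] exp_add[symmetric] algebra_simps)
  moreover have c': "continuous_on UNIV (\<lambda>t. g t - a)" using assms by (intro continuous_intros)
  ultimately show ?thesis
    unfolding normalized_path_continuous[OF c'] normalized_path_continuous[OF assms]
    by (simp add: enn2real_mult exp_diff exp_minus field_simps)
qed

lemma nn_integral_exp_pos:
  fixes g :: "real \<Rightarrow> real"
  assumes [measurable]: "g \<in> borel_measurable borel"
  shows "(\<integral>\<^sup>+u. ennreal (exp (g u)) \<partial>lborel) \<noteq> 0"
proof
  assume "(\<integral>\<^sup>+u. ennreal (exp (g u)) \<partial>lborel) = 0"
  then have "AE u in lborel. ennreal (exp (g u)) = 0"
    by (subst (asm) nn_integral_0_iff_AE) auto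
  then have "AE u in (lborel :: real measure). False" by simp
  then show False by (simp add: AE_iff_null null_sets_def)
qed

lemma measurable_sequence:
  assumes "\<And>k. (\<lambda>\<omega>. X \<omega> k) \<in> borel_measurable N"
  shows "X \<in> measurable N (borel :: (nat \<Rightarrow> real) measure)"
proof -
  have "(\<lambda>\<omega> k. X \<omega> k) \<in> measurable N (\<Pi>\<^sub>M k\<in>UNIV. borel)"
    using assms by (intro measurable_PiM_single') auto
  then show ?thesis
    by (simp add: measurable_cong_sets[OF refl sets_PiM_equal_borel])
qed

context stationary_increments_gaussian begin

definition samples :: "'e \<Rightarrow> nat \<Rightarrow> real" where
  "samples \<omega> k = drifted (dyadic_time k) \<omega>"

definition sample_law :: "(nat \<Rightarrow> real) measure" where
  "sample_law = distr E borel samples"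

lemma measurable_samples[measurable]: "samples \<in> measurable E borel"
  by (rule measurable_sequence) (simp add: samples_def)

lemma prob_space_sample_law: "prob_space sample_law"
  unfolding sample_law_def by (rule prob_space_distr) simp

text \<open>For a functional \<open>G\<close> of the path that ignores additive constants, the tilted law at time \<open>s\<close>
  can be replaced by the law of the path shifted by \<open>s\<close>.\<close>

lemma tilted_shift_invariant:
  assumes G[measurable]: "G \<in> borel_measurable (borel :: (nat \<Rightarrow> real) measure)"
    and inv: "\<And>\<omega>. \<omega> \<in> space E \<Longrightarrow> G (\<lambda>k. drifted (dyadic_time k) \<omega> - drifted s \<omega>) = G (samples \<omega>)"
  shows "(\<integral>\<^sup>+\<omega>. ennreal (exp (drifted s \<omega>)) * G (samples \<omega>) \<partial>E) =
    (\<integral>\<^sup>+\<omega>. G (\<lambda>k. drifted (dyadic_time k - s) \<omega>) \<partial>E)"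
proof -
  let ?T = "density E (\<lambda>\<omega>. ennreal (exp (drifted s \<omega>)))"
  let ?N = "\<Pi>\<^sub>M k\<in>(UNIV :: nat set). (borel :: real measure)"
    and ?X = "\<lambda>\<omega> k. drifted (dyadic_time k) \<omega> - drifted s \<omega>" and ?Y = "\<lambda>\<omega> k. drifted (dyadic_time k - s) \<omega>"
  have G': "G \<in> borel_measurable ?N"
    using G by (simp add: measurable_cong_sets[OF sets_PiM_equal_borel refl])
  have m1: "?X \<in> measurable ?T ?N"
    by (intro measurable_PiM_single') auto
  have m2: "?Y \<in> measurable E ?N"
    by (intro measurable_PiM_single') auto
  have "(\<integral>\<^sup>+\<omega>. ennreal (exp (drifted s \<omega>)) * G (samples \<omega>) \<partial>E) = (\<integral>\<^sup>+\<omega>. G (samples \<omega>) \<partial>?T)"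
    by (subst nn_integral_density) auto
  also have "\<dots> = (\<integral>\<^sup>+\<omega>. G (\<lambda>k. drifted (dyadic_time k) \<omega> - drifted s \<omega>) \<partial>?T)"
    by (intro nn_integral_cong) (simp add: inv)
  also have "\<dots> = (\<integral>\<^sup>+x. G x \<partial>distr ?T ?N ?X)"
    using G' by (intro nn_integral_distr[OF m1, symmetric]) simp
  also have "\<dots> = (\<integral>\<^sup>+x. G x \<partial>distr E ?N ?Y)"
    by (simp only: tilted_distr)
  also have "\<dots> = (\<integral>\<^sup>+\<omega>. G (\<lambda>k. drifted (dyadic_time k - s) \<omega>) \<partial>E)"
    using G' by (intro nn_integral_distr[OF m2]) simp
  finally show ?thesis .
qed

lemma nn_integral_sample_law_pair:
  assumes [measurable]: "F \<in> borel_measurable (borel \<Otimes>\<^sub>M borel)"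
  shows "(\<integral>\<^sup>+z. F z \<partial>(sample_law \<Otimes>\<^sub>M lborel)) = (\<integral>\<^sup>+\<omega>. (\<integral>\<^sup>+u. F (samples \<omega>, u) \<partial>lborel) \<partial>E)"
proof -
  have sets_eq[measurable_cong]: "sets sample_law = sets borel" by (simp add: sample_law_def)
  have "(\<integral>\<^sup>+z. F z \<partial>(sample_law \<Otimes>\<^sub>M lborel)) = (\<integral>\<^sup>+x. (\<integral>\<^sup>+u. F (x, u) \<partial>lborel) \<partial>sample_law)"
    by (rule lborel.nn_integral_fst[symmetric]) measurable
  also have "\<dots> = (\<integral>\<^sup>+\<omega>. (\<integral>\<^sup>+u. F (samples \<omega>, u) \<partial>lborel) \<partial>E)"
    unfolding sample_law_def by (subst nn_integral_distr) auto
  finally show ?thesis .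
qed

context
  assumes cont: "\<And>\<omega>. \<omega> \<in> space E \<Longrightarrow> continuous_on UNIV (\<lambda>t. drifted t \<omega>)"
    and finite_mass: "AE \<omega> in E. (\<integral>\<^sup>+t. ennreal (exp (drifted t \<omega>)) \<partial>lborel) < \<infinity>"
begin

lemma jointly_measurable_drifted: "(\<lambda>(t, \<omega>). drifted t \<omega>) \<in> borel_measurable (borel \<Otimes>\<^sub>M E)"
  by (rule measurable_continuous_process[OF measurable_drifted cont])

text \<open>Almost every normalized path integrates to \<open>1\<close>.\<close>

lemma nn_integral_normalized_path: "(\<integral>\<^sup>+z. ennreal (normalized_path z) \<partial>(sample_law \<Otimes>\<^sub>M lborel)) = 1"
proof -
  have "(\<integral>\<^sup>+z. ennreal (normalized_path z) \<partial>(sample_law \<Otimes>\<^sub>M lborel)) =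
      (\<integral>\<^sup>+\<omega>. (\<integral>\<^sup>+u. ennreal (normalized_path (samples \<omega>, u)) \<partial>lborel) \<partial>E)"
    by (rule nn_integral_sample_law_pair) measurable
  also have "\<dots> = (\<integral>\<^sup>+\<omega>. 1 \<partial>E)"
  proof (rule nn_integral_cong_AE)
    show "AE \<omega> in E. (\<integral>\<^sup>+u. ennreal (normalized_path (samples \<omega>, u)) \<partial>lborel) = 1"
      using finite_mass AE_space
    proof eventually_elim
      case (elim \<omega>)
      let ?Z = "\<integral>\<^sup>+t. ennreal (exp (drifted t \<omega>)) \<partial>lborel"
      note c = cont[OF elim(2)]
      have [measurable]: "(\<lambda>t. drifted t \<omega>) \<in> borel_measurable borel"
        using c by (rule borel_measurable_continuous_onI)
      obtain z where z: "?Z = ennreal z" "z > 0"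
        using elim(1) nn_integral_exp_pos[of "\<lambda>t. drifted t \<omega>"] by (cases ?Z) (auto simp: less_le)
      have "(\<integral>\<^sup>+u. ennreal (normalized_path (samples \<omega>, u)) \<partial>lborel) = (\<integral>\<^sup>+u. ennreal (1 / z) * ennreal (exp (drifted u \<omega>)) \<partial>lborel)"
        unfolding samples_def normalized_path_continuous[OF c] z(1)
        using z(2) by (simp add: ennreal_mult[symmetric])
      also have "\<dots> = ennreal (1 / z) * ?Z" by (rule nn_integral_cmult) measurable
      also have "\<dots> = 1" using z by (simp add: ennreal_mult[symmetric])
      finally show ?case .
    qed
  qed
  finally show ?thesis by (simp add: emeasure_space_1)
qed

text \<open>The functional \<open>G r\<close> below is the maximum over \<open>t \<in> J\<close> of \<open>c t\<close> times the normalized path at \<open>t + r\<close>. Since the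
  integral of \<open>exp (drifted s)\<close> over \<open>s\<close> cancels the normalization, the left-hand side is the expectation of
  \<open>exp (drifted s) * G 0\<close>, integrated over \<open>s\<close>; the change of measure at time \<open>s\<close> turns \<open>G 0\<close> into \<open>G (- s)\<close>, and \<open>u = - s\<close>
  gives the right-hand side.\<close>

lemma spectral_SUP_eq_moving_maxima:
  fixes c :: "real \<Rightarrow> real"
  assumes J: "finite J" and c: "\<And>t. t \<in> J \<Longrightarrow> c t > 0"
  shows "(\<integral>\<^sup>+\<omega>. (SUP t\<in>J. ennreal (c t * exp (drifted t \<omega>))) \<partial>E) =
    (\<integral>\<^sup>+z. (SUP t\<in>J. ennreal (c t * normalized_path (fst z, t + snd z))) \<partial>(sample_law \<Otimes>\<^sub>M lborel))"
proof -
  interpret pair_sigma_finite lborel E ..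
  have [measurable]: "(\<lambda>z. drifted (fst z) (snd z)) \<in> borel_measurable (borel \<Otimes>\<^sub>M E)"
    using jointly_measurable_drifted by (simp add: case_prod_beta')
  have cJ: "countable J" using J by (rule countable_finite)
  define G where "G r x = (SUP t\<in>J. ennreal (c t * normalized_path (x, t + r)))" for r x
  have G_meas2[measurable]: "(\<lambda>z. G (snd z) (fst z)) \<in> borel_measurable (borel \<Otimes>\<^sub>M borel)"
    unfolding G_def using cJ by (intro borel_measurable_SUP) measurable
  have G_meas[measurable]: "G r \<in> borel_measurable borel" for r
    unfolding G_def using cJ by (intro borel_measurable_SUP) measurable
  have G_comp: "(\<lambda>z. G (- fst z) (samples (snd z))) \<in> borel_measurable (lborel \<Otimes>\<^sub>M E)"
    by (rule measurable_compose[of "\<lambda>z. (samples (snd z), - fst z)", OF _ G_meas2, simplified]) measurable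
  have G_shift: "G 0 (\<lambda>k. drifted (dyadic_time k) \<omega> - drifted s \<omega>) = G 0 (samples \<omega>)" if "\<omega> \<in> space E" for \<omega> s
    unfolding G_def samples_def normalized_path_shift[OF cont[OF that]] ..
  have G_move: "G 0 (\<lambda>k. drifted (dyadic_time k - s) \<omega>) = G (- s) (samples \<omega>)" if \<omega>: "\<omega> \<in> space E" for \<omega> s
  proof -
    have c1: "continuous_on UNIV (\<lambda>t. drifted (t - s) \<omega>)"
      by (rule continuous_on_compose2[OF cont[OF \<omega>]]) (auto intro!: continuous_intros)
    have [measurable]: "(\<lambda>t. drifted t \<omega>) \<in> borel_measurable borel"
      using cont[OF \<omega>] by (rule borel_measurable_continuous_onI)
    have "(\<integral>\<^sup>+t. ennreal (exp (drifted t \<omega>)) \<partial>lborel) = (\<integral>\<^sup>+t. ennreal (exp (drifted (t - s) \<omega>)) \<partial>lborel)"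
      by (subst nn_integral_real_affine[of _ 1 "- s"]) simp_all
    then show ?thesis
      unfolding G_def samples_def normalized_path_continuous[OF cont[OF \<omega>]] normalized_path_continuous[OF c1]
      by simp
  qed
  have "(\<integral>\<^sup>+\<omega>. (SUP t\<in>J. ennreal (c t * exp (drifted t \<omega>))) \<partial>E) =
      (\<integral>\<^sup>+\<omega>. (\<integral>\<^sup>+s. ennreal (exp (drifted s \<omega>)) * G 0 (samples \<omega>) \<partial>lborel) \<partial>E)"
  proof (rule nn_integral_cong_AE)
    show "AE \<omega> in E. (SUP t\<in>J. ennreal (c t * exp (drifted t \<omega>))) =
        (\<integral>\<^sup>+s. ennreal (exp (drifted s \<omega>)) * G 0 (samples \<omega>) \<partial>lborel)"
      using finite_mass AE_space
    proof eventually_elim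
      case (elim \<omega>)
      let ?Z = "\<integral>\<^sup>+t. ennreal (exp (drifted t \<omega>)) \<partial>lborel"
      note c1 = cont[OF elim(2)]
      have [measurable]: "(\<lambda>t. drifted t \<omega>) \<in> borel_measurable borel"
        using c1 by (rule borel_measurable_continuous_onI)
      obtain z where z: "?Z = ennreal z" "z > 0"
        using elim(1) nn_integral_exp_pos[of "\<lambda>t. drifted t \<omega>"] by (cases ?Z) (auto simp: less_le)
      have "(\<integral>\<^sup>+s. ennreal (exp (drifted s \<omega>)) * G 0 (samples \<omega>) \<partial>lborel) = ?Z * G 0 (samples \<omega>)"
        by (rule nn_integral_multc) measurable
      also have "\<dots> = (SUP t\<in>J. ennreal z * ennreal (c t * (exp (drifted t \<omega>) / z)))"
        unfolding G_def samples_def normalized_path_continuous[OF c1] z(1) using z(2)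
        by (cases "J = {}") (auto simp: SUP_mult_left_ennreal bot_ennreal)
      also have "\<dots> = (SUP t\<in>J. ennreal (c t * exp (drifted t \<omega>)))"
      proof (rule SUP_cong)
        fix t assume "t \<in> J"
        then show "ennreal z * ennreal (c t * (exp (drifted t \<omega>) / z)) = ennreal (c t * exp (drifted t \<omega>))"
          using z(2) c[of t] by (simp add: ennreal_mult'[symmetric])
      qed simp
      finally show ?case ..
    qed
  qed
  also have "\<dots> = (\<integral>\<^sup>+s. (\<integral>\<^sup>+\<omega>. ennreal (exp (drifted s \<omega>)) * G 0 (samples \<omega>) \<partial>E) \<partial>lborel)"
    by (rule Fubini') measurable
  also have "\<dots> = (\<integral>\<^sup>+s. (\<integral>\<^sup>+\<omega>. G (- s) (samples \<omega>) \<partial>E) \<partial>lborel)"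
  proof (rule nn_integral_cong)
    fix s
    show "(\<integral>\<^sup>+\<omega>. ennreal (exp (drifted s \<omega>)) * G 0 (samples \<omega>) \<partial>E) = (\<integral>\<^sup>+\<omega>. G (- s) (samples \<omega>) \<partial>E)"
      by (subst tilted_shift_invariant[OF G_meas G_shift]) (auto intro!: nn_integral_cong simp: G_move)
  qed
  also have "\<dots> = (\<integral>\<^sup>+\<omega>. (\<integral>\<^sup>+s. G (- s) (samples \<omega>) \<partial>lborel) \<partial>E)"
    using G_comp by (intro Fubini'[symmetric]) (simp add: case_prod_beta')
  also have "\<dots> = (\<integral>\<^sup>+\<omega>. (\<integral>\<^sup>+u. G u (samples \<omega>) \<partial>lborel) \<partial>E)"
  proof (rule nn_integral_cong)
    fix \<omega>
    have [measurable]: "(\<lambda>u. G u (samples \<omega>)) \<in> borel_measurable borel"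
      using measurable_compose[OF measurable_Pair1'[of "samples \<omega>" borel borel] G_meas2] by simp
    show "(\<integral>\<^sup>+s. G (- s) (samples \<omega>) \<partial>lborel) = (\<integral>\<^sup>+u. G u (samples \<omega>) \<partial>lborel)"
      by (subst (2) nn_integral_real_affine[of _ "-1" 0]) simp_all
  qed
  also have "\<dots> = (\<integral>\<^sup>+z. G (snd z) (fst z) \<partial>(sample_law \<Otimes>\<^sub>M lborel))"
    by (subst nn_integral_sample_law_pair) simp_all
  finally show ?thesis by (simp add: G_def)
qed

end

end

section \<open>Existence of the mixed moving maxima representation\<close>

text \<open>Lists all data of a point configuration, the number of points of each cell and the coordinates of the candidate points,
  in one real sequence.\<close>

definition encode_configuration :: "(nat \<Rightarrow> nat \<times> (nat \<Rightarrow> real \<times> (nat \<Rightarrow> real) \<times> real)) \<Rightarrow> nat \<Rightarrow> real" where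
  "encode_configuration \<omega> n =
    (let (m, p) = prod_decode n; (k, j) = prod_decode p; z = snd (\<omega> m) k in
     if j = 0 then real (fst (\<omega> m)) else if j = 1 then fst z else if j = 2 then snd (snd z) else fst (snd z) (j - 3))"

lemma inj_encode_configuration: "inj encode_configuration"
proof (rule injI)
  fix \<omega> \<eta> assume "encode_configuration \<omega> = encode_configuration \<eta>"
  then have eq: "encode_configuration \<omega> (prod_encode (m, prod_encode (k, j))) =
      encode_configuration \<eta> (prod_encode (m, prod_encode (k, j)))" for m k j by simp
  have "fst (\<omega> m) = fst (\<eta> m)" for m
    using eq[of m 0 0] by (simp add: encode_configuration_def)
  moreover have "snd (\<omega> m) k = snd (\<eta> m) k" for m k
  proof -
    have "fst (snd (snd (\<omega> m) k)) i = fst (snd (snd (\<eta> m) k)) i" for i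
      using eq[of m k "i + 3"] by (simp add: encode_configuration_def)
    then have "fst (snd (snd (\<omega> m) k)) = fst (snd (snd (\<eta> m) k))" by blast
    then show ?thesis
      using eq[of m k 1] eq[of m k 2] by (simp add: encode_configuration_def prod_eq_iff)
  qed
  ultimately show "\<omega> = \<eta>" by (simp add: fun_eq_iff prod_eq_iff)
qed

lemma exists_sup_measure_over_sequences:
  fixes \<nu> :: "(nat \<Rightarrow> real) measure"
  assumes \<nu>: "prob_space \<nu>"
  obtains Q :: "(nat \<Rightarrow> real) measure" and M where
    "frechet_sup_measure Q (\<nu> \<Otimes>\<^sub>M (lborel :: real measure)) M"
    "\<And>f. integrable (\<nu> \<Otimes>\<^sub>M (lborel :: real measure)) f \<Longrightarrow> (\<And>s. s \<in> space (\<nu> \<Otimes>\<^sub>M (lborel :: real measure)) \<Longrightarrow> f s \<ge> 0) \<Longrightarrow>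
      \<exists>Y. has_extremal_integral Q (\<nu> \<Otimes>\<^sub>M (lborel :: real measure)) M f Y"
proof -
  let ?S = "\<nu> \<Otimes>\<^sub>M (lborel :: real measure)"
  note cells = unit_cells_prob_pair[OF \<nu> unit_cells_lborel]
  obtain Q :: "(nat \<Rightarrow> nat \<times> (nat \<Rightarrow> real \<times> (nat \<Rightarrow> real) \<times> real)) measure" and pts
    where "poisson_avoidance Q ((lborel :: real measure) \<Otimes>\<^sub>M ?S) pts"
    by (rule unit_cells_poisson_avoidance[OF unit_cells_pair[OF unit_cells_lborel cells]])
  note pts = poisson_avoidance_embed[OF this inj_encode_configuration]
  note fin = unit_cells_sigma_finite[OF cells]
  show thesis
  proof (rule that[OF frechet_point_sup_measure[OF pts fin]])
    fix f :: "(nat \<Rightarrow> real) \<times> real \<Rightarrow> real"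
    assume "integrable ?S f" "\<And>s. s \<in> space ?S \<Longrightarrow> f s \<ge> 0"
    then have "has_extremal_integral (embed_measure Q encode_configuration) ?S
        (point_sup_measure (\<lambda>\<omega>. pts (inv encode_configuration \<omega>))) f
        (\<lambda>\<omega>. enn2real (SUP z\<in>pts (inv encode_configuration \<omega>). spectral_weight f z))"
      by (rule has_extremal_integral_point_sup_measure[OF pts fin])
    then show "\<exists>Y. has_extremal_integral (embed_measure Q encode_configuration) ?S
        (point_sup_measure (\<lambda>\<omega>. pts (inv encode_configuration \<omega>))) f Y"
      by (intro exI)
  qed
qed

text \<open>The two families of spectral functions give the same expected maxima, hence the same process.\<close>

lemma (in stationary_increments_gaussian) brown_resnick_mixed_moving_maxima:
  assumes cont: "\<And>\<omega>. \<omega> \<in> space E \<Longrightarrow> continuous_on UNIV (\<lambda>t. drifted t \<omega>)"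
    and fin: "AE \<omega> in E. (\<integral>\<^sup>+t. ennreal (exp (drifted t \<omega>)) \<partial>lborel) < \<infinity>"
    and X: "extremal_representation P X Q E M (brown_resnick_spectral_function E W)"
  shows "has_mixed_moving_maxima_representation P X"
proof -
  let ?\<nu> = sample_law
  let ?S = "?\<nu> \<Otimes>\<^sub>M (lborel :: real measure)"
  interpret \<nu>: prob_space ?\<nu> by (rule prob_space_sample_law)
  have \<nu>_sets[measurable_cong]: "sets ?\<nu> = sets borel"
    by (simp add: sample_law_def)
  let ?f = "\<lambda>t (x, u). normalized_path (x, t + u)"
  have meas: "?f t \<in> borel_measurable ?S" for t by measurable
  have int: "integrable ?S (?f t)" for t
  proof (rule integrableI_nonneg[OF meas])
    have "(\<integral>\<^sup>+z. ennreal (?f t z) \<partial>?S) = (\<integral>\<^sup>+x. (\<integral>\<^sup>+u. ennreal (normalized_path (x, t + u)) \<partial>lborel) \<partial>?\<nu>)"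
      using lborel.nn_integral_fst[of "\<lambda>z. ennreal (?f t z)" ?\<nu>] meas[of t] by simp
    also have "\<dots> = (\<integral>\<^sup>+x. (\<integral>\<^sup>+u. ennreal (normalized_path (x, u)) \<partial>lborel) \<partial>?\<nu>)"
    proof (rule nn_integral_cong)
      fix x
      show "(\<integral>\<^sup>+u. ennreal (normalized_path (x, t + u)) \<partial>lborel) = (\<integral>\<^sup>+u. ennreal (normalized_path (x, u)) \<partial>lborel)"
        by (subst (2) nn_integral_real_affine[of _ 1 t]) simp_all
    qed
    also have "\<dots> = (\<integral>\<^sup>+z. ennreal (normalized_path z) \<partial>?S)"
      by (rule lborel.nn_integral_fst) measurable
    also have "\<dots> = 1" by (rule nn_integral_normalized_path[OF cont fin])
    finally show "(\<integral>\<^sup>+z. ennreal (?f t z) \<partial>?S) < \<infinity>" by simp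
  qed auto
  obtain Q' :: "(nat \<Rightarrow> real) measure" and M' where M': "frechet_sup_measure Q' ?S M'"
    and ex: "\<And>f. integrable ?S f \<Longrightarrow> (\<And>s. s \<in> space ?S \<Longrightarrow> f s \<ge> 0) \<Longrightarrow> \<exists>Y. has_extremal_integral Q' ?S M' f Y"
  proof (rule exists_sup_measure_over_sequences[OF \<nu>.prob_space_axioms])
    fix R N
    assume "frechet_sup_measure (R :: (nat \<Rightarrow> real) measure) ?S N"
      and "\<And>f. integrable ?S f \<Longrightarrow> (\<And>s. s \<in> space ?S \<Longrightarrow> f s \<ge> 0) \<Longrightarrow> \<exists>Y. has_extremal_integral R ?S N f Y"
    then show thesis by (rule that)
  qed
  have "\<forall>t. \<exists>Y. has_extremal_integral Q' ?S M' (?f t) Y"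
    using int by (intro allI ex) auto
  then obtain Y' where Y': "\<And>t. has_extremal_integral Q' ?S M' (?f t) (Y' t)" by metis
  from X obtain Y where M: "frechet_sup_measure Q E M" and P: "real_process P X"
    and Y: "\<And>t. has_extremal_integral Q E M (brown_resnick_spectral_function E W t) (Y t)"
    and XY: "eq_fdd P X Q Y"
    by (auto simp: extremal_representation_def)
  have "eq_fdd Q Y Q' Y'"
  proof (rule eq_fdd_extremal_integrals[OF M M' Y Y'])
    fix J and c :: "real \<Rightarrow> real" assume "finite J" "\<And>t. t \<in> J \<Longrightarrow> c t > 0"
    then show "(\<integral>\<^sup>+s. (SUP t\<in>J. ennreal (c t * brown_resnick_spectral_function E W t s)) \<partial>E) =
        (\<integral>\<^sup>+s. (SUP t\<in>J. ennreal (c t * ?f t s)) \<partial>?S)"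
      using spectral_SUP_eq_moving_maxima[OF cont fin, of J c]
      by (simp add: brown_resnick_spectral_function_eq case_prod_beta')
  qed
  with XY have "eq_fdd P X Q' Y'" by (simp add: eq_fdd_def)
  then have "extremal_representation P X Q' ?S M' ?f"
    unfolding extremal_representation_def using P M' Y' by blast
  then have "mixed_moving_maxima_representation P X Q' ?\<nu> M' normalized_path"
    unfolding mixed_moving_maxima_representation_def
    using \<nu>_sets \<nu>.sigma_finite_measure_axioms nn_integral_normalized_path[OF cont fin]
    by (auto, measurable)
  then show ?thesis
    unfolding has_mixed_moving_maxima_representation_def by blast
qed

section \<open>Fractional Brownian motion\<close>

lemma summable_exp_minus_powr:
  assumes "a > 0" "c > 0"
  shows "summable (\<lambda>n. exp (- c * real n powr a))"
proof (rule summable_comparison_test_bigo)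
  show "summable (\<lambda>n. norm (1 / real n ^ 2))"
    using inverse_power_summable[of 2, where 'a=real] by (simp add: field_simps)
  show "(\<lambda>n. exp (- c * real n powr a)) \<in> O(\<lambda>n. 1 / real n ^ 2)"
    using assms by real_asymp
qed

theorem proposition7p1:
  fixes P :: "'w measure" and X :: "real \<Rightarrow> 'w \<Rightarrow> real"
    and E :: "'e measure" and W :: "real \<Rightarrow> 'e \<Rightarrow> real"
    and Q :: "'q measure" and M :: "'e set \<Rightarrow> 'q \<Rightarrow> ennreal"
    and H \<sigma> :: real
  assumes "0 < H" and "H \<le> 1" and "\<sigma> > 0"
    and "fractional_brownian_motion E W H \<sigma>"
    and "brown_resnick_process P X E W Q M"
  shows "purely_dissipative P X Q E M (brown_resnick_spectral_function E W) \<and>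
         has_mixed_moving_maxima_representation P X"
proof -
  define v where "v t = \<sigma>\<^sup>2 * \<bar>t\<bar> powr (2 * H)" for t :: real
  interpret stationary_increments_gaussian E W v
    using assms(1,4)
    by unfold_locales (auto simp: fractional_brownian_motion_def v_def field_simps)
  have X: "extremal_representation P X Q E M (brown_resnick_spectral_function E W)"
    and W: "\<And>\<omega>. \<omega> \<in> space E \<Longrightarrow> continuous_on UNIV (\<lambda>t. W t \<omega>)"
    using assms(5) by (auto simp: brown_resnick_process_def)
  have "continuous_on UNIV v"
    unfolding v_def using assms(1)
    by (auto intro!: continuous_on_mult_left continuous_on_powr' continuous_on_rabs continuous_on_id continuous_on_const)
  then have cont: "\<And>\<omega>. \<omega> \<in> space E \<Longrightarrow> continuous_on UNIV (\<lambda>t. drifted t \<omega>)"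
    unfolding drifted_def by (intro continuous_intros W) auto
  note jm = measurable_continuous_process[OF measurable_drifted cont]
  have fin: "AE \<omega> in E. (\<integral>\<^sup>+t. ennreal (exp (drifted t \<omega>)) \<partial>lborel) < \<infinity>"
  proof (rule AE_spectral_integral_finite[OF jm])
    show "v s \<le> v t" if "\<bar>s\<bar> \<le> \<bar>t\<bar>" for s t
      unfolding v_def using that assms(1) by (intro mult_left_mono powr_mono2) auto
    show "summable (\<lambda>n. exp (- v (real n) / 16))"
      using summable_exp_minus_powr[of "2 * H" "\<sigma>\<^sup>2 / 16"] assms(1,3) by (simp add: v_def field_simps)
  qed
  have "jointly_measurable_representation P X Q E M (brown_resnick_spectral_function E W)"
    unfolding jointly_measurable_representation_def
    using X sigma_finite_measure_axioms jm
    by (auto simp: brown_resnick_spectral_function_eq case_prod_beta')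
  then have "purely_dissipative P X Q E M (brown_resnick_spectral_function E W)"
    unfolding purely_dissipative_def using fin by (simp add: brown_resnick_spectral_function_eq)
  with brown_resnick_mixed_moving_maxima[OF cont fin X] show ?thesis by blast
qed

end
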